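(* Let $M$ be a PL $2$-manifold (a surface) with a generic PL function $f\colon M\to\mathbb{R}$. Then every H-critical vertex of $f$ is of one of the following types: 1. a local minimum, H-critical of index $0$ only, with multiplicity $1$; 2. a local maximum, H-critical of index $2$ only, with multiplicity $1$; 3. a saddle point, H-critical of index $1$ only, with arbitrary multiplicity. Moreover, any H-regular vertex is also strongly regular, and any saddle point whose total multiplicity is $1$ is non-degenerate critical.
   Context: A (compact) PL $d$-manifold $M$ (without boundary) is realized as a finite polytopal (e.g. simplicial) complex in which the star of each relatively open cell is PL homeomorphic to an open $d$-ball. A function $f\colon M\to\mathbb{R}$ is generic PL if it is linear on each cell and takes distinct values at distinct vertices. Let $f_a=\{x\mid f(x)\le a\}$. For a vertex $v$ with $f(v)=a$ and a field $\mathbb{F}$: $v$ is H-critical (for $\mathbb F$) if $H_*(f_a,f_a\setminus\{v\};\mathbb{F})\neq0$, and the total rank is its total multiplicity; it is H-critical of index $k$ if $H_k(f_a,f_a\setminus\{v\};\mathbb{F})\neq 0$, and the rank of this group is the multiplicity restricted to index $k$. The vertex $v$ is H-regular if $H_*(f_a,f_a\setminus\{v\};\mathbb{F})=0$ for every field $\mathbb{F}$. A saddle point is an H-critical vertex that is neither a local minimum nor a local maximum. A point $p$ is strongly regular if there is a PL chart around $p$ (with $p$ at the origin) in which $f(x_1,\dots,x_d)=f(p)+x_d$. A vertex $v$ is non-degenerate critical (of index $k$) if there is a PL chart around $v$ (with $v$ at the origin) in which $f(x_1,\dots,x_d)=f(v)-|x_1|-\cdots-|x_k|+|x_{k+1}|+\cdots+|x_d|$.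 *)

theory Defs
  imports
    "HOL-Analysis.Analysis"
    "HOL-Homology.Homology"
    "Jordan_Normal_Form.Missing_VectorSpace"
begin

section \<open>Polytopal complexes and PL manifolds\<close>

text \<open>The conventions for faces are those of the library constant \<^const>\<open>simplicial_complex\<close>:
  the empty polytope is a face of every polytope.\<close>

definition polytopal_complex :: "'a::euclidean_space set set \<Rightarrow> bool" where
  "polytopal_complex K \<longleftrightarrow>
     finite K \<and>
     (\<forall>P\<in>K. polytope P) \<and>
     (\<forall>P\<in>K. \<forall>Q. Q face_of P \<longrightarrow> Q \<in> K) \<and>
     (\<forall>P\<in>K. \<forall>Q\<in>K. (P \<inter> Q) face_of P \<and> (P \<inter> Q) face_of Q)"

definition vertices :: "'a set set \<Rightarrow> 'a set" where
  "vertices K = {v. {v} \<in> K}"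

definition open_star :: "'a::euclidean_space set set \<Rightarrow> 'a set \<Rightarrow> 'a set" where
  "open_star K P = (\<Union>Q\<in>{Q\<in>K. P face_of Q}. rel_interior Q)"

definition affine_on :: "'a::real_vector set \<Rightarrow> ('a \<Rightarrow> 'b::real_vector) \<Rightarrow> bool" where
  "affine_on P g \<longleftrightarrow> (\<exists>l c. linear l \<and> (\<forall>x\<in>P. g x = l x + c))"

text \<open>The domain need not be compact (open stars and charts are not): every point of \<open>X\<close> has a
  neighbourhood in \<open>X\<close> that is a finite union of polytopes on each of which \<open>g\<close> is affine.
  In particular \<open>X\<close> is locally polyhedral and \<open>g\<close> is continuous on \<open>X\<close>.\<close>

definition PL_map :: "'a::euclidean_space set \<Rightarrow> ('a \<Rightarrow> 'b::euclidean_space) \<Rightarrow> bool" where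
  "PL_map X g \<longleftrightarrow>
     (\<forall>x\<in>X. \<exists>\<P> W. finite \<P> \<and> (\<forall>P\<in>\<P>. polytope P \<and> P \<subseteq> X \<and> affine_on P g) \<and>
                   open W \<and> x \<in> W \<and> X \<inter> W \<subseteq> \<Union>\<P>)"

definition PL_homeomorphism ::
  "'a::euclidean_space set \<Rightarrow> 'b::euclidean_space set \<Rightarrow> ('a \<Rightarrow> 'b) \<Rightarrow> ('b \<Rightarrow> 'a) \<Rightarrow> bool" where
  "PL_homeomorphism X Y g h \<longleftrightarrow> homeomorphism X Y g h \<and> PL_map X g \<and> PL_map Y h"

text \<open>The dimension \<open>d\<close> is the cardinality of the index type \<open>'d\<close>.  The relatively open cells are
  the relative interiors of the nonempty members of \<open>K\<close>.\<close>

definition PL_manifold :: "'d::finite itself \<Rightarrow> 'a::euclidean_space set set \<Rightarrow> bool" where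
  "PL_manifold (d :: 'd itself) K \<longleftrightarrow>
     polytopal_complex K \<and>
     (\<forall>P\<in>K. P \<noteq> {} \<longrightarrow>
        (\<exists>g h. PL_homeomorphism (open_star K P) (ball (0 :: real^'d) 1) g h))"

definition generic_PL :: "'a::euclidean_space set set \<Rightarrow> ('a \<Rightarrow> real) \<Rightarrow> bool" where
  "generic_PL K f \<longleftrightarrow> (\<forall>P\<in>K. affine_on P f) \<and> inj_on f (vertices K)"

definition PL_chart_at ::
  "'a::euclidean_space set \<Rightarrow> 'a \<Rightarrow> 'a set \<Rightarrow> ('a \<Rightarrow> real^'d::finite) \<Rightarrow> bool" where
  "PL_chart_at M p U \<phi> \<longleftrightarrow>
     openin (top_of_set M) U \<and> p \<in> U \<and> \<phi> p = 0 \<and>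
     (\<exists>V \<psi>. open V \<and> PL_homeomorphism U V \<phi> \<psi>)"

text \<open>The coordinates of \<^typ>\<open>real^'d\<close> carry no order, so the last coordinate \<open>x\<^sub>d\<close> is rendered
  by some coordinate \<open>i\<close>, and the first \<open>k\<close> coordinates by some set \<open>S\<close> of \<open>k\<close> coordinates;
  a permutation of the coordinates of a chart is again a chart.\<close>

definition strongly_regular ::
  "'d::finite itself \<Rightarrow> 'a::euclidean_space set set \<Rightarrow> ('a \<Rightarrow> real) \<Rightarrow> 'a \<Rightarrow> bool" where
  "strongly_regular (d :: 'd itself) K f p \<longleftrightarrow>
     (\<exists>U (\<phi> :: 'a \<Rightarrow> real^'d) i. PL_chart_at (\<Union>K) p U \<phi> \<and> (\<forall>x\<in>U. f x = f p + \<phi> x $ i))"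

definition nondegenerate_critical ::
  "'d::finite itself \<Rightarrow> 'a::euclidean_space set set \<Rightarrow> ('a \<Rightarrow> real) \<Rightarrow> 'a \<Rightarrow> nat \<Rightarrow> bool" where
  "nondegenerate_critical (d :: 'd itself) K f v k \<longleftrightarrow>
     (\<exists>U (\<phi> :: 'a \<Rightarrow> real^'d) S. PL_chart_at (\<Union>K) v U \<phi> \<and> card S = k \<and>
        (\<forall>x\<in>U. f x = f v - (\<Sum>i\<in>S. \<bar>\<phi> x $ i\<bar>) + (\<Sum>i\<in>-S. \<bar>\<phi> x $ i\<bar>)))"


section \<open>Relative singular homology with coefficients in a field\<close>

text \<open>The homology groups of \<open>HOL-Homology\<close> have integer coefficients.  Here the coefficients are
  an arbitrary \<open>HOL-Algebra\<close> field, which allows quantification over fields; singular simplices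
  and their faces are those of \<open>HOL-Homology\<close>.  The \<open>mult\<close> and \<open>one\<close> fields of a
  module record play no role.\<close>

definition chain_module ::
  "('k, 'm) ring_scheme \<Rightarrow> nat \<Rightarrow> 'a topology \<Rightarrow> ('k, ((nat \<Rightarrow> real) \<Rightarrow> 'a) \<Rightarrow> 'k) module" where
  "chain_module F p X =
     \<lparr>carrier = {c. (\<forall>\<sigma>. c \<sigma> \<in> carrier F) \<and> finite {\<sigma>. c \<sigma> \<noteq> \<zero>\<^bsub>F\<^esub>} \<and>
                    (\<forall>\<sigma>. c \<sigma> \<noteq> \<zero>\<^bsub>F\<^esub> \<longrightarrow> singular_simplex p X \<sigma>)},
      mult = undefined, one = undefined,
      zero = (\<lambda>\<sigma>. \<zero>\<^bsub>F\<^esub>),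
      add = (\<lambda>b c \<sigma>. b \<sigma> \<oplus>\<^bsub>F\<^esub> c \<sigma>),
      smult = (\<lambda>a c \<sigma>. a \<otimes>\<^bsub>F\<^esub> c \<sigma>)\<rparr>"

text \<open>The coefficient of \<open>\<tau>\<close> in the boundary of \<open>c\<close> collects \<open>(-1)\<^sup>k\<close> times the coefficient of
  each \<open>\<sigma>\<close> whose \<open>k\<close>-th face is \<open>\<tau>\<close>.\<close>

definition boundary_map ::
  "('k, 'm) ring_scheme \<Rightarrow> nat \<Rightarrow> (((nat \<Rightarrow> real) \<Rightarrow> 'a) \<Rightarrow> 'k) \<Rightarrow> ((nat \<Rightarrow> real) \<Rightarrow> 'a) \<Rightarrow> 'k" where
  "boundary_map F p c =
     (if p = 0 then (\<lambda>\<tau>. \<zero>\<^bsub>F\<^esub>)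
      else (\<lambda>\<tau>. \<Oplus>\<^bsub>F\<^esub>k\<in>{..p}. (\<ominus>\<^bsub>F\<^esub> \<one>\<^bsub>F\<^esub>) [^]\<^bsub>F\<^esub> k \<otimes>\<^bsub>F\<^esub>
                (\<Oplus>\<^bsub>F\<^esub>\<sigma>\<in>{\<sigma>. c \<sigma> \<noteq> \<zero>\<^bsub>F\<^esub> \<and> singular_face p k \<sigma> = \<tau>}. c \<sigma>)))"

definition relcycles ::
  "('k, 'm) ring_scheme \<Rightarrow> nat \<Rightarrow> 'a topology \<Rightarrow> 'a set \<Rightarrow> (((nat \<Rightarrow> real) \<Rightarrow> 'a) \<Rightarrow> 'k) set" where
  "relcycles F p X S =
     {c \<in> carrier (chain_module F p X).
        boundary_map F p c \<in> carrier (chain_module F (p - 1) (subtopology X S))}"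

definition relboundaries ::
  "('k, 'm) ring_scheme \<Rightarrow> nat \<Rightarrow> 'a topology \<Rightarrow> 'a set \<Rightarrow> (((nat \<Rightarrow> real) \<Rightarrow> 'a) \<Rightarrow> 'k) set" where
  "relboundaries F p X S =
     {boundary_map F (Suc p) d \<oplus>\<^bsub>chain_module F p X\<^esub> e | d e.
        d \<in> carrier (chain_module F (Suc p) X) \<and>
        e \<in> carrier (chain_module F p (subtopology X S))}"

definition quotient_module ::
  "('k, 'c, 'm) module_scheme \<Rightarrow> 'c set \<Rightarrow> ('k, 'c set) module" where
  "quotient_module M N =
     \<lparr>carrier = a_rcosets\<^bsub>M\<^esub> N,
      mult = undefined, one = undefined,
      zero = N,
      add = (\<lambda>A B. A <+>\<^bsub>M\<^esub> B),
      smult = (\<lambda>a A. \<Union>x\<in>A. N +>\<^bsub>M\<^esub> (a \<odot>\<^bsub>M\<^esub> x))\<rparr>"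

definition rel_homology ::
  "('k, 'm) ring_scheme \<Rightarrow> nat \<Rightarrow> 'a topology \<Rightarrow> 'a set \<Rightarrow>
     ('k, (((nat \<Rightarrow> real) \<Rightarrow> 'a) \<Rightarrow> 'k) set) module" where
  "rel_homology F p X S =
     quotient_module ((chain_module F p X)\<lparr>carrier := relcycles F p X S\<rparr>) (relboundaries F p X S)"

definition vs_rank :: "('k, 'm) ring_scheme \<Rightarrow> ('k, 'c, 'n) module_scheme \<Rightarrow> enat" where
  "vs_rank F V = (if vectorspace.fin_dim F V then enat (vectorspace.dim F V) else \<infinity>)"


section \<open>Critical and regular vertices\<close>

definition sublevel :: "'a set set \<Rightarrow> ('a \<Rightarrow> real) \<Rightarrow> real \<Rightarrow> 'a set" where
  "sublevel K f a = {x \<in> \<Union>K. f x \<le> a}"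

definition vertex_homology ::
  "('k, 'm) ring_scheme \<Rightarrow> 'a::euclidean_space set set \<Rightarrow> ('a \<Rightarrow> real) \<Rightarrow> 'a \<Rightarrow> nat \<Rightarrow>
     ('k, (((nat \<Rightarrow> real) \<Rightarrow> 'a) \<Rightarrow> 'k) set) module" where
  "vertex_homology F K f v k =
     rel_homology F k (top_of_set (sublevel K f (f v))) (sublevel K f (f v) - {v})"

definition H_critical_of_index ::
  "('k, 'm) ring_scheme \<Rightarrow> 'a::euclidean_space set set \<Rightarrow> ('a \<Rightarrow> real) \<Rightarrow> 'a \<Rightarrow> nat \<Rightarrow> bool" where
  "H_critical_of_index F K f v k \<longleftrightarrow>
     carrier (vertex_homology F K f v k) \<noteq> {\<zero>\<^bsub>vertex_homology F K f v k\<^esub>}"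

definition H_critical ::
  "('k, 'm) ring_scheme \<Rightarrow> 'a::euclidean_space set set \<Rightarrow> ('a \<Rightarrow> real) \<Rightarrow> 'a \<Rightarrow> bool" where
  "H_critical F K f v \<longleftrightarrow> (\<exists>k. H_critical_of_index F K f v k)"

definition multiplicity_of_index ::
  "('k, 'm) ring_scheme \<Rightarrow> 'a::euclidean_space set set \<Rightarrow> ('a \<Rightarrow> real) \<Rightarrow> 'a \<Rightarrow> nat \<Rightarrow> enat" where
  "multiplicity_of_index F K f v k = vs_rank F (vertex_homology F K f v k)"

definition total_multiplicity ::
  "('k, 'm) ring_scheme \<Rightarrow> 'a::euclidean_space set set \<Rightarrow> ('a \<Rightarrow> real) \<Rightarrow> 'a \<Rightarrow> enat" where
  "total_multiplicity F K f v = suminf (multiplicity_of_index F K f v)"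

text \<open>HOL cannot quantify over the fields of all types inside a formula.  The fields with carrier
  in \<^typ>\<open>nat\<close> are, up to isomorphism, all countable fields and hence include all prime fields;
  since homology over a field is obtained from homology over its prime field by extension of
  scalars, vanishing over these fields is the same as vanishing over every field.\<close>

definition H_regular ::
  "'a::euclidean_space set set \<Rightarrow> ('a \<Rightarrow> real) \<Rightarrow> 'a \<Rightarrow> bool" where
  "H_regular K f v \<longleftrightarrow> (\<forall>F :: nat ring. field F \<longrightarrow> \<not> H_critical F K f v)"

definition local_minimum :: "'a::euclidean_space set set \<Rightarrow> ('a \<Rightarrow> real) \<Rightarrow> 'a \<Rightarrow> bool" where
  "local_minimum K f v \<longleftrightarrow> (\<exists>W. open W \<and> v \<in> W \<and> (\<forall>x\<in>\<Union>K \<inter> W. f v \<le> f x))"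

definition local_maximum :: "'a::euclidean_space set set \<Rightarrow> ('a \<Rightarrow> real) \<Rightarrow> 'a \<Rightarrow> bool" where
  "local_maximum K f v \<longleftrightarrow> (\<exists>W. open W \<and> v \<in> W \<and> (\<forall>x\<in>\<Union>K \<inter> W. f x \<le> f v))"

definition saddle_point ::
  "('k, 'm) ring_scheme \<Rightarrow> 'a::euclidean_space set set \<Rightarrow> ('a \<Rightarrow> real) \<Rightarrow> 'a \<Rightarrow> bool" where
  "saddle_point F K f v \<longleftrightarrow>
     v \<in> vertices K \<and> H_critical F K f v \<and> \<not> local_minimum K f v \<and> \<not> local_maximum K f v"

end

theory Submission imports Defs
begin

text \<open>By definition of a surface, the open star of a vertex \<open>v\<close> is PL homeomorphic to a disc in the plane.
  Near the origin \<open>f - f v\<close> becomes positively homogeneous and linear on the sectors of a fan, and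
  by genericity it has no other local extremum with value \<open>0\<close>. On the unit circle it therefore is
  positive, negative, or changes sign exactly at \<open>2 n\<close> angles with \<open>n > 0\<close>. By excision
  the homology of the pair at \<open>v\<close> is that of a point, of a disc relative to the complement of its
  centre, or of a cone relative to the complement of its apex, which is a union of \<open>n\<close> disjoint
  contractible sectors; the rank is \<open>1\<close> in degree \<open>0\<close>, \<open>1\<close> in degree \<open>2\<close>, or
  \<open>n - 1\<close> in degree \<open>1\<close>, over the integers and hence over every field. Two germs with the same number of
  sign changes differ by a homeomorphism of the plane which is linear on the sectors of a fan; for
  \<open>n = 1\<close> and \<open>n = 2\<close> the models are \<open>y\<close> and \<open>\<bar>y\<bar> - \<bar>x\<bar>\<close>.\<close>

section \<open>Vector space dimension of a quotient\<close>

text \<open>Excision, additivity and homotopy invariance are applied to integral homology only. The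
  passage to a field happens on chains: when the integral relative homology is free and concentrated
  in one degree, every singular simplex splits by integral formulas, and these extend linearly to
  any coefficients, so neither a torsion term nor excision over the field enters. The chart at
  \<open>v\<close> is only piecewise linear, so the cells of the star lose their shape under it. Two
  facts survive: \<open>f\<close> is affine on finitely many polytopes around the origin, and near
  any other point of the star it takes values above and below its value there, a condition on open
  sets. \<open>pl_circle\<close> records just these; they force the zeros on the circle to be
  isolated and to be sign changes, and periodicity makes their number even. The sublevel set is
  closed, so the pieces of the punctured cone are closed sectors; open positive sectors between them
  keep them disjoint. For the normal forms, the rays of two fans are matched so that zeros go to
  zeros; on all other rays the length of the image vector absorbs the quotient of the two
  functions.\<close>

lemma (in field) finsum_pointwise:
  assumes "finite A" "\<And>v. v \<in> A \<Longrightarrow> g v \<in> carrier (func_space S)" "i \<in> S"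
  shows "(\<Oplus>\<^bsub>func_space S\<^esub>v\<in>A. g v) i = (\<Oplus>v\<in>A. g v i)"
proof -
  interpret W: module R "func_space S" by (rule func_space_is_module)
  show ?thesis using assms(1,2)
  proof (induction A rule: finite_induct)
    case empty
    have "finsum (func_space S) g {} = \<zero>\<^bsub>func_space S\<^esub>" by (rule W.finsum_empty)
    then show ?case using assms(3) by (simp add: func_space_def)
  next
    case (insert x A)
    have g: "g x i \<in> carrier R" "(\<lambda>v. g v i) \<in> A \<rightarrow> carrier R"
      using insert.prems assms(3) by (auto simp: func_space_def PiE_iff)
    have "(\<Oplus>\<^bsub>func_space S\<^esub>v\<in>insert x A. g v) = g x \<oplus>\<^bsub>func_space S\<^esub> (\<Oplus>\<^bsub>func_space S\<^esub>v\<in>A. g v)"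
      using insert by (intro W.finsum_insert) auto
    then show ?case using insert g assms(3) by (simp add: func_space_def)
  qed
qed

lemma (in field) func_space_lessThan_dim:
  "vectorspace.fin_dim R (func_space {..<m::nat}) \<and> vectorspace.dim R (func_space {..<m}) = m"
proof -
  let ?S = "{..<m}" let ?W = "func_space ?S"
  have "vectorspace R ?W"
    by (rule vectorspace.func_space_is_vs[of R ?W])
       (simp add: vectorspace_def func_space_is_module field_axioms)
  then interpret W: vectorspace R ?W .
  define \<delta> where "\<delta> i = restrict (\<lambda>j. if j = i then \<one> else \<zero>) ?S" for i :: nat
  let ?A = "\<delta> ` ?S"
  have inj: "inj_on \<delta> ?S"
  proof (rule inj_onI)
    fix i j assume "i \<in> ?S" "j \<in> ?S" "\<delta> i = \<delta> j"
    then have "\<delta> i i = \<delta> j i" by simp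
    with \<open>i \<in> ?S\<close> show "i = j" by (simp add: \<delta>_def split: if_splits)
  qed
  have \<delta>W: "\<delta> i \<in> carrier ?W" for i by (auto simp: \<delta>_def func_space_def)
  \<comment> \<open>The value of a combination at \<open>j\<close> is its coefficient at
    \<open>\<delta> j\<close>; existence and uniqueness of coordinates both come from this.\<close>
  have eval: "W.lincomb a ?A j = a (\<delta> j)" if a: "a \<in> ?A \<rightarrow> carrier R" and j: "j < m" for a j
  proof -
    have sm: "(a v \<odot>\<^bsub>?W\<^esub> v) j = a v \<otimes> v j" for v using j by (simp add: func_space_def)
    have "W.lincomb a ?A j = (\<Oplus>v\<in>?A. (a v \<odot>\<^bsub>?W\<^esub> v) j)"
      unfolding W.lincomb_def
      using a j by (intro finsum_pointwise) (auto intro!: W.smult_closed \<delta>W)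
    also have "\<dots> = (\<Oplus>v\<in>?A. if \<delta> j = v then a v else \<zero>)"
      unfolding sm
    proof (rule finsum_cong')
      fix v assume "v \<in> ?A"
      then obtain i where i: "i < m" "v = \<delta> i" by auto
      have "a v \<in> carrier R" using a \<open>v \<in> ?A\<close> by auto
      moreover have "(\<delta> j = v) = (i = j)" using i j inj by (metis inj_on_eq_iff lessThan_iff)
      moreover have "v j = (if j = i then \<one> else \<zero>)" using i j by (simp add: \<delta>_def)
      ultimately show "a v \<otimes> v j = (if \<delta> j = v then a v else \<zero>)" by auto
    qed (use a in auto)
    also have "\<dots> = a (\<delta> j)"
      using a j by (intro finsum_singleton) auto
    finally show ?thesis .
  qed
  have "W.basis ?A"
    unfolding W.basis_criterion[OF finite_imageI[OF finite_lessThan] image_subsetI[OF \<delta>W]]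
  proof (intro allI impI ex1I[where P="\<lambda>a. a \<in> ?A \<rightarrow>\<^sub>E carrier R \<and> W.lincomb a ?A = _"])
    fix v assume v: "v \<in> carrier ?W"
    let ?a = "restrict (\<lambda>w. v (inv_into ?S \<delta> w)) ?A"
    have aA: "?a \<in> ?A \<rightarrow>\<^sub>E carrier R"
      using v inj by (auto simp: func_space_def PiE_iff)
    have "W.lincomb ?a ?A = v"
    proof (rule extensionalityI[of _ ?S])
      show "W.lincomb ?a ?A \<in> extensional ?S"
      proof -
        have "W.lincomb ?a ?A \<in> carrier ?W"
          using aA \<delta>W by (intro W.lincomb_closed) auto
        then show ?thesis by (simp add: func_space_def PiE_iff)
      qed
      show "v \<in> extensional ?S" using v by (auto simp: func_space_def PiE_iff)
      fix j assume "j \<in> ?S"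
      then show "W.lincomb ?a ?A j = v j"
        using eval[of ?a j] aA inj by auto
    qed
    then show "?a \<in> ?A \<rightarrow>\<^sub>E carrier R \<and> W.lincomb ?a ?A = v" using aA by simp
    fix b assume b: "b \<in> ?A \<rightarrow>\<^sub>E carrier R \<and> W.lincomb b ?A = v"
    show "b = ?a"
    proof (rule extensionalityI[of _ ?A])
      fix x assume "x \<in> ?A"
      then obtain j where j: "j < m" "x = \<delta> j" by auto
      moreover have "b \<in> ?A \<rightarrow> carrier R" using b by (simp add: PiE_def)
      ultimately show "b x = ?a x" using eval[of b j] b inj by simp
    qed (use b in \<open>auto simp: PiE_iff\<close>)
  qed
  moreover have "card ?A = m" using inj by (simp add: card_image)
  ultimately show ?thesis
    using W.dim_basis[of ?A] by (auto simp: W.fin_dim_def W.basis_def)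
qed

text \<open>The first isomorphism theorem: \<open>L\<close> maps \<open>M\<close> onto the
  m-dimensional coordinate space, encoded as sequences that vanish from index \<open>m\<close> on,
  and \<open>N\<close> is its kernel. The isomorphism is built from the coordinate space to the
  quotient by choosing preimages, so no function on cosets has to be shown well defined.\<close>

lemma vs_rank_quotient_module:
  fixes M :: "('k, 'c, 'm) module_scheme" and L :: "'c \<Rightarrow> nat \<Rightarrow> 'k"
  assumes F: "field F" and M: "module F M"
    and add: "\<And>x y. x \<in> carrier M \<Longrightarrow> y \<in> carrier M \<Longrightarrow> L (x \<oplus>\<^bsub>M\<^esub> y) = (\<lambda>i. L x i \<oplus>\<^bsub>F\<^esub> L y i)"
    and smult: "\<And>a x. a \<in> carrier F \<Longrightarrow> x \<in> carrier M \<Longrightarrow> L (a \<odot>\<^bsub>M\<^esub> x) = (\<lambda>i. a \<otimes>\<^bsub>F\<^esub> L x i)"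
    and im: "L ` carrier M = {a. (\<forall>i. a i \<in> carrier F) \<and> (\<forall>i\<ge>m. a i = \<zero>\<^bsub>F\<^esub>)}"
    and N: "N = {x \<in> carrier M. \<forall>i. L x i = \<zero>\<^bsub>F\<^esub>}"
  shows "vs_rank F (quotient_module M N) = enat m"
    and "carrier (quotient_module M N) = {\<zero>\<^bsub>quotient_module M N\<^esub>} \<longleftrightarrow> m = 0"
proof -
  interpret F: field F by fact
  interpret M: module F M by fact
  let ?Q = "quotient_module M N" let ?W = "F.func_space {..<m}"
  \<comment> \<open>The cosets of \<open>N\<close> are the fibres of \<open>L\<close>; written this
    way, every identity between cosets becomes one between values of \<open>L\<close>.\<close>
  define T where "T x = {y \<in> carrier M. L y = L x}" for x
  have LF: "L x i \<in> carrier F" if "x \<in> carrier M" for x i using im that by blast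
  have Lsub: "L (x \<ominus>\<^bsub>M\<^esub> y) = (\<lambda>i. L x i \<ominus>\<^bsub>F\<^esub> L y i)" if "x \<in> carrier M" "y \<in> carrier M" for x y
  proof
    fix i
    have "L (x \<ominus>\<^bsub>M\<^esub> y) i \<oplus>\<^bsub>F\<^esub> L y i = L x i"
      using add[of "x \<ominus>\<^bsub>M\<^esub> y" y] that 
      by (smt (verit, ccfv_SIG) M.minus_closed M.minus_equality M.minus_eq M.add.inv_solve_right M.add.m_closed M.a_inv_closed M.add.inv_closed M.a_assoc M.l_neg M.r_zero)
    then show "L (x \<ominus>\<^bsub>M\<^esub> y) i = L x i \<ominus>\<^bsub>F\<^esub> L y i"
      using that LF by (metis F.add.inv_solve_right' F.minus_eq M.minus_closed)
  qed
  have L0: "L \<zero>\<^bsub>M\<^esub> = (\<lambda>i. \<zero>\<^bsub>F\<^esub>)"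
    using smult[of "\<zero>\<^bsub>F\<^esub>" "\<zero>\<^bsub>M\<^esub>"] LF by (simp add: fun_eq_iff)
  have coset: "N +>\<^bsub>M\<^esub> x = T x" if x: "x \<in> carrier M" for x
  proof
    show "N +>\<^bsub>M\<^esub> x \<subseteq> T x"
      using x add LF by (auto simp: a_r_coset_def' N T_def)
    show "T x \<subseteq> N +>\<^bsub>M\<^esub> x"
    proof
      fix y assume y: "y \<in> T x"
      then have "y \<ominus>\<^bsub>M\<^esub> x \<in> N" using x Lsub[of y x] LF by (auto simp: T_def N)
      moreover have "y = (y \<ominus>\<^bsub>M\<^esub> x) \<oplus>\<^bsub>M\<^esub> x"
        using x y by (simp add: T_def M.minus_eq M.a_assoc M.l_neg)
      ultimately show "y \<in> N +>\<^bsub>M\<^esub> x" by (auto simp: a_r_coset_def')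
    qed
  qed
  have Tself: "x \<in> T x" if "x \<in> carrier M" for x using that by (simp add: T_def)
  have Teq: "T x = T y \<longleftrightarrow> L x = L y" if "x \<in> carrier M" "y \<in> carrier M" for x y
    using that by (auto simp: T_def)
  have cQ: "carrier ?Q = T ` carrier M"
    using coset by (auto simp: quotient_module_def A_RCOSETS_def')
  have zQ: "\<zero>\<^bsub>?Q\<^esub> = T \<zero>\<^bsub>M\<^esub>"
    by (auto simp: quotient_module_def T_def N L0 fun_eq_iff)
  have aQ: "T x \<oplus>\<^bsub>?Q\<^esub> T y = T (x \<oplus>\<^bsub>M\<^esub> y)" if x: "x \<in> carrier M" and y: "y \<in> carrier M" for x y
  proof -
    have "z \<in> T x <+>\<^bsub>M\<^esub> T y" if z: "z \<in> T (x \<oplus>\<^bsub>M\<^esub> y)" for z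
    proof -
      have zM: "z \<in> carrier M" using z by (simp add: T_def)
      have "L (z \<ominus>\<^bsub>M\<^esub> y) = L x"
      proof -
        have "L z i = L x i \<oplus>\<^bsub>F\<^esub> L y i" for i using z add[OF x y] by (simp add: T_def)
        then show ?thesis unfolding Lsub[OF zM y]
          using LF x y by (auto simp: fun_eq_iff F.minus_eq F.a_assoc F.r_neg)
      qed
      then have "z \<ominus>\<^bsub>M\<^esub> y \<in> T x" using zM y by (simp add: T_def)
      moreover have "z = (z \<ominus>\<^bsub>M\<^esub> y) \<oplus>\<^bsub>M\<^esub> y"
        using zM y by (simp add: M.minus_eq M.a_assoc M.l_neg)
      ultimately show ?thesis using Tself[OF y] by (auto simp: set_add_def')
    qed
    then show ?thesis
      using x y add by (auto simp: quotient_module_def set_add_def' T_def)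
  qed
  have sQ: "a \<odot>\<^bsub>?Q\<^esub> T x = T (a \<odot>\<^bsub>M\<^esub> x)" if a: "a \<in> carrier F" and x: "x \<in> carrier M" for a x
  proof -
    have "N +>\<^bsub>M\<^esub> (a \<odot>\<^bsub>M\<^esub> y) = T (a \<odot>\<^bsub>M\<^esub> x)" if "y \<in> T x" for y
      using that a x smult coset[of "a \<odot>\<^bsub>M\<^esub> y"] by (auto simp: T_def)
    then show ?thesis using Tself[OF x] by (auto simp: quotient_module_def)
  qed
  \<comment> \<open>A preimage under \<open>L\<close> of a coordinate vector. It is not linear
    itself, but \<open>T\<close> of it is, since \<open>T\<close> depends on the value of
    \<open>L\<close> only.\<close>
  define r where "r v = (SOME x. x \<in> carrier M \<and> (\<forall>i<m. L x i = v i))" for v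
  have r: "r v \<in> carrier M \<and> (\<forall>i<m. L (r v) i = v i)" if "v \<in> carrier ?W" for v
  proof -
    have "(\<lambda>i. if i < m then v i else \<zero>\<^bsub>F\<^esub>) \<in> L ` carrier M"
      unfolding im using that by (auto simp: F.func_space_def PiE_iff)
    then obtain x where x: "x \<in> carrier M" "L x = (\<lambda>i. if i < m then v i else \<zero>\<^bsub>F\<^esub>)" by auto
    show ?thesis unfolding r_def by (rule someI[of _ x]) (use x in auto)
  qed
  have Lext: "L x = L y" if "x \<in> carrier M" "y \<in> carrier M" "\<And>i. i < m \<Longrightarrow> L x i = L y i" for x y
  proof
    fix i
    have "\<forall>i\<ge>m. L x i = \<zero>\<^bsub>F\<^esub>" "\<forall>i\<ge>m. L y i = \<zero>\<^bsub>F\<^esub>" using im that by blast+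
    then show "L x i = L y i" using that(3)[of i] by (cases "i < m") auto
  qed
  have W: "vectorspace F ?W"
    by (rule vectorspace.func_space_is_vs[of F ?W])
       (simp add: vectorspace_def F.func_space_is_module F.field_axioms)
  interpret W: vectorspace F ?W by fact
  have "module F ?Q"
  proof (rule module_criteria)
    show "\<forall>v\<in>carrier ?Q. \<exists>w\<in>carrier ?Q. v \<oplus>\<^bsub>?Q\<^esub> w = \<zero>\<^bsub>?Q\<^esub>"
    proof
      fix v assume "v \<in> carrier ?Q"
      then obtain x where x: "x \<in> carrier M" "v = T x" by (auto simp: cQ)
      then have "v \<oplus>\<^bsub>?Q\<^esub> T (\<ominus>\<^bsub>M\<^esub> x) = \<zero>\<^bsub>?Q\<^esub>" by (simp add: aQ zQ M.r_neg)
      then show "\<exists>w\<in>carrier ?Q. v \<oplus>\<^bsub>?Q\<^esub> w = \<zero>\<^bsub>?Q\<^esub>"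
        using x unfolding cQ by blast
    qed
    show "\<forall>v w. v \<in> carrier ?Q \<and> w \<in> carrier ?Q \<longrightarrow> v \<oplus>\<^bsub>?Q\<^esub> w = w \<oplus>\<^bsub>?Q\<^esub> v"
      using M.add.m_comm by (auto simp: cQ aQ)
  qed (auto simp: F.is_cring cQ zQ aQ sQ M.add.m_assoc M.smult_assoc1 M.smult_l_distr M.smult_r_distr)
  then have "vectorspace F ?Q" by (simp add: vectorspace_def F.field_axioms)
  then interpret Q: vectorspace F ?Q .
  have lin: "linear_map F ?W ?Q (\<lambda>v. T (r v))"
    unfolding linear_map_def mod_hom_def mod_hom_axioms_def module_hom_def
  proof (intro conjI CollectI W Q.vectorspace_axioms W.module_axioms Q.module_axioms allI impI)
    show "(\<lambda>v. T (r v)) \<in> carrier ?W \<rightarrow> carrier ?Q" using r by (auto simp: cQ)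
    fix v w assume vw: "v \<in> carrier ?W \<and> w \<in> carrier ?W"
    have "L (r (v \<oplus>\<^bsub>?W\<^esub> w)) = L (r v \<oplus>\<^bsub>M\<^esub> r w)"
      using vw r[of v] r[of w] r[of "v \<oplus>\<^bsub>?W\<^esub> w"] W.add.m_closed[of v w]
      by (intro Lext) (auto simp: add F.func_space_def)
    then show "T (r (v \<oplus>\<^bsub>?W\<^esub> w)) = T (r v) \<oplus>\<^bsub>?Q\<^esub> T (r w)"
      using vw r by (simp add: aQ Teq)
  next
    fix a v assume av: "a \<in> carrier F \<and> v \<in> carrier ?W"
    have "L (r (a \<odot>\<^bsub>?W\<^esub> v)) = L (a \<odot>\<^bsub>M\<^esub> r v)"
      using av r[of v] r[of "a \<odot>\<^bsub>?W\<^esub> v"] W.smult_closed[of a v]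
      by (intro Lext) (auto simp: smult F.func_space_def)
    then show "T (r (a \<odot>\<^bsub>?W\<^esub> v)) = a \<odot>\<^bsub>?Q\<^esub> T (r v)"
      using av r by (simp add: sQ Teq)
  qed
  have inj: "inj_on (\<lambda>v. T (r v)) (carrier ?W)"
  proof (rule inj_onI)
    fix v w assume vw: "v \<in> carrier ?W" "w \<in> carrier ?W" "T (r v) = T (r w)"
    then have "\<forall>i<m. v i = w i" using r by (metis Teq)
    then show "v = w" using vw by (intro PiE_ext[of v "{..<m}" "\<lambda>_. carrier F" w]) (auto simp: F.func_space_def)
  qed
  have surj: "(\<lambda>v. T (r v)) ` carrier ?W = carrier ?Q"
  proof
    show "(\<lambda>v. T (r v)) ` carrier ?W \<subseteq> carrier ?Q" using r by (auto simp: cQ)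
    show "carrier ?Q \<subseteq> (\<lambda>v. T (r v)) ` carrier ?W"
    proof
      fix A assume "A \<in> carrier ?Q"
      then obtain x where x: "x \<in> carrier M" "A = T x" by (auto simp: cQ)
      have v: "restrict (L x) {..<m} \<in> carrier ?W" using LF x by (auto simp: F.func_space_def)
      have "L (r (restrict (L x) {..<m})) = L x"
        using r[OF v] x by (intro Lext) auto
      then have "A = T (r (restrict (L x) {..<m}))" using x r[OF v] by (simp add: Teq)
      then show "A \<in> (\<lambda>v. T (r v)) ` carrier ?W" using v by blast
    qed
  qed
  have "Q.fin_dim" "Q.dim = m"
    using linear_map.surj_fin_dim[OF lin _ surj] linear_map.dim_eq[OF lin _ inj surj]
      F.func_space_lessThan_dim[of m] by auto
  then show "vs_rank F ?Q = enat m" by (simp add: vs_rank_def)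
  show "carrier ?Q = {\<zero>\<^bsub>?Q\<^esub>} \<longleftrightarrow> m = 0"
  proof
    assume "m = 0"
    then have "L x = L \<zero>\<^bsub>M\<^esub>" if "x \<in> carrier M" for x using that by (intro Lext) auto
    then have "T x = T \<zero>\<^bsub>M\<^esub>" if "x \<in> carrier M" for x
      using that by (metis M.zero_closed Teq)
    then show "carrier ?Q = {\<zero>\<^bsub>?Q\<^esub>}" unfolding cQ zQ
      using M.zero_closed by (blast intro: image_eqI)
  next
    assume Q1: "carrier ?Q = {\<zero>\<^bsub>?Q\<^esub>}"
    show "m = 0"
    proof (rule ccontr)
      assume "m \<noteq> 0"
      then have "(\<lambda>i. if i = 0 then \<one>\<^bsub>F\<^esub> else \<zero>\<^bsub>F\<^esub>) \<in> L ` carrier M" unfolding im by auto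
      then obtain x where x: "x \<in> carrier M" "L x = (\<lambda>i. if i = 0 then \<one>\<^bsub>F\<^esub> else \<zero>\<^bsub>F\<^esub>)"
        by (metis (no_types, lifting) imageE)
      have "T x = T \<zero>\<^bsub>M\<^esub>" using Q1 x unfolding cQ zQ by blast
      then have "L x = L \<zero>\<^bsub>M\<^esub>" using x Teq by (metis M.zero_closed)
      then have "L x 0 = \<zero>\<^bsub>F\<^esub>" by (simp add: L0)
      then show False using x by simp
    qed
  qed
qed

section \<open>Extension of integral chain maps to field coefficients\<close>

context field
begin

definition finsupp :: "('x \<Rightarrow> 'a) set" where
  "finsupp = {c. (\<forall>x. c x \<in> carrier R) \<and> finite {x. c x \<noteq> \<zero>}}"

text \<open>This is \<open>frag_extend t\<close> tensored with the field: an integer coefficient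
  acts through its image in the field, whatever the characteristic.\<close>

definition lin_ext :: "('x \<Rightarrow> ('y \<Rightarrow>\<^sub>0 int)) \<Rightarrow> ('x \<Rightarrow> 'a) \<Rightarrow> 'y \<Rightarrow> 'a" where
  "lin_ext t c = (\<lambda>y. \<Oplus>x\<in>{x. c x \<noteq> \<zero>}. c x \<otimes> [poly_mapping.lookup (t x) y] \<cdot> \<one>)"

text \<open>The elementary tensor of the scalar \<open>a\<close> with the integral chain
  \<open>u\<close>.\<close>

definition scalar_frag :: "'a \<Rightarrow> ('x \<Rightarrow>\<^sub>0 int) \<Rightarrow> 'x \<Rightarrow> 'a" where
  "scalar_frag a u = (\<lambda>x. a \<otimes> [poly_mapping.lookup u x] \<cdot> \<one>)"

lemma add_pow_int_zero [simp]: "[(0::int)] \<cdot> x = \<zero>"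
  by (simp add: add_pow_int_ge)

lemma scalar_frag_add:
  "a \<in> carrier R \<Longrightarrow> scalar_frag a (u + v) = (\<lambda>x. scalar_frag a u x \<oplus> scalar_frag a v x)"
  by (simp add: scalar_frag_def lookup_add add.int_pow_mult r_distr)

lemma scalar_frag_closed [simp]: "a \<in> carrier R \<Longrightarrow> scalar_frag a u x \<in> carrier R"
  by (simp add: scalar_frag_def)

lemma scalar_frag_0 [simp]: "a \<in> carrier R \<Longrightarrow> scalar_frag a 0 = (\<lambda>x. \<zero>)"
  by (simp add: scalar_frag_def)

lemma scalar_frag_of [simp]:
  "a \<in> carrier R \<Longrightarrow> scalar_frag a (frag_of x) = (\<lambda>y. if y = x then a else \<zero>)"
  by (auto simp: scalar_frag_def fun_eq_iff)

lemma scalar_frag_support: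
  assumes "a \<in> carrier R" "scalar_frag a u x \<noteq> \<zero>" shows "x \<in> Poly_Mapping.keys u"
  using assms by (force simp: scalar_frag_def in_keys_iff)

lemma finsupp_scalar_frag: "a \<in> carrier R \<Longrightarrow> scalar_frag a u \<in> finsupp"
  unfolding finsupp_def
  using finite_subset[of "{x. scalar_frag a u x \<noteq> \<zero>}" "Poly_Mapping.keys u"] scalar_frag_support
  by force

lemma lin_ext_superset:
  assumes "finite A" "{x. c x \<noteq> \<zero>} \<subseteq> A" "c \<in> finsupp"
  shows "lin_ext t c y = (\<Oplus>x\<in>A. c x \<otimes> [poly_mapping.lookup (t x) y] \<cdot> \<one>)"
  unfolding lin_ext_def
  using assms by (intro add.finprod_mono_neutral_cong_left) (auto simp: finsupp_def)

lemma finsupp_add: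
  assumes "c \<in> finsupp" "d \<in> finsupp" shows "(\<lambda>x. c x \<oplus> d x) \<in> finsupp"
proof -
  have "{x. c x \<oplus> d x \<noteq> \<zero>} \<subseteq> {x. c x \<noteq> \<zero>} \<union> {x. d x \<noteq> \<zero>}"
    using assms by (auto simp: finsupp_def)
  then show ?thesis
    using assms finite_subset by (fastforce simp: finsupp_def)
qed

lemma finsupp_smult:
  assumes "c \<in> finsupp" "a \<in> carrier R" shows "(\<lambda>x. a \<otimes> c x) \<in> finsupp"
proof -
  have "{x. a \<otimes> c x \<noteq> \<zero>} \<subseteq> {x. c x \<noteq> \<zero>}"
    using assms by (auto simp: finsupp_def)
  then show ?thesis
    using assms finite_subset by (fastforce simp: finsupp_def)
qed

lemma finsupp_zero: "(\<lambda>x. \<zero>) \<in> finsupp"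
  by (simp add: finsupp_def)

lemma lin_ext_closed: "c \<in> finsupp \<Longrightarrow> lin_ext t c y \<in> carrier R"
  unfolding lin_ext_def by (intro finsum_closed) (auto simp: finsupp_def)

lemma lin_ext_add:
  assumes c: "c \<in> finsupp" and d: "d \<in> finsupp"
  shows "lin_ext t (\<lambda>x. c x \<oplus> d x) = (\<lambda>y. lin_ext t c y \<oplus> lin_ext t d y)"
proof
  fix y
  let ?A = "{x. c x \<noteq> \<zero>} \<union> {x. d x \<noteq> \<zero>}"
  have A: "finite ?A" using c d by (simp add: finsupp_def)
  have cd: "c x \<in> carrier R" "d x \<in> carrier R" for x using c d by (auto simp: finsupp_def)
  have "lin_ext t (\<lambda>x. c x \<oplus> d x) y = (\<Oplus>x\<in>?A. (c x \<oplus> d x) \<otimes> [poly_mapping.lookup (t x) y] \<cdot> \<one>)"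
    using cd by (intro lin_ext_superset A finsupp_add c d) auto
  also have "\<dots> = (\<Oplus>x\<in>?A. c x \<otimes> [poly_mapping.lookup (t x) y] \<cdot> \<one> \<oplus> d x \<otimes> [poly_mapping.lookup (t x) y] \<cdot> \<one>)"
    using cd by (intro finsum_cong') (auto simp: l_distr)
  also have "\<dots> = (\<Oplus>x\<in>?A. c x \<otimes> [poly_mapping.lookup (t x) y] \<cdot> \<one>) \<oplus> (\<Oplus>x\<in>?A. d x \<otimes> [poly_mapping.lookup (t x) y] \<cdot> \<one>)"
    using cd by (intro finsum_addf) auto
  also have "\<dots> = lin_ext t c y \<oplus> lin_ext t d y"
    using lin_ext_superset[OF A _ c, of t y] lin_ext_superset[OF A _ d, of t y] by auto
  finally show "lin_ext t (\<lambda>x. c x \<oplus> d x) y = lin_ext t c y \<oplus> lin_ext t d y" .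
qed

lemma lin_ext_smult:
  assumes c: "c \<in> finsupp" and a: "a \<in> carrier R"
  shows "lin_ext t (\<lambda>x. a \<otimes> c x) = (\<lambda>y. a \<otimes> lin_ext t c y)"
proof
  fix y
  let ?A = "{x. c x \<noteq> \<zero>}"
  have A: "finite ?A" using c by (simp add: finsupp_def)
  have cR: "c x \<in> carrier R" for x using c by (auto simp: finsupp_def)
  have "lin_ext t (\<lambda>x. a \<otimes> c x) y = (\<Oplus>x\<in>?A. (a \<otimes> c x) \<otimes> [poly_mapping.lookup (t x) y] \<cdot> \<one>)"
    using cR a by (intro lin_ext_superset A finsupp_smult c) auto
  also have "\<dots> = (\<Oplus>x\<in>?A. a \<otimes> (c x \<otimes> [poly_mapping.lookup (t x) y] \<cdot> \<one>))"
    using cR a by (intro finsum_cong') (auto simp: m_assoc)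
  also have "\<dots> = a \<otimes> lin_ext t c y"
    unfolding lin_ext_def using cR a A by (intro finsum_rdistr[symmetric]) auto
  finally show "lin_ext t (\<lambda>x. a \<otimes> c x) y = a \<otimes> lin_ext t c y" .
qed

lemma lin_ext_single:
  assumes "a \<in> carrier R"
  shows "lin_ext t (\<lambda>y. if y = x then a else \<zero>) = scalar_frag a (t x)"
proof
  fix y
  have "lin_ext t (\<lambda>y. if y = x then a else \<zero>) y = (\<Oplus>z\<in>{x}. (if z = x then a else \<zero>) \<otimes> [poly_mapping.lookup (t z) y] \<cdot> \<one>)"
    using assms by (intro lin_ext_superset) (auto simp: finsupp_def)
  then show "lin_ext t (\<lambda>y. if y = x then a else \<zero>) y = scalar_frag a (t x) y"
    using assms by (simp add: scalar_frag_def)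
qed

text \<open>The intermediate chains are restrictions of \<open>c\<close> to subsets of its support.
  Keeping their support inside that of \<open>c\<close> makes hypotheses about the generators that
  occur in \<open>c\<close> available in each step.\<close>

lemma finsupp_induct [consumes 1, case_names zero add]:
  assumes c: "c \<in> finsupp" and zero: "P (\<lambda>x. \<zero>)"
    and add: "\<And>d a x. d \<in> finsupp \<Longrightarrow> a \<in> carrier R \<Longrightarrow> c x \<noteq> \<zero> \<Longrightarrow> (\<And>y. d y \<noteq> \<zero> \<Longrightarrow> c y \<noteq> \<zero>) \<Longrightarrow> P d \<Longrightarrow>
      P (\<lambda>y. d y \<oplus> (if y = x then a else \<zero>))"
  shows "P c"
proof -
  have cR: "c x \<in> carrier R" for x using c by (simp add: finsupp_def)
  have fin: "finite {x. c x \<noteq> \<zero>}" using c by (simp add: finsupp_def)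
  have "P (\<lambda>x. if x \<in> A then c x else \<zero>)" if "A \<subseteq> {x. c x \<noteq> \<zero>}" "finite A" for A
    using that(2,1)
  proof (induction A rule: finite_induct)
    case empty
    then show ?case using zero by simp
  next
    case (insert x A)
    let ?d = "\<lambda>x. if x \<in> A then c x else \<zero>"
    have "?d \<in> finsupp" using insert(1) cR by (simp add: finsupp_def)
    then have "P (\<lambda>y. ?d y \<oplus> (if y = x then c x else \<zero>))"
      using insert cR by (intro add) (auto split: if_splits)
    moreover have "(\<lambda>y. ?d y \<oplus> (if y = x then c x else \<zero>)) = (\<lambda>y. if y \<in> insert x A then c y else \<zero>)"
      using insert(2) cR by (auto simp: fun_eq_iff)
    ultimately show ?case by simp
  qed
  from this[OF subset_refl fin] show ?thesis
    by (auto elim!: back_subst[of P] simp: fun_eq_iff)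
qed

lemma lin_ext_zero [simp]: "lin_ext t (\<lambda>x. \<zero>) = (\<lambda>y. \<zero>)"
  by (simp add: lin_ext_def)

lemma finsupp_single: "a \<in> carrier R \<Longrightarrow> (\<lambda>y. if y = x then a else \<zero>) \<in> finsupp"
  by (simp add: finsupp_def)

lemma finsupp_lin_ext:
  assumes c: "c \<in> finsupp" and t: "\<And>x. c x \<noteq> \<zero> \<Longrightarrow> Poly_Mapping.keys (t x) \<subseteq> K"
  shows "lin_ext t c \<in> finsupp \<and> (\<forall>y. lin_ext t c y \<noteq> \<zero> \<longrightarrow> y \<in> K)"
  using c
proof (induction rule: finsupp_induct)
  case zero
  then show ?case by (simp add: finsupp_zero)
next
  case (add d a x)
  then have "lin_ext t (\<lambda>y. d y \<oplus> (if y = x then a else \<zero>)) = (\<lambda>y. lin_ext t d y \<oplus> scalar_frag a (t x) y)"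
    by (simp add: lin_ext_add lin_ext_single finsupp_single)
  then show ?case
    using add t[of x] scalar_frag_support[of a "t x"]
    by (auto simp: finsupp_add finsupp_scalar_frag) (metis l_zero subset_iff zero_closed)
qed

lemma scalar_frag_minus:
  assumes a: "a \<in> carrier R" shows "scalar_frag a (u - v) = (\<lambda>x. scalar_frag a u x \<ominus> scalar_frag a v x)"
proof
  fix x
  have "scalar_frag a u x = scalar_frag a (u - v) x \<oplus> scalar_frag a v x"
    using fun_cong[OF scalar_frag_add[OF a, of "u - v" v], of x] by simp
  then show "scalar_frag a (u - v) x = scalar_frag a u x \<ominus> scalar_frag a v x"
    using a by (simp add: minus_eq a_assoc r_neg)
qed

lemma lin_ext_scalar_frag:
  assumes a: "a \<in> carrier R"
  shows "lin_ext s (scalar_frag a u) = scalar_frag a (frag_extend s u)"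
proof -
  have "Poly_Mapping.keys u \<subseteq> UNIV" by simp
  then show ?thesis
  proof (induction u rule: frag_induction)
    case (diff u v)
    \<comment> \<open>\<open>frag_induction\<close> proceeds by differences while the extension is
      known to respect sums, so \<open>u\<close> is written as \<open>(u - v) + v\<close> and the
      second summand is cancelled.\<close>
    have "scalar_frag a u = (\<lambda>x. scalar_frag a (u - v) x \<oplus> scalar_frag a v x)"
      using scalar_frag_add[OF a, of "u - v" v] by simp
    then have "lin_ext s (scalar_frag a u) = (\<lambda>x. lin_ext s (scalar_frag a (u - v)) x \<oplus> lin_ext s (scalar_frag a v) x)"
      using lin_ext_add[OF finsupp_scalar_frag[OF a] finsupp_scalar_frag[OF a]] by metis
    then have eq: "scalar_frag a (frag_extend s u) x = lin_ext s (scalar_frag a (u - v)) x \<oplus> scalar_frag a (frag_extend s v) x" for x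
      using diff by metis
    have "lin_ext s (scalar_frag a (u - v)) x = scalar_frag a (frag_extend s (u - v)) x" for x
      using a lin_ext_closed[OF finsupp_scalar_frag[OF a], of s "u - v" x] eq[of x]
      unfolding frag_extend_diff scalar_frag_minus[OF a, of "frag_extend s u"] by (simp add: minus_eq a_assoc r_neg)
    then show ?case by blast
  qed (use a in \<open>auto simp: lin_ext_single\<close>)
qed

text \<open>Functoriality of the change of coefficients. Together with \<open>lin_ext_plus\<close>
  it carries identities between integral chain maps over to the field.\<close>

lemma lin_ext_compose:
  assumes "c \<in> finsupp"
  shows "lin_ext s (lin_ext t c) = lin_ext (\<lambda>x. frag_extend s (t x)) c"
  using assms
proof (induction rule: finsupp_induct)
  case (add d a x)
  then show ?case
    using finsupp_lin_ext[OF add(1), of t UNIV]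
    by (simp add: lin_ext_add lin_ext_single finsupp_single finsupp_scalar_frag lin_ext_scalar_frag)
qed simp

lemma lin_ext_plus:
  assumes "c \<in> finsupp"
  shows "lin_ext (\<lambda>x. t x + u x) c = (\<lambda>y. lin_ext t c y \<oplus> lin_ext u c y)"
  using assms
proof (induction rule: finsupp_induct)
  case (add d a x)
  then show ?case
    by (simp add: lin_ext_add lin_ext_single finsupp_single scalar_frag_add fun_eq_iff
        lin_ext_closed add.m_ac)
qed simp

lemma lin_ext_cong:
  assumes "c \<in> finsupp" "\<And>x. c x \<noteq> \<zero> \<Longrightarrow> t x = u x"
  shows "lin_ext t c = lin_ext u c"
  using assms unfolding lin_ext_def
  by (intro ext finsum_cong') (auto simp: finsupp_def)

lemma lin_ext_frag_of: "c \<in> finsupp \<Longrightarrow> lin_ext frag_of c = c"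
proof (induction rule: finsupp_induct)
  case (add d a x)
  then show ?case by (simp add: lin_ext_add lin_ext_single finsupp_single)
qed simp

lemma lin_ext_eq_zero:
  assumes "c \<in> finsupp" "\<And>x. c x \<noteq> \<zero> \<Longrightarrow> t x = 0"
  shows "lin_ext t c = (\<lambda>y. \<zero>)"
proof -
  have "lin_ext t c = lin_ext (\<lambda>x. 0) c" by (rule lin_ext_cong[OF assms])
  also have "\<dots> = (\<lambda>y. \<zero>)"
    unfolding lin_ext_def using assms
    by (intro ext finsum_zero') (auto simp: finsupp_def)
  finally show ?thesis .
qed

text \<open>The sum in \<open>boundary_map\<close> runs over the face index first and over the
  simplices second; exchanging the two sums exhibits the integral boundary of each simplex, with the
  signs read in the field.\<close>

lemma boundary_map_eq_lin_ext:
  assumes c: "c \<in> finsupp"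
  shows "boundary_map R p c = lin_ext (\<lambda>\<sigma>. chain_boundary p (frag_of \<sigma>)) c"
proof (cases "p = 0")
  case True
  then show ?thesis using c by (subst lin_ext_eq_zero) (auto simp: boundary_map_def chain_boundary_def)
next
  case False
  have cR: "c \<sigma> \<in> carrier R" for \<sigma> using c by (simp add: finsupp_def)
  define sg where "sg k = (\<ominus> \<one>) [^] k" for k :: nat
  have sgR: "sg k \<in> carrier R" for k by (simp add: sg_def)
  have sgi: "[((-1) ^ k :: int)] \<cdot> \<one> = sg k" for k
  proof (induction k)
    case 0
    then show ?case by (simp add: sg_def)
  next
    case (Suc k)
    have "[((-1) ^ Suc k :: int)] \<cdot> \<one> = \<ominus> ([((-1) ^ k :: int)] \<cdot> \<one>)"
      using add.int_pow_neg[of \<one> "(-1)^k"] by simp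
    also have "\<dots> = sg (Suc k)"
      using sgR[of k] unfolding Suc by (simp add: sg_def nat_pow_Suc r_minus)
    finally show ?case .
  qed
  have "boundary_map R p c \<tau> = lin_ext (\<lambda>\<sigma>. chain_boundary p (frag_of \<sigma>)) c \<tau>" for \<tau>
  proof -
    \<comment> \<open>The support of \<open>c\<close> is replaced by an arbitrary finite set
      \<open>A\<close>, so that the induction adds one simplex at a time while \<open>c\<close>
      itself stays fixed.\<close>
    have *: "(\<Oplus>k\<in>{..p}. sg k \<otimes> (\<Oplus>\<sigma>\<in>{\<sigma>\<in>A. singular_face p k \<sigma> = \<tau>}. c \<sigma>)) =
        (\<Oplus>\<sigma>\<in>A. c \<sigma> \<otimes> [poly_mapping.lookup (chain_boundary p (frag_of \<sigma>)) \<tau>] \<cdot> \<one>)"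
      if "finite A" for A
      using that
    proof (induction A rule: finite_induct)
      case empty
      then show ?case using sgR by (simp cong: finsum_cong add: finsum_zero)
    next
      case (insert \<rho> A)
      have sum_k: "[poly_mapping.lookup (\<Sum>k\<in>B. frag_cmul ((-1)^k) (frag_of (singular_face p k \<rho>))) \<tau>] \<cdot> \<one>
            = (\<Oplus>k\<in>B. sg k \<otimes> (if singular_face p k \<rho> = \<tau> then \<one> else \<zero>))" if "finite B" for B
        using that
      proof (induction B rule: finite_induct)
        case (insert k B)
        then show ?case
          using sgR by (simp add: lookup_add add.int_pow_mult sgi)
      qed simp
      have step: "sg k \<otimes> (\<Oplus>\<sigma>\<in>{\<sigma>\<in>insert \<rho> A. singular_face p k \<sigma> = \<tau>}. c \<sigma>)
          = c \<rho> \<otimes> (sg k \<otimes> (if singular_face p k \<rho> = \<tau> then \<one> else \<zero>)) \<oplus> sg k \<otimes> (\<Oplus>\<sigma>\<in>{\<sigma>\<in>A. singular_face p k \<sigma> = \<tau>}. c \<sigma>)" for k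
      proof (cases "singular_face p k \<rho> = \<tau>")
        case True
        then have "{\<sigma>\<in>insert \<rho> A. singular_face p k \<sigma> = \<tau>} = insert \<rho> {\<sigma>\<in>A. singular_face p k \<sigma> = \<tau>}" by auto
        then show ?thesis using True insert cR sgR[of k]
          by (simp add: finsum_insert r_distr m_comm)
      next
        case F: False
        then have "{\<sigma>\<in>insert \<rho> A. singular_face p k \<sigma> = \<tau>} = {\<sigma>\<in>A. singular_face p k \<sigma> = \<tau>}" by auto
        then show ?thesis using F insert cR sgR[of k] by simp
      qed
      have "(\<Oplus>k\<in>{..p}. sg k \<otimes> (\<Oplus>\<sigma>\<in>{\<sigma>\<in>insert \<rho> A. singular_face p k \<sigma> = \<tau>}. c \<sigma>))
         = (\<Oplus>k\<in>{..p}. c \<rho> \<otimes> (sg k \<otimes> (if singular_face p k \<rho> = \<tau> then \<one> else \<zero>)))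
           \<oplus> (\<Oplus>k\<in>{..p}. sg k \<otimes> (\<Oplus>\<sigma>\<in>{\<sigma>\<in>A. singular_face p k \<sigma> = \<tau>}. c \<sigma>))"
        unfolding step using cR sgR by (intro finsum_addf) auto
      also have "(\<Oplus>k\<in>{..p}. c \<rho> \<otimes> (sg k \<otimes> (if singular_face p k \<rho> = \<tau> then \<one> else \<zero>)))
         = c \<rho> \<otimes> [poly_mapping.lookup (chain_boundary p (frag_of \<rho>)) \<tau>] \<cdot> \<one>"
        using cR sgR False by (simp add: chain_boundary_of sum_k finsum_rdistr Pi_def)
      finally show ?case
        unfolding insert.IH using insert cR by (simp add: finsum_insert)
    qed
    have "finite {\<sigma>. c \<sigma> \<noteq> \<zero>}" using c by (simp add: finsupp_def)
    from *[OF this] show ?thesis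
      using False by (simp add: boundary_map_def lin_ext_def sg_def)
  qed
  then show ?thesis by blast
qed

end

section \<open>Relative homology with field coefficients from integral homology\<close>

text \<open>The classes of the \<open>z i\<close> with \<open>i < m\<close> form a basis of the
  integral relative homology in degree \<open>k\<close>, and the other degrees vanish. It is phrased
  with chains rather than cosets because the next step extracts explicit chains from it.\<close>

definition free_homology :: "nat \<Rightarrow> nat \<Rightarrow> (nat \<Rightarrow> 'a chain) \<Rightarrow> 'a topology \<Rightarrow> 'a set \<Rightarrow> bool" where
  "free_homology k m z X S \<longleftrightarrow>
     (\<forall>p c. p \<noteq> k \<longrightarrow> singular_relcycle p X S c \<longrightarrow> singular_relboundary p X S c) \<and>
     (\<forall>i<m. singular_relcycle k X S (z i)) \<and>
     (\<forall>c. singular_relcycle k X S c \<longrightarrow>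
        (\<exists>n. Poly_Mapping.keys n \<subseteq> {..<m} \<and> singular_relboundary k X S (c - frag_extend z n))) \<and>
     (\<forall>n. Poly_Mapping.keys n \<subseteq> {..<m} \<longrightarrow> singular_relboundary k X S (frag_extend z n) \<longrightarrow> n = 0)"

lemma frag_extend_frag_extend: "frag_extend s (frag_extend t x) = frag_extend (\<lambda>a. frag_extend s (t a)) x"
proof -
  have "Poly_Mapping.keys x \<subseteq> UNIV" by simp
  then show ?thesis by (induction x rule: frag_induction) (simp_all add: frag_extend_diff)
qed

lemma frag_extend_chain_boundary:
  fixes s :: "'b \<Rightarrow> 'a chain"
  shows "frag_extend (\<lambda>\<sigma>. chain_boundary p (s \<sigma>)) c = chain_boundary p (frag_extend s c)"
proof (cases "p = 0")
  case True
  have "chain_boundary 0 x = 0" for x :: "'a chain" by (simp add: chain_boundary_def)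
  then show ?thesis using True frag_extend_eq_0[of c "\<lambda>\<sigma>. 0"] by simp
next
  case False
  have "chain_boundary p x = frag_extend (\<lambda>f. \<Sum>k\<le>p. frag_cmul ((-1) ^ k) (frag_of (singular_face p k f))) x"
    for x :: "'a chain" using False by (simp add: chain_boundary_def)
  then show ?thesis by (simp only: frag_extend_frag_extend)
qed

lemma chain_boundary_frag_extend: "chain_boundary p c = frag_extend (\<lambda>\<sigma>. chain_boundary p (frag_of \<sigma>)) c"
  by (subst frag_extend_chain_boundary) (simp only: frag_expansion[symmetric])

text \<open>Degree by degree, a singular simplex is decomposed into a boundary, a correction pulled back
  from its own boundary, a combination of the cycles \<open>z i\<close>, and a chain of \<open>S\<close>; only the vanishing
  of the homology in lower degrees enters, so no freeness of subgroups is required.\<close>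

lemma free_homology_contraction:
  assumes fh: "free_homology k m z X S"
  obtains s :: "nat \<Rightarrow> _ \<Rightarrow> 'a chain" and \<nu> where
    "\<And>p \<sigma>. singular_simplex p X \<sigma> \<Longrightarrow> singular_chain (Suc p) X (s p \<sigma>)"
    "\<And>p \<sigma>. singular_simplex p (subtopology X S) \<sigma> \<Longrightarrow> s p \<sigma> = 0 \<and> \<nu> p \<sigma> = 0"
    "\<And>p \<sigma>. Poly_Mapping.keys (\<nu> p \<sigma>) \<subseteq> {..<m} \<and> (p \<noteq> k \<longrightarrow> \<nu> p \<sigma> = 0)"
    "\<And>p \<sigma>. singular_simplex (Suc p) X \<sigma> \<Longrightarrow> frag_extend (\<nu> p) (chain_boundary (Suc p) (frag_of \<sigma>)) = 0"
    "\<And>p \<sigma>. singular_simplex p X \<sigma> \<Longrightarrow> singular_chain p (subtopology X S)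
       (frag_of \<sigma> - chain_boundary (Suc p) (s p \<sigma>) - frag_extend (s (p - 1)) (chain_boundary p (frag_of \<sigma>))
         - frag_extend z (\<nu> p \<sigma>))"
    "\<And>i. i < m \<Longrightarrow> frag_extend (\<nu> k) (z i) = frag_of i"
proof -
  have zz: "\<And>i. i < m \<Longrightarrow> singular_relcycle k X S (z i)"
    and indep: "\<And>n. Poly_Mapping.keys n \<subseteq> {..<m} \<Longrightarrow> singular_relboundary k X S (frag_extend z n) \<Longrightarrow> n = 0"
    using fh by (auto simp: free_homology_def)
  have E: "\<exists>d n. singular_chain (Suc p) X d \<and> Poly_Mapping.keys n \<subseteq> {..<m} \<and> (p \<noteq> k \<longrightarrow> n = 0) \<and>
      singular_chain p (subtopology X S) (c - chain_boundary (Suc p) d - frag_extend z n)"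
    if c: "singular_relcycle p X S c" for p c
  proof -
    obtain n where n: "Poly_Mapping.keys n \<subseteq> {..<m}" "p \<noteq> k \<longrightarrow> n = 0"
      and b: "singular_relboundary p X S (c - frag_extend z n)"
    proof (cases "p = k")
      case True
      then show ?thesis using that fh c by (auto simp: free_homology_def)
    next
      case False
      then have "singular_relboundary p X S c" using fh c by (auto simp: free_homology_def)
      then show ?thesis using that[of 0] by simp
    qed
    from b obtain d e where "singular_chain (Suc p) X d" "singular_chain p (subtopology X S) e"
      "chain_boundary (Suc p) d + e = c - frag_extend z n" unfolding singular_relboundary by blast
    moreover from this(3) have "e = c - chain_boundary (Suc p) d - frag_extend z n"
      by (simp add: algebra_simps)
    ultimately show ?thesis using n by auto
  qed
  \<comment> \<open>The last clause decomposes absolute cycles only. This is what the next degree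
    consumes, since there it is applied to the boundary of a simplex; the decomposition of a general
    simplex also involves the preceding degree and belongs to \<open>Step\<close>.\<close>
  define Good where "Good p sn \<longleftrightarrow> (case sn of (s, \<nu>) \<Rightarrow>
      (\<forall>\<sigma>. singular_simplex p X \<sigma> \<longrightarrow> singular_chain (Suc p) X (s \<sigma>)) \<and>
      (\<forall>\<sigma>. singular_simplex p (subtopology X S) \<sigma> \<longrightarrow> s \<sigma> = 0 \<and> \<nu> \<sigma> = 0) \<and>
      (\<forall>\<sigma>. Poly_Mapping.keys (\<nu> \<sigma>) \<subseteq> {..<m} \<and> (p \<noteq> k \<longrightarrow> \<nu> \<sigma> = 0)) \<and>
      (\<forall>c. singular_chain p X c \<longrightarrow> chain_boundary p c = 0 \<longrightarrow>
         singular_chain p (subtopology X S) (c - chain_boundary (Suc p) (frag_extend s c) - frag_extend z (frag_extend \<nu> c))))"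
    for p and sn :: "(((nat \<Rightarrow> real) \<Rightarrow> 'a) \<Rightarrow> 'a chain) \<times> (((nat \<Rightarrow> real) \<Rightarrow> 'a) \<Rightarrow> nat \<Rightarrow>\<^sub>0 int)"
  \<comment> \<open>A relation between consecutive degrees: the correction in degree
    \<open>Suc p\<close> refers to the particular \<open>s\<close> already chosen in degree
    \<open>p\<close>, hence the dependent choice below.\<close>
  define Step where "Step p sn sn' \<longleftrightarrow> (case sn of (s, \<nu>) \<Rightarrow> case sn' of (s', \<nu>') \<Rightarrow>
      (\<forall>\<sigma>. singular_simplex (Suc p) X \<sigma> \<longrightarrow>
         frag_extend \<nu> (chain_boundary (Suc p) (frag_of \<sigma>)) = 0 \<and>
         singular_chain (Suc p) (subtopology X S)
           (frag_of \<sigma> - chain_boundary (Suc (Suc p)) (s' \<sigma>) - frag_extend s (chain_boundary (Suc p) (frag_of \<sigma>))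
             - frag_extend z (\<nu>' \<sigma>))))"
    for p and sn sn' :: "(((nat \<Rightarrow> real) \<Rightarrow> 'a) \<Rightarrow> 'a chain) \<times> (((nat \<Rightarrow> real) \<Rightarrow> 'a) \<Rightarrow> nat \<Rightarrow>\<^sub>0 int)"
  have lin: "singular_chain p (subtopology X S)
      (c - chain_boundary (Suc p) (frag_extend s' c) - frag_extend s (chain_boundary p c) - frag_extend z (frag_extend \<nu>' c))"
    if s: "\<And>\<sigma>. singular_simplex p X \<sigma> \<Longrightarrow> singular_chain p (subtopology X S)
       (frag_of \<sigma> - chain_boundary (Suc p) (s' \<sigma>) - frag_extend s (chain_boundary p (frag_of \<sigma>)) - frag_extend z (\<nu>' \<sigma>))"
      and c: "singular_chain p X c"
    for p c s' \<nu>' and s :: "((nat \<Rightarrow> real) \<Rightarrow> 'a) \<Rightarrow> 'a chain"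
  proof -
    have "Poly_Mapping.keys c \<subseteq> singular_simplex_set p X" using c by (simp add: singular_chain_def)
    then show ?thesis
    proof (induction c rule: frag_induction)
      case (diff a b)
      show ?case
        using singular_chain_diff[OF diff]
        by (simp add: frag_extend_diff chain_boundary_diff algebra_simps)
    qed (use s in auto)
  qed
  have base: "\<exists>sn. Good 0 sn"
  proof -
    have "\<exists>d n. singular_chain (Suc 0) X d \<and> Poly_Mapping.keys n \<subseteq> {..<m} \<and> (0 \<noteq> k \<longrightarrow> n = 0) \<and>
      singular_chain 0 (subtopology X S) (frag_of \<sigma> - chain_boundary (Suc 0) d - frag_extend z n) \<and>
      (singular_simplex 0 (subtopology X S) \<sigma> \<longrightarrow> d = 0 \<and> n = 0)"
      if "singular_simplex 0 X \<sigma>" for \<sigma>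
    proof (cases "singular_simplex 0 (subtopology X S) \<sigma>")
      case True
      then show ?thesis by (intro exI[of _ 0]) (simp add: singular_chain_of)
    next
      case False
      have "singular_relcycle 0 X S (frag_of \<sigma>)"
        using that by (simp add: singular_relcycle singular_chain_of chain_boundary_def)
      from E[OF this] False show ?thesis by auto
    qed
    then obtain s \<nu> where sn: "\<And>\<sigma>. singular_simplex 0 X \<sigma> \<Longrightarrow>
      singular_chain (Suc 0) X (s \<sigma>) \<and> Poly_Mapping.keys (\<nu> \<sigma>) \<subseteq> {..<m} \<and> (0 \<noteq> k \<longrightarrow> \<nu> \<sigma> = 0) \<and>
      singular_chain 0 (subtopology X S) (frag_of \<sigma> - chain_boundary (Suc 0) (s \<sigma>) - frag_extend z (\<nu> \<sigma>)) \<and>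
      (singular_simplex 0 (subtopology X S) \<sigma> \<longrightarrow> s \<sigma> = 0 \<and> \<nu> \<sigma> = (0::nat \<Rightarrow>\<^sub>0 int))" by metis
    \<comment> \<open>The choice says nothing about arguments that are not simplices of
      \<open>X\<close>; the value 0 there makes the bound on the keys hold for every
      argument.\<close>
    define \<nu>' where "\<nu>' \<sigma> = (if singular_simplex 0 X \<sigma> then \<nu> \<sigma> else 0)" for \<sigma>
    have "singular_chain 0 (subtopology X S) (c - chain_boundary (Suc 0) (frag_extend s c) - frag_extend z (frag_extend \<nu>' c))"
      if "singular_chain 0 X c" for c
      using lin[of 0 s "\<lambda>_. 0" \<nu>' c] sn that by (simp add: \<nu>'_def chain_boundary_def)
    then have "Good 0 (s, \<nu>')"
      using sn by (auto simp: Good_def \<nu>'_def singular_simplex_subtopology)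
    then show ?thesis by blast
  qed
  have step: "\<exists>sn'. Good (Suc p) sn' \<and> Step p sn sn'" if G: "Good p sn" for p sn
  proof -
    obtain s \<nu> where sn: "sn = (s, \<nu>)" by (cases sn)
    have s1: "\<And>\<sigma>. singular_simplex p X \<sigma> \<Longrightarrow> singular_chain (Suc p) X (s \<sigma>)"
      and s2: "\<And>\<sigma>. singular_simplex p (subtopology X S) \<sigma> \<Longrightarrow> s \<sigma> = 0 \<and> \<nu> \<sigma> = 0"
      and s3: "\<And>\<sigma>. Poly_Mapping.keys (\<nu> \<sigma>) \<subseteq> {..<m} \<and> (p \<noteq> k \<longrightarrow> \<nu> \<sigma> = 0)"
      and s4: "\<And>c. singular_chain p X c \<Longrightarrow> chain_boundary p c = 0 \<Longrightarrow>
         singular_chain p (subtopology X S) (c - chain_boundary (Suc p) (frag_extend s c) - frag_extend z (frag_extend \<nu> c))"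
      using G by (auto simp: Good_def sn)
    have sc: "singular_chain (Suc p) X (frag_extend s c)" if "singular_chain p X c" for c
      using that s1 by (intro singular_chain_extend) (auto simp: singular_chain_def)
    \<comment> \<open>The boundary of the simplex is a cycle, so \<open>s4\<close> shows that the
      boundary of the corrected chain \<open>?c\<close> is
      \<open>frag_extend z (frag_extend \<nu> ?b)\<close> up to a chain of \<open>S\<close>. In
      degree \<open>k\<close> this makes that combination of the \<open>z i\<close> a relative
      boundary, so independence forces its coefficients to vanish; in the other degrees
      \<open>\<nu>\<close> is zero anyway. Hence \<open>?c\<close> is a relative cycle.\<close>
    have main: "frag_extend \<nu> (chain_boundary (Suc p) (frag_of \<sigma>)) = 0 \<and>
        singular_relcycle (Suc p) X S (frag_of \<sigma> - frag_extend s (chain_boundary (Suc p) (frag_of \<sigma>)))"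
      if \<sigma>: "singular_simplex (Suc p) X \<sigma>" for \<sigma>
    proof -
      let ?b = "chain_boundary (Suc p) (frag_of \<sigma>)"
      let ?c = "frag_of \<sigma> - frag_extend s ?b"
      have ch: "singular_chain (Suc p) X (frag_of \<sigma>)" using \<sigma> by (simp add: singular_chain_of)
      have b: "singular_chain p X ?b" using singular_chain_boundary_alt[OF ch] .
      have bb: "chain_boundary p ?b = 0"
        using chain_boundary_boundary_alt[of p X] ch chain_boundary_boundary[OF ch] by simp
      have cc: "singular_chain (Suc p) X ?c" using ch sc[OF b] by (rule singular_chain_diff)
      have e: "singular_chain p (subtopology X S) (?b - chain_boundary (Suc p) (frag_extend s ?b) - frag_extend z (frag_extend \<nu> ?b))"
        using s4[OF b bb] .
      have keys: "Poly_Mapping.keys (frag_extend \<nu> ?b) \<subseteq> {..<m}"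
        using s3 by (intro subset_trans[OF keys_frag_extend]) blast
      have n0: "frag_extend \<nu> ?b = 0"
      proof (cases "p = k")
        case False
        then show ?thesis using s3 by (intro frag_extend_eq_0) auto
      next
        case True
        have "frag_extend z (frag_extend \<nu> ?b) = chain_boundary (Suc p) ?c +
           - (?b - chain_boundary (Suc p) (frag_extend s ?b) - frag_extend z (frag_extend \<nu> ?b))"
          by (simp add: chain_boundary_diff)
        then have "singular_relboundary k X S (frag_extend z (frag_extend \<nu> ?b))"
          unfolding singular_relboundary
          using cc True singular_chain_minus[of p "subtopology X S"] e by metis
        then show ?thesis using indep[OF keys] by simp
      qed
      then show ?thesis using e cc by (simp add: singular_relcycle chain_boundary_diff)
    qed
    have "\<exists>d n. singular_chain (Suc (Suc p)) X d \<and> Poly_Mapping.keys n \<subseteq> {..<m} \<and> (Suc p \<noteq> k \<longrightarrow> n = 0) \<and>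
      singular_chain (Suc p) (subtopology X S)
        (frag_of \<sigma> - chain_boundary (Suc (Suc p)) d - frag_extend s (chain_boundary (Suc p) (frag_of \<sigma>)) - frag_extend z n) \<and>
      (singular_simplex (Suc p) (subtopology X S) \<sigma> \<longrightarrow> d = 0 \<and> n = 0)"
      if \<sigma>: "singular_simplex (Suc p) X \<sigma>" for \<sigma>
    proof (cases "singular_simplex (Suc p) (subtopology X S) \<sigma>")
      case True
      have "singular_chain p (subtopology X S) (chain_boundary (Suc p) (frag_of \<sigma>))"
        using True by (intro singular_chain_boundary_alt) (simp add: singular_chain_of)
      then have "frag_extend s (chain_boundary (Suc p) (frag_of \<sigma>)) = 0"
        using s2 by (intro frag_extend_eq_0) (auto simp: singular_chain_def)
      then show ?thesis using True by (intro exI[of _ 0]) (simp add: singular_chain_of)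
    next
      case False
      obtain d n where "singular_chain (Suc (Suc p)) X d" "Poly_Mapping.keys n \<subseteq> {..<m}" "Suc p \<noteq> k \<longrightarrow> n = 0"
        "singular_chain (Suc p) (subtopology X S) (frag_of \<sigma> - frag_extend s (chain_boundary (Suc p) (frag_of \<sigma>)) - chain_boundary (Suc (Suc p)) d - frag_extend z n)"
        using E main[OF \<sigma>] by blast
      then show ?thesis using False
        by (intro exI[of _ d] exI[of _ n]) (simp add: algebra_simps)
    qed
    then obtain s' \<nu>0 where sn': "\<And>\<sigma>. singular_simplex (Suc p) X \<sigma> \<Longrightarrow>
      singular_chain (Suc (Suc p)) X (s' \<sigma>) \<and> Poly_Mapping.keys (\<nu>0 \<sigma>) \<subseteq> {..<m} \<and> (Suc p \<noteq> k \<longrightarrow> \<nu>0 \<sigma> = 0) \<and>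
      singular_chain (Suc p) (subtopology X S)
        (frag_of \<sigma> - chain_boundary (Suc (Suc p)) (s' \<sigma>) - frag_extend s (chain_boundary (Suc p) (frag_of \<sigma>)) - frag_extend z (\<nu>0 \<sigma>)) \<and>
      (singular_simplex (Suc p) (subtopology X S) \<sigma> \<longrightarrow> s' \<sigma> = 0 \<and> \<nu>0 \<sigma> = (0::nat \<Rightarrow>\<^sub>0 int))" by metis
    define \<nu>' where "\<nu>' \<sigma> = (if singular_simplex (Suc p) X \<sigma> then \<nu>0 \<sigma> else 0)" for \<sigma>
    have "singular_chain (Suc p) (subtopology X S) (c - chain_boundary (Suc (Suc p)) (frag_extend s' c) - frag_extend z (frag_extend \<nu>' c))"
      if "singular_chain (Suc p) X c" "chain_boundary (Suc p) c = 0" for c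
      using lin[of "Suc p" s' s \<nu>' c] sn' that by (simp add: \<nu>'_def)
    then have "Good (Suc p) (s', \<nu>')"
      using sn' by (auto simp: Good_def \<nu>'_def singular_simplex_subtopology)
    moreover have "Step p sn (s', \<nu>')"
      using sn' main by (auto simp: Step_def sn \<nu>'_def)
    ultimately show ?thesis by blast
  qed
  obtain f where f: "\<And>p. Good p (f p)" "\<And>p. Step p (f p) (f (Suc p))"
    using dependent_nat_choice[of Good Step] base step by metis
  define s where "s p = fst (f p)" for p
  define \<nu> where "\<nu> p = snd (f p)" for p
  have G: "Good p (s p, \<nu> p)" and St: "Step p (s p, \<nu> p) (s (Suc p), \<nu> (Suc p))" for p
    using f by (auto simp: s_def \<nu>_def)
  have dec: "singular_chain p (subtopology X S)
       (frag_of \<sigma> - chain_boundary (Suc p) (s p \<sigma>) - frag_extend (s (p - 1)) (chain_boundary p (frag_of \<sigma>))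
         - frag_extend z (\<nu> p \<sigma>))" if "singular_simplex p X \<sigma>" for p \<sigma>
  proof (cases p)
    case 0
    have "singular_chain 0 X (frag_of \<sigma>)" using that 0 by (simp add: singular_chain_of)
    moreover have "chain_boundary 0 (frag_of \<sigma>) = 0" by (simp add: chain_boundary_def)
    ultimately have "singular_chain 0 (subtopology X S) (frag_of \<sigma> -
        chain_boundary (Suc 0) (frag_extend (s 0) (frag_of \<sigma>)) - frag_extend z (frag_extend (\<nu> 0) (frag_of \<sigma>)))"
      using G[of 0] unfolding Good_def prod.case by blast
    then show ?thesis unfolding 0 \<open>chain_boundary 0 (frag_of \<sigma>) = 0\<close> by simp
  next
    case (Suc q)
    then show ?thesis using that St[of q] by (simp add: Step_def)
  qed
  show ?thesis
  proof (rule that[of s \<nu>])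
    fix i assume i: "i < m"
    let ?n = "frag_extend (\<nu> k) (z i)"
    have zc: "singular_chain k X (z i)" "singular_chain (k - 1) (subtopology X S) (chain_boundary k (z i))"
      using zz[OF i] by (auto simp: singular_relcycle)
    \<comment> \<open>The boundary of \<open>z i\<close> lies in \<open>S\<close>, where the
      correction vanishes. The splitting of \<open>z i\<close> then says that \<open>z i\<close> is
      homologous to the combination with coefficients \<open>?n\<close>, and independence identifies
      \<open>?n\<close>.\<close>
    have "frag_extend (s (k - 1)) (chain_boundary k (z i)) = 0"
      using zc(2) G[of "k - 1"] by (intro frag_extend_eq_0) (auto simp: singular_chain_def Good_def)
    then have e: "singular_chain k (subtopology X S) (z i - chain_boundary (Suc k) (frag_extend (s k) (z i)) - frag_extend z ?n)"
      using lin[OF dec zc(1)] by simp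
    have keys: "Poly_Mapping.keys ?n \<subseteq> {..<m}"
    proof (rule subset_trans[OF keys_frag_extend])
      show "(\<Union>x\<in>Poly_Mapping.keys (z i). Poly_Mapping.keys (\<nu> k x)) \<subseteq> {..<m}"
        using G[of k] unfolding Good_def by blast
    qed
    have "singular_chain (Suc k) X (frag_extend (s k) (z i))"
      using zc(1) G[of k] by (intro singular_chain_extend) (auto simp: singular_chain_def Good_def)
    moreover have "chain_boundary (Suc k) (frag_extend (s k) (z i)) +
        (z i - chain_boundary (Suc k) (frag_extend (s k) (z i)) - frag_extend z ?n) = frag_extend z (frag_of i - ?n)"
    proof -
      have "a + (b - a - c) = b - c" for a b c :: "'a chain" by (simp add: algebra_simps)
      then show ?thesis by (simp only: frag_extend_diff frag_extend_of)
    qed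
    ultimately have "singular_relboundary k X S (frag_extend z (frag_of i - ?n))"
      using e unfolding singular_relboundary by blast
    moreover have "Poly_Mapping.keys (frag_of i - ?n) \<subseteq> {..<m}"
      using keys keys_diff[of "frag_of i" ?n] i by auto
    ultimately have "frag_of i - ?n = 0" using indep by blast
    then show "?n = frag_of i" by simp
  next
    show "frag_extend (\<nu> p) (chain_boundary (Suc p) (frag_of \<sigma>)) = 0" if "singular_simplex (Suc p) X \<sigma>" for p \<sigma>
      using St[of p] that by (simp add: Step_def)
  qed (use G dec in \<open>auto simp: Good_def\<close>)
qed

lemma chain_module_carrier:
  assumes "field F"
  shows "c \<in> carrier (chain_module F p X) \<longleftrightarrow>
    c \<in> field.finsupp F \<and> (\<forall>\<sigma>. c \<sigma> \<noteq> \<zero>\<^bsub>F\<^esub> \<longrightarrow> singular_simplex p X \<sigma>)"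
  using assms by (simp add: chain_module_def field.finsupp_def)

text \<open>\<open>vs_rank_quotient_module\<close> is applied with \<open>L\<close> the extension of
  \<open>\<nu> p\<close>. Relative boundaries lie in its kernel because \<open>\<nu>\<close> kills
  boundaries and simplices of \<open>S\<close>. Conversely the extended splitting writes a relative
  cycle as a boundary, plus a combination of the \<open>z i\<close> with coefficients given by
  \<open>L\<close>, plus a chain of \<open>S\<close>; if \<open>L\<close> vanishes, a relative
  boundary is left. The \<open>z i\<close> themselves give surjectivity.\<close>

lemma rel_homology_free:
  fixes F :: "('k, 'm) ring_scheme"
  assumes F: "field F" and fh: "free_homology k m z X S"
  shows "vs_rank F (rel_homology F p X S) = (if p = k then enat m else 0)"
    and "carrier (rel_homology F p X S) = {\<zero>\<^bsub>rel_homology F p X S\<^esub>} \<longleftrightarrow> p \<noteq> k \<or> m = 0"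
proof -
  interpret field F by fact
  obtain s \<nu> where
    s: "\<And>p \<sigma>. singular_simplex p X \<sigma> \<Longrightarrow> singular_chain (Suc p) X (s p \<sigma>)"
    and sS: "\<And>p \<sigma>. singular_simplex p (subtopology X S) \<sigma> \<Longrightarrow> s p \<sigma> = 0 \<and> \<nu> p \<sigma> = 0"
    and \<nu>: "\<And>p \<sigma>. Poly_Mapping.keys (\<nu> p \<sigma>) \<subseteq> {..<m} \<and> (p \<noteq> k \<longrightarrow> \<nu> p \<sigma> = 0)"
    and \<nu>b: "\<And>p \<sigma>. singular_simplex (Suc p) X \<sigma> \<Longrightarrow> frag_extend (\<nu> p) (chain_boundary (Suc p) (frag_of \<sigma>)) = 0"
    and dec: "\<And>p \<sigma>. singular_simplex p X \<sigma> \<Longrightarrow> singular_chain p (subtopology X S)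
       (frag_of \<sigma> - chain_boundary (Suc p) (s p \<sigma>) - frag_extend (s (p - 1)) (chain_boundary p (frag_of \<sigma>))
         - frag_extend z (\<nu> p \<sigma>))"
    and \<nu>z: "\<And>i. i < m \<Longrightarrow> frag_extend (\<nu> k) (z i) = frag_of i"
    using free_homology_contraction[OF fh] by blast
  note cm = chain_module_carrier[OF F]
  let ?M = "(chain_module F p X)\<lparr>carrier := relcycles F p X S\<rparr>"
  \<comment> \<open>Away from degree \<open>k\<close> the map \<open>\<nu> p\<close> is zero, so one
    argument with \<open>?m = 0\<close> covers the vanishing groups.\<close>
  let ?m = "if p = k then m else 0"
  let ?D = "\<lambda>p \<sigma>. chain_boundary p (frag_of \<sigma>)"
  have mapc: "lin_ext t c \<in> carrier (chain_module F q Y)"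
    if "c \<in> finsupp" "\<And>\<sigma>. c \<sigma> \<noteq> \<zero>\<^bsub>F\<^esub> \<Longrightarrow> singular_chain q Y (t \<sigma>)" for c t q and Y :: "'a topology"
    using finsupp_lin_ext[of c t "singular_simplex_set q Y"] that
    by (auto simp: cm singular_chain_def)
  have fs: "c \<in> finsupp" if "c \<in> relcycles F p X S" for c p
    using that by (simp add: relcycles_def cm)
  have rc: "c \<in> relcycles F q X S \<longleftrightarrow> c \<in> carrier (chain_module F q X) \<and>
      lin_ext (?D q) c \<in> carrier (chain_module F (q - 1) (subtopology X S))" for c q
    by (auto simp: relcycles_def cm boundary_map_eq_lin_ext)
  have ca: "(\<lambda>\<sigma>. c \<sigma> \<oplus>\<^bsub>F\<^esub> d \<sigma>) \<in> carrier (chain_module F q Y)"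
    if "c \<in> carrier (chain_module F q Y)" "d \<in> carrier (chain_module F q Y)" for c d q and Y :: "'a topology"
    using that finsupp_add[of c d] by (auto simp: cm) (metis l_zero zero_closed)
  have cs: "(\<lambda>\<sigma>. a \<otimes>\<^bsub>F\<^esub> c \<sigma>) \<in> carrier (chain_module F q Y)"
    if "c \<in> carrier (chain_module F q Y)" "a \<in> carrier F" for c a q and Y :: "'a topology"
    using that finsupp_smult[of c a] by (auto simp: cm) (metis r_null)
  have ra: "(\<lambda>\<sigma>. c \<sigma> \<oplus>\<^bsub>F\<^esub> d \<sigma>) \<in> relcycles F q X S" if c: "c \<in> relcycles F q X S" and d: "d \<in> relcycles F q X S" for c d q
    unfolding rc lin_ext_add[OF fs[OF c] fs[OF d]] using c d unfolding rc by (intro conjI ca) auto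
  have rs: "(\<lambda>\<sigma>. a \<otimes>\<^bsub>F\<^esub> c \<sigma>) \<in> relcycles F q X S" if c: "c \<in> relcycles F q X S" and a: "a \<in> carrier F" for c a q
    unfolding rc lin_ext_smult[OF fs[OF c] a] using c a unfolding rc by (intro conjI cs) auto
  have rz: "(\<lambda>\<sigma>. \<zero>\<^bsub>F\<^esub>) \<in> relcycles F q X S" for q
    unfolding rc by (simp add: cm finsupp_zero)
  have rF: "c \<sigma> \<in> carrier F" if "c \<in> relcycles F p X S" for c \<sigma>
    using fs[OF that] by (simp add: finsupp_def)
  have M: "module F ?M"
  proof (rule module_criteria)
    show "\<forall>v\<in>carrier ?M. \<exists>w\<in>carrier ?M. v \<oplus>\<^bsub>?M\<^esub> w = \<zero>\<^bsub>?M\<^esub>"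
    proof
      fix v assume v: "v \<in> carrier ?M"
      let ?w = "\<lambda>\<sigma>. (\<ominus>\<^bsub>F\<^esub> \<one>\<^bsub>F\<^esub>) \<otimes>\<^bsub>F\<^esub> v \<sigma>"
      have "?w \<in> carrier ?M" using v rs by simp
      moreover have "v \<oplus>\<^bsub>?M\<^esub> ?w = \<zero>\<^bsub>?M\<^esub>"
        using v rF by (simp add: chain_module_def fun_eq_iff l_minus r_neg)
      ultimately show "\<exists>w\<in>carrier ?M. v \<oplus>\<^bsub>?M\<^esub> w = \<zero>\<^bsub>?M\<^esub>" by blast
    qed
    show "\<forall>v w. v \<in> carrier ?M \<and> w \<in> carrier ?M \<longrightarrow> v \<oplus>\<^bsub>?M\<^esub> w = w \<oplus>\<^bsub>?M\<^esub> v"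
      using rF by (auto simp: chain_module_def fun_eq_iff a_comm)
  qed (auto simp: is_cring chain_module_def ra rs rz rF fun_eq_iff a_assoc m_assoc l_distr r_distr)
  \<comment> \<open>The splitting of simplices from \<open>dec\<close>, with coefficients extended;
    the last summand is the chain of \<open>S\<close>.\<close>
  have split: "c = (\<lambda>\<sigma>. lin_ext (?D (Suc p)) (lin_ext (s p) c) \<sigma> \<oplus>\<^bsub>F\<^esub>
       (lin_ext (s (p - 1)) (lin_ext (?D p) c) \<sigma> \<oplus>\<^bsub>F\<^esub> (lin_ext z (lin_ext (\<nu> p) c) \<sigma> \<oplus>\<^bsub>F\<^esub>
        lin_ext (\<lambda>\<sigma>. frag_of \<sigma> - chain_boundary (Suc p) (s p \<sigma>) - frag_extend (s (p - 1)) (chain_boundary p (frag_of \<sigma>))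
         - frag_extend z (\<nu> p \<sigma>)) c \<sigma>)))" if c: "c \<in> finsupp" for c
  proof -
    have "c = lin_ext (\<lambda>\<sigma>. chain_boundary (Suc p) (s p \<sigma>) + (frag_extend (s (p - 1)) (chain_boundary p (frag_of \<sigma>))
         + (frag_extend z (\<nu> p \<sigma>) + (frag_of \<sigma> - chain_boundary (Suc p) (s p \<sigma>) -
        frag_extend (s (p - 1)) (chain_boundary p (frag_of \<sigma>)) - frag_extend z (\<nu> p \<sigma>))))) c"
      by (subst lin_ext_frag_of[OF c, symmetric]) (rule arg_cong[of _ _ "\<lambda>t. lin_ext t c"], simp add: fun_eq_iff)
    also have "\<dots> = (\<lambda>\<sigma>. lin_ext (?D (Suc p)) (lin_ext (s p) c) \<sigma> \<oplus>\<^bsub>F\<^esub>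
       (lin_ext (s (p - 1)) (lin_ext (?D p) c) \<sigma> \<oplus>\<^bsub>F\<^esub> (lin_ext z (lin_ext (\<nu> p) c) \<sigma> \<oplus>\<^bsub>F\<^esub>
        lin_ext (\<lambda>\<sigma>. frag_of \<sigma> - chain_boundary (Suc p) (s p \<sigma>) - frag_extend (s (p - 1)) (chain_boundary p (frag_of \<sigma>))
         - frag_extend z (\<nu> p \<sigma>)) c \<sigma>)))"
      unfolding lin_ext_plus[OF c] lin_ext_compose[OF c] chain_boundary_frag_extend[symmetric] by (rule refl)
    finally show ?thesis .
  qed
  have L_add: "lin_ext (\<nu> p) (x \<oplus>\<^bsub>?M\<^esub> y) = (\<lambda>i. lin_ext (\<nu> p) x i \<oplus>\<^bsub>F\<^esub> lin_ext (\<nu> p) y i)"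
    if "x \<in> carrier ?M" "y \<in> carrier ?M" for x y
    using that fs by (simp add: chain_module_def lin_ext_add)
  have L_smult: "lin_ext (\<nu> p) (a \<odot>\<^bsub>?M\<^esub> x) = (\<lambda>i. a \<otimes>\<^bsub>F\<^esub> lin_ext (\<nu> p) x i)"
    if "a \<in> carrier F" "x \<in> carrier ?M" for a x
    using that fs by (simp add: chain_module_def lin_ext_smult)
  have L_im: "lin_ext (\<nu> p) ` carrier ?M = {a. (\<forall>i. a i \<in> carrier F) \<and> (\<forall>i\<ge>?m. a i = \<zero>\<^bsub>F\<^esub>)}"
  proof (intro subset_antisym subsetI)
    fix a assume "a \<in> lin_ext (\<nu> p) ` carrier ?M"
    then obtain c where c: "c \<in> finsupp" "a = lin_ext (\<nu> p) c" using fs by auto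
    have "Poly_Mapping.keys (\<nu> p \<sigma>) \<subseteq> {..<?m}" for \<sigma> using \<nu>[of p \<sigma>] by auto
    from finsupp_lin_ext[OF c(1) this] show "a \<in> {a. (\<forall>i. a i \<in> carrier F) \<and> (\<forall>i\<ge>?m. a i = \<zero>\<^bsub>F\<^esub>)}"
      using c by (fastforce simp: finsupp_def)
  next
    fix a assume a: "a \<in> {a. (\<forall>i. a i \<in> carrier F) \<and> (\<forall>i\<ge>?m. a i = \<zero>\<^bsub>F\<^esub>)}"
    then have aF: "\<And>i. a i \<in> carrier F" by blast
    have a0: "p = k \<and> i < m" if "a i \<noteq> \<zero>\<^bsub>F\<^esub>" for i
    proof -
      have "\<forall>i\<ge>?m. a i = \<zero>\<^bsub>F\<^esub>" using a by blast
      then have "i < ?m" using that not_le by blast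
      then show ?thesis by (simp split: if_splits)
    qed
    have "{i. a i \<noteq> \<zero>\<^bsub>F\<^esub>} \<subseteq> {..<m}" using a0 by auto
    then have "finite {i. a i \<noteq> \<zero>\<^bsub>F\<^esub>}" using finite_subset by blast
    then have af: "a \<in> finsupp" using aF by (simp add: finsupp_def)
    have zz: "singular_relcycle p X S (z i)" if "a i \<noteq> \<zero>\<^bsub>F\<^esub>" for i
      using a0[OF that] fh by (simp add: free_homology_def)
    have c1: "lin_ext z a \<in> carrier (chain_module F p X)"
      using zz by (intro mapc af) (simp add: singular_relcycle)
    have "lin_ext (?D p) (lin_ext z a) = lin_ext (\<lambda>i. chain_boundary p (z i)) a"
      unfolding lin_ext_compose[OF af] chain_boundary_frag_extend[symmetric] by (rule refl)
    moreover have "lin_ext (\<lambda>i. chain_boundary p (z i)) a \<in> carrier (chain_module F (p - 1) (subtopology X S))"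
      using zz by (intro mapc af) (simp add: singular_relcycle)
    ultimately have "lin_ext z a \<in> carrier ?M" using c1 rc by simp
    moreover have "lin_ext (\<nu> p) (lin_ext z a) = a"
    proof -
      have "lin_ext (\<nu> p) (lin_ext z a) = lin_ext frag_of a"
        unfolding lin_ext_compose[OF af]
      proof (rule lin_ext_cong[OF af])
        fix i assume "a i \<noteq> \<zero>\<^bsub>F\<^esub>"
        from a0[OF this] show "frag_extend (\<nu> p) (z i) = frag_of i" using \<nu>z by simp
      qed
      then show ?thesis using lin_ext_frag_of[OF af] by simp
    qed
    ultimately show "a \<in> lin_ext (\<nu> p) ` carrier ?M" by (metis image_eqI)
  qed
  have N: "relboundaries F p X S = {x \<in> carrier ?M. \<forall>i. lin_ext (\<nu> p) x i = \<zero>\<^bsub>F\<^esub>}"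
  proof (intro subset_antisym subsetI)
    fix x assume "x \<in> relboundaries F p X S"
    then obtain d e where d: "d \<in> carrier (chain_module F (Suc p) X)"
      and e: "e \<in> carrier (chain_module F p (subtopology X S))"
      and x: "x = (\<lambda>\<sigma>. lin_ext (?D (Suc p)) d \<sigma> \<oplus>\<^bsub>F\<^esub> e \<sigma>)"
      by (auto simp: relboundaries_def chain_module_def[of F p X] boundary_map_eq_lin_ext cm)
    have df: "d \<in> finsupp" and ef: "e \<in> finsupp" using d e by (auto simp: cm)
    have bd: "lin_ext (?D (Suc p)) d \<in> carrier (chain_module F p X)"
      using d by (intro mapc df) (auto simp: cm singular_chain_of intro: singular_chain_boundary_alt)
    have 0: "lin_ext (?D p) (lin_ext (?D (Suc p)) d) = (\<lambda>\<sigma>. \<zero>\<^bsub>F\<^esub>)"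
      unfolding lin_ext_compose[OF df] chain_boundary_frag_extend[symmetric]
    proof (rule lin_ext_eq_zero[OF df])
      fix \<sigma> assume "d \<sigma> \<noteq> \<zero>\<^bsub>F\<^esub>"
      then have "singular_chain (Suc p) X (frag_of \<sigma>)" using d by (simp add: cm singular_chain_of)
      from chain_boundary_boundary[OF this] show "chain_boundary p (chain_boundary (Suc p) (frag_of \<sigma>)) = 0" by simp
    qed
    have 1: "lin_ext (?D p) e \<in> carrier (chain_module F (p - 1) (subtopology X S))"
    proof (intro mapc ef)
      fix \<sigma> assume "e \<sigma> \<noteq> \<zero>\<^bsub>F\<^esub>"
      then have "singular_chain p (subtopology X S) (frag_of \<sigma>)" using e by (simp add: cm singular_chain_of)
      from singular_chain_boundary[OF this] show "singular_chain (p - 1) (subtopology X S) (chain_boundary p (frag_of \<sigma>))" by simp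
    qed
    have 2: "e \<in> carrier (chain_module F p X)"
      using e by (auto simp: cm singular_simplex_subtopology)
    have bf: "lin_ext (?D (Suc p)) d \<in> finsupp" using bd unfolding cm by blast
    have xM: "x \<in> carrier ?M"
    proof -
      have "lin_ext (?D p) x = (\<lambda>\<sigma>. \<zero>\<^bsub>F\<^esub> \<oplus>\<^bsub>F\<^esub> lin_ext (?D p) e \<sigma>)"
        unfolding x lin_ext_add[OF bf ef] 0 by (rule refl)
      also have "\<dots> = lin_ext (?D p) e" by (rule ext) (simp add: lin_ext_closed[OF ef])
      finally have "x \<in> relcycles F p X S" unfolding rc using 1 ca[OF bd 2] by (simp add: x)
      then show ?thesis by simp
    qed
    have 3: "lin_ext (\<nu> p) (lin_ext (?D (Suc p)) d) = (\<lambda>\<sigma>. \<zero>\<^bsub>F\<^esub>)"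
      unfolding lin_ext_compose[OF df] by (rule lin_ext_eq_zero[OF df]) (use d \<nu>b in \<open>auto simp: cm\<close>)
    have 4: "lin_ext (\<nu> p) e = (\<lambda>\<sigma>. \<zero>\<^bsub>F\<^esub>)"
      by (rule lin_ext_eq_zero[OF ef]) (use e sS in \<open>auto simp: cm\<close>)
    have "lin_ext (\<nu> p) x = (\<lambda>\<sigma>. \<zero>\<^bsub>F\<^esub>)" unfolding x lin_ext_add[OF bf ef] 3 4 by simp
    then show "x \<in> {x \<in> carrier ?M. \<forall>i. lin_ext (\<nu> p) x i = \<zero>\<^bsub>F\<^esub>}" using xM by simp
  next
    fix x assume "x \<in> {x \<in> carrier ?M. \<forall>i. lin_ext (\<nu> p) x i = \<zero>\<^bsub>F\<^esub>}"
    then have x: "x \<in> relcycles F p X S" and L0: "lin_ext (\<nu> p) x = (\<lambda>i. \<zero>\<^bsub>F\<^esub>)" by auto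
    have xf: "x \<in> finsupp" using fs[OF x] .
    let ?d = "lin_ext (s p) x"
    let ?e = "lin_ext (\<lambda>\<sigma>. frag_of \<sigma> - chain_boundary (Suc p) (s p \<sigma>) - frag_extend (s (p - 1)) (chain_boundary p (frag_of \<sigma>))
         - frag_extend z (\<nu> p \<sigma>)) x"
    have xs: "singular_simplex p X \<sigma>" if "x \<sigma> \<noteq> \<zero>\<^bsub>F\<^esub>" for \<sigma> using x that by (simp add: rc cm)
    have d: "?d \<in> carrier (chain_module F (Suc p) X)" using xs s by (intro mapc xf) auto
    have e: "?e \<in> carrier (chain_module F p (subtopology X S))" using xs dec by (intro mapc xf) auto
    \<comment> \<open>The boundary of a relative cycle is a chain of \<open>S\<close>, where
      \<open>s\<close> vanishes; this removes the second summand of \<open>split\<close>.\<close>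
    have "lin_ext (?D p) x \<in> carrier (chain_module F (p - 1) (subtopology X S))" using x by (simp add: rc)
    then have "lin_ext (s (p - 1)) (lin_ext (?D p) x) = (\<lambda>\<sigma>. \<zero>\<^bsub>F\<^esub>)"
      using sS by (intro lin_ext_eq_zero) (auto simp: cm)
    then have "x = (\<lambda>\<sigma>. lin_ext (?D (Suc p)) ?d \<sigma> \<oplus>\<^bsub>F\<^esub> ?e \<sigma>)"
      using split[OF xf] L0 e by (simp add: cm finsupp_def fun_eq_iff)
    also have "\<dots> = boundary_map F (Suc p) ?d \<oplus>\<^bsub>chain_module F p X\<^esub> ?e"
      using d by (simp add: chain_module_def[of F p X] boundary_map_eq_lin_ext cm)
    finally show "x \<in> relboundaries F p X S" using d e unfolding relboundaries_def by blast
  qed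
  have "vs_rank F (rel_homology F p X S) = enat ?m"
    unfolding rel_homology_def by (rule vs_rank_quotient_module(1)[OF F M L_add L_smult L_im N])
  then show "vs_rank F (rel_homology F p X S) = (if p = k then enat m else 0)"
    by (cases "p = k") (simp_all add: zero_enat_def)
  have "carrier (rel_homology F p X S) = {\<zero>\<^bsub>rel_homology F p X S\<^esub>} \<longleftrightarrow> ?m = 0"
    unfolding rel_homology_def by (rule vs_rank_quotient_module(2)[OF F M L_add L_smult L_im N])
  then show "carrier (rel_homology F p X S) = {\<zero>\<^bsub>rel_homology F p X S\<^esub>} \<longleftrightarrow> p \<noteq> k \<or> m = 0"
    by (cases "p = k") simp_all
qed

section \<open>Integral relative homology of model pairs\<close>

text \<open>The degree is an integer, as for the homology groups, so that passing to degree
  \<open>p - 1\<close> below is uniform in \<open>p\<close>, negative degrees included.\<close>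

definition homology_free_of_rank :: "int \<Rightarrow> nat \<Rightarrow> 'a topology \<Rightarrow> 'a set \<Rightarrow> bool" where
  "homology_free_of_rank k m X S \<longleftrightarrow>
     (\<forall>p. p \<noteq> k \<longrightarrow> trivial_group (relative_homology_group p X S)) \<and>
     relative_homology_group k X S \<cong> free_Abelian_group {..<m}"

lemma homology_free_of_rank_cong:
  assumes "\<And>p. relative_homology_group p X S \<cong> relative_homology_group p Y T"
    and "homology_free_of_rank k m Y T"
  shows "homology_free_of_rank k m X S"
proof -
  have "trivial_group (relative_homology_group p X S) \<longleftrightarrow> trivial_group (relative_homology_group p Y T)" for p
    by (rule isomorphic_group_triviality[OF assms(1)]) simp_all
  then show ?thesis
    using assms(2) iso_trans[OF assms(1)[of k], of "free_Abelian_group {..<m}"] by (simp add: homology_free_of_rank_def)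
qed

text \<open>The \<open>z i\<close> are cycles in the classes that correspond to the standard
  generators. The work is to see that the isomorphism sends an integral combination of generators to
  the class of the same combination of cycles.\<close>

lemma free_homology_exists:
  assumes "homology_free_of_rank (int k) m X S"
  obtains z where "free_homology k m z X S"
proof -
  let ?H = "relative_homology_group (int k) X S"
  have triv: "trivial_group (relative_homology_group (int p) X S)" if "p \<noteq> k" for p
    using assms that by (simp add: homology_free_of_rank_def)
  have "free_Abelian_group {..<m} \<cong> ?H"
    using assms by (simp add: homology_free_of_rank_def group.iso_sym)
  then obtain h where h: "h \<in> iso (free_Abelian_group {..<m}) ?H" by (auto simp: is_iso_def)
  interpret group_hom "free_Abelian_group {..<m}" ?H h
    using h by (intro group_hom.intro group_hom_axioms.intro) (simp_all only: iso_def mem_Collect_eq group_free_Abelian_group group_relative_homology_group)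
  have bij: "bij_betw h {n. Poly_Mapping.keys n \<subseteq> {..<m}} (carrier ?H)"
    using h by (simp add: iso_def free_Abelian_group_def)
  have "\<exists>z. singular_relcycle k X S z \<and> h (frag_of i) = homologous_rel_set k X S z" if "i < m" for i
  proof -
    have "h (frag_of i) \<in> carrier ?H" using that by (intro hom_closed) simp
    then show ?thesis by (auto simp: carrier_relative_homology_group)
  qed
  then obtain z where z: "\<And>i. i < m \<Longrightarrow> singular_relcycle k X S (z i)"
    "\<And>i. i < m \<Longrightarrow> h (frag_of i) = homologous_rel_set k X S (z i)" by metis
  have hadd: "homologous_rel_set k X S a \<otimes>\<^bsub>?H\<^esub> homologous_rel_set k X S b = homologous_rel_set k X S (a + b)"
    if "singular_relcycle k X S a" "singular_relcycle k X S b" for a b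
  proof -
    have "r + s \<in> homologous_rel_set k X S (a + b)"
      if "homologous_rel k X S a r" "homologous_rel k X S b s" for r s
      using that by (simp add: homologous_rel_add)
    moreover have "\<exists>r s. homologous_rel k X S a r \<and> homologous_rel k X S b s \<and> x = r + s"
      if "homologous_rel k X S (a + b) x" for x
    proof (intro exI conjI)
      show "homologous_rel k X S a a" by simp
      show "homologous_rel k X S b (x - a)"
        using that by (simp add: homologous_rel_def algebra_simps)
      show "x = a + (x - a)" by simp
    qed
    ultimately show ?thesis unfolding mult_relative_homology_group by blast
  qed
  have inj: "a = b" if "Poly_Mapping.keys a \<subseteq> {..<m}" "Poly_Mapping.keys b \<subseteq> {..<m}" "h a = h b" for a b
    using bij that by (auto simp: bij_betw_def inj_on_def)
  have hz: "h n = homologous_rel_set k X S (frag_extend z n) \<and> singular_relcycle k X S (frag_extend z n)"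
    if "Poly_Mapping.keys n \<subseteq> {..<m}" for n
  proof -
    have "Poly_Mapping.keys n \<subseteq> {..<m} \<and> h n = homologous_rel_set k X S (frag_extend z n) \<and> singular_relcycle k X S (frag_extend z n)"
      using that
    proof (induction n rule: frag_induction)
      case zero
      have "singular_relboundary_set k X S = homologous_rel_set k X S 0"
        by (metis homologous_rel_set_eq_relboundary singular_relboundary_0)
      then show ?case using hom_one by simp
    next
      case (one i)
      then show ?case using z by simp
    next
      case (diff a b)
      have k: "Poly_Mapping.keys (a - b) \<subseteq> {..<m}" using diff keys_diff[of a b] by blast
      have c: "singular_relcycle k X S (frag_extend z (a - b))"
        using diff by (simp add: frag_extend_diff singular_relcycle_diff)
      \<comment> \<open>Both candidates for the class of the difference have the same product with
        \<open>h b\<close>, so they agree by cancellation in the group.\<close>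
      have "h (a - b) \<otimes>\<^bsub>?H\<^esub> h b = homologous_rel_set k X S (frag_extend z (a - b)) \<otimes>\<^bsub>?H\<^esub> h b"
      proof -
        have "h (a - b) \<otimes>\<^bsub>?H\<^esub> h b = h a" using hom_mult[of "a - b" b] k diff by simp
        also have "\<dots> = homologous_rel_set k X S (frag_extend z (a - b) + frag_extend z b)"
          using diff by (simp add: frag_extend_diff)
        also have "\<dots> = homologous_rel_set k X S (frag_extend z (a - b)) \<otimes>\<^bsub>?H\<^esub> h b"
          using hadd[OF c] diff by simp
        finally show ?thesis .
      qed
      moreover have "h (a - b) \<in> carrier ?H" "h b \<in> carrier ?H"
        using hom_closed[of "a - b"] hom_closed[of b] k diff by simp_all
      moreover have "homologous_rel_set k X S (frag_extend z (a - b)) \<in> carrier ?H"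
        using c by (simp add: carrier_relative_homology_group)
      ultimately have "h (a - b) = homologous_rel_set k X S (frag_extend z (a - b))"
        by (simp add: group.right_cancel[OF group_relative_homology_group])
      then show ?case using k c by simp
    qed
    then show ?thesis by simp
  qed
  have "free_homology k m z X S"
    unfolding free_homology_def
  proof (intro conjI allI impI)
    fix p c assume "p \<noteq> k" and c: "singular_relcycle p X S c"
    then have "carrier (relative_homology_group (int p) X S) = {singular_relboundary_set p X S}"
      using triv by (simp add: trivial_group_def)
    moreover have "homologous_rel_set p X S c \<in> carrier (relative_homology_group (int p) X S)"
      using c by (simp add: carrier_relative_homology_group)
    ultimately have "homologous_rel_set p X S c = singular_relboundary_set p X S" by simp
    then show "singular_relboundary p X S c" by (simp add: homologous_rel_set_eq_relboundary)
  next
    fix c assume c: "singular_relcycle k X S c"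
    then have "homologous_rel_set k X S c \<in> carrier ?H" by (simp add: carrier_relative_homology_group)
    then have "homologous_rel_set k X S c \<in> h ` {n. Poly_Mapping.keys n \<subseteq> {..<m}}"
      using bij by (simp add: bij_betw_def)
    then obtain n where n: "Poly_Mapping.keys n \<subseteq> {..<m}" "homologous_rel_set k X S c = h n"
      by blast
    then have "homologous_rel k X S c (frag_extend z n)"
      using hz[OF n(1)] by (simp add: homologous_rel_set_eq)
    then show "\<exists>n. Poly_Mapping.keys n \<subseteq> {..<m} \<and> singular_relboundary k X S (c - frag_extend z n)"
      using n by (auto simp: homologous_rel_def)
  next
    fix n :: "nat \<Rightarrow>\<^sub>0 int"
    assume n: "Poly_Mapping.keys n \<subseteq> {..<m}" and b: "singular_relboundary k X S (frag_extend z n)"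
    then have "h n = singular_relboundary_set k X S" using hz[OF n] by (simp add: homologous_rel_set_eq_relboundary)
    also have "\<dots> = h 0" using hom_one by simp
    finally show "n = 0" using inj[of n 0] n by simp
  qed (use z in auto)
  then show thesis using that by blast
qed

text \<open>The homology at \<open>v\<close> is local: \<open>Y - N\<close> is closed in
  \<open>Y\<close> and contained in the open set \<open>Y - {v}\<close>, hence can be
  excised.\<close>

lemma homology_free_of_rank_excision:
  fixes Y :: "'a::t1_space set"
  assumes N: "openin (top_of_set Y) N" "v \<in> N"
    and h: "homology_free_of_rank k m (top_of_set N) (N - {v})"
  shows "homology_free_of_rank k m (top_of_set Y) (Y - {v})"
proof (rule homology_free_of_rank_cong[OF _ h])
  fix p
  have NY: "N \<subseteq> Y" using N by (simp add: openin_imp_subset)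
  let ?X = "top_of_set Y"
  have c: "closedin ?X (Y - N)" using closedin_diff[OF closedin_topspace N(1)] by simp
  have o: "openin ?X (Y - {v})"
    by (metis Diff_eq open_Compl closed_singleton openin_open_Int)
  have "?X closure_of (Y - N) \<subseteq> ?X interior_of (Y - {v})"
    using N by (simp add: closure_of_closedin[OF c] interior_of_openin[OF o]) auto
  from homology_excision_axiom[OF this, of Y p]
  have "relative_homology_group p (subtopology ?X (Y - (Y - N))) ((Y - {v}) - (Y - N))
      \<cong> relative_homology_group p (subtopology ?X Y) (Y - {v})"
    by (auto simp: is_iso_def)
  moreover have "Y - (Y - N) = N" "(Y - {v}) - (Y - N) = N - {v}" using NY by auto
  ultimately have "relative_homology_group p (top_of_set N) (N - {v}) \<cong> relative_homology_group p ?X (Y - {v})"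
    using NY by (simp add: subtopology_subtopology Int_absorb1 Int_absorb2)
  then show "relative_homology_group p ?X (Y - {v}) \<cong> relative_homology_group p (top_of_set N) (N - {v})"
    by (simp add: group.iso_sym)
qed

lemma homology_free_of_rank_homeomorphism:
  assumes hom: "homeomorphism N N' g h" and v: "v \<in> N"
    and fr: "homology_free_of_rank k m (top_of_set N') (N' - {g v})"
  shows "homology_free_of_rank k m (top_of_set N) (N - {v})"
proof (rule homology_free_of_rank_cong[OF _ fr])
  fix p
  have inj: "inj_on g N" and im: "g ` N = N'"
    using hom by (auto simp: homeomorphism_def intro: inj_on_inverseI[of N h])
  have "homeomorphic_map (top_of_set N) (top_of_set N') g"
    using hom homeomorphic_map_maps homeomorphic_maps_iff_homeomorphism by metis
  moreover have "g ` (N - {v}) = N' - {g v}"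
    using inj_on_image_set_diff[OF inj, of N "{v}"] v im by auto
  ultimately show "relative_homology_group p (top_of_set N) (N - {v}) \<cong> relative_homology_group p (top_of_set N') (N' - {g v})"
    by (intro is_isoI[OF homeomorphic_map_relative_homology_iso[of _ _ g]]) auto
qed

lemma homology_free_of_rank_point:
  "homology_free_of_rank 0 1 (top_of_set {v}) ({v} - {v})"
proof -
  have "homology_group 0 (top_of_set {v}) \<cong> integer_group"
    by (rule homology_coefficients[of _ v]) simp
  also have "integer_group \<cong> free_Abelian_group {..<(1::nat)}"
    using isomorphic_group_integer_free_Abelian_group_singleton[of "0::nat"] by (simp add: lessThan_Suc)
  finally show ?thesis
    using homology_dimension_axiom[of "top_of_set {v}" v] by (simp add: homology_free_of_rank_def)
qed

text \<open>The disc is contractible, so the relative group is the reduced homology of the punctured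
  disc one degree lower, and the punctured disc is homotopy equivalent to a circle.\<close>

lemma homology_free_of_rank_disc:
  assumes r: "r > 0"
  shows "homology_free_of_rank 2 1 (top_of_set (ball (0::complex) r)) (ball 0 r - {0})"
proof -
  let ?B = "ball (0::complex) r"
  have c: "contractible_space (top_of_set ?B)"
    using convex_imp_contractible[OF convex_ball] by (simp add: contractible_space_top_of_set)
  have ne: "topspace (top_of_set ?B) \<inter> (?B - {0}) \<noteq> {}"
  proof -
    have "of_real (r/2) \<in> ?B - {0}" using r by simp
    then show ?thesis by (metis Diff_subset IntI empty_iff subset_iff topspace_euclidean_subtopology)
  qed
  have 1: "relative_homology_group p (top_of_set ?B) (?B - {0}) \<cong> reduced_homology_group (p - 1) (nsphere 1)" for p
  proof -
    have "relative_homology_group p (top_of_set ?B) (?B - {0}) \<cong> reduced_homology_group (p - 1) (subtopology (top_of_set ?B) (?B - {0}))"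
      by (rule isomorphic_group_relative_homology_of_contractible[OF c ne])
    also have "subtopology (top_of_set ?B) (?B - {0}) = top_of_set (?B - {0})"
      by (simp add: subtopology_subtopology Int_absorb1)
    also have "reduced_homology_group (p - 1) (top_of_set (?B - {0})) \<cong> reduced_homology_group (p - 1) (nsphere 1)"
    proof (rule homotopy_equivalent_space_imp_isomorphic_reduced_homology_groups)
      \<comment> \<open>The punctured disc is compared with the relative frontier of a smaller
        concentric disc, which is a circle inside it.\<close>
      have rf: "rel_frontier (ball (0::complex) (r/2)) = sphere 0 (r/2)"
        using r by (simp add: rel_frontier_nonempty_interior frontier_ball)
      moreover have "rel_frontier (ball (0::complex) (r/2)) homotopy_eqv (?B - {0})"
        using r by (intro homotopy_eqv_rel_frontier_punctured_convex)
          (auto simp: rf rel_interior_nonempty_interior affine_hull_open)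
      moreover have "sphere (0::complex) (r/2) homeomorphic sphere (0::complex) 1"
        using r by (intro homeomorphic_spheres) auto
      moreover obtain f :: "(nat \<Rightarrow> real) \<Rightarrow> complex" and g
        where "homeomorphic_maps (nsphere (2 - 1)) (top_of_set (sphere 0 1 \<inter> span {1, \<i>})) f g"
        by (rule homeomorphic_maps_nsphere_euclidean_sphere[of "{1, \<i>}" 2])
          (use independent_Basis[where 'a=complex] in \<open>auto simp: Basis_complex_def orthogonal_def pairwise_insert\<close>)
      moreover have "span {1, \<i>} = UNIV"
        using span_Basis Basis_complex_def by metis
      ultimately have "top_of_set (sphere (0::complex) (r/2)) homotopy_equivalent_space top_of_set (?B - {0})"
         "sphere (0::complex) (r/2) homotopy_eqv sphere (0::complex) 1"
         "nsphere 1 homeomorphic_space top_of_set (sphere (0::complex) 1)"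
        unfolding homeomorphic_space_def by (simp_all add: homeomorphic_imp_homotopy_eqv) blast
      then show "top_of_set (?B - {0}) homotopy_equivalent_space nsphere 1"
        by (meson homeomorphic_imp_homotopy_equivalent_space homotopy_equivalent_space_sym homotopy_eqv_trans)
    qed
    finally show ?thesis .
  qed
  have "relative_homology_group 2 (top_of_set ?B) (?B - {0}) \<cong> integer_group"
    using iso_trans[OF 1[of 2]] reduced_homology_group_nsphere(1)[of 1] by simp
  also have "integer_group \<cong> free_Abelian_group {..<(1::nat)}"
    using isomorphic_group_integer_free_Abelian_group_singleton[of "0::nat"] by (simp add: lessThan_Suc)
  finally have 2: "relative_homology_group 2 (top_of_set ?B) (?B - {0}) \<cong> free_Abelian_group {..<(1::nat)}" .
  have "trivial_group (relative_homology_group p (top_of_set ?B) (?B - {0}))" if "p \<noteq> 2" for p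
    using isomorphic_group_triviality[OF 1[of p]] reduced_homology_group_nsphere(2)[of "p - 1" 1] that by auto
  then show ?thesis using 2 by (simp add: homology_free_of_rank_def)
qed

text \<open>Homology is additive over disjoint open pieces, and each piece has the homology of a
  point. Additivity is indexed by the sets themselves; nonempty disjoint pieces are distinct sets,
  so they may be counted by their indices.\<close>

lemma homology_contractible_pieces:
  fixes B :: "'i \<Rightarrow> 'a::real_normed_vector set"
  assumes disj: "\<And>i j. i \<in> I \<Longrightarrow> j \<in> I \<Longrightarrow> i \<noteq> j \<Longrightarrow> B i \<inter> B j = {}"
    and op: "\<And>i. i \<in> I \<Longrightarrow> openin (top_of_set (\<Union>(B ` I))) (B i)"
    and ne: "\<And>i. i \<in> I \<Longrightarrow> B i \<noteq> {}" and con: "\<And>i. i \<in> I \<Longrightarrow> contractible (B i)"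
  shows "homology_group 0 (top_of_set (\<Union>(B ` I))) \<cong> free_Abelian_group I"
    and "p \<noteq> 0 \<Longrightarrow> trivial_group (homology_group p (top_of_set (\<Union>(B ` I))))"
proof -
  let ?X = "top_of_set (\<Union>(B ` I))"
  have iso: "sum_group (B ` I) (\<lambda>S. homology_group p (subtopology ?X S)) \<cong> homology_group p ?X" for p
    using disj op by (intro is_isoI[OF homology_additivity_axiom]) (auto simp: pairwise_def disjnt_def)
  have sub: "subtopology ?X (B i) = top_of_set (B i)" if "i \<in> I" for i
    using that by (simp add: subtopology_subtopology) (metis UN_upper inf.absorb_iff2)
  have inj: "inj_on B I"
    by (rule inj_onI) (metis disj inf.idem ne)
  have "homology_group 0 ?X \<cong> sum_group (B ` I) (\<lambda>S. homology_group 0 (subtopology ?X S))"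
    by (rule group.iso_sym) (simp_all add: iso)
  also have "\<dots> \<cong> sum_group (B ` I) (\<lambda>S. integer_group)"
  proof (rule iso_sum_groupI)
    fix S assume "S \<in> B ` I"
    then obtain i where i: "i \<in> I" "S = B i" by blast
    have "path_connected_space (top_of_set (B i))"
      using contractible_imp_path_connected[OF con[OF i(1)]]
      by (metis path_connectedin_def path_connectedin_euclidean)
    then show "homology_group 0 (subtopology ?X S) \<cong> integer_group"
      using ne[OF i(1)] sub[OF i(1)] i by (simp add: isomorphic_integer_zeroth_homology_group)
  qed auto
  also have "\<dots> \<cong> free_Abelian_group (B ` I)" by (rule isomorphic_sum_integer_group)
  also have "\<dots> \<cong> free_Abelian_group I"
    unfolding isomorphic_free_Abelian_groups using inj by (rule inj_on_image_eqpoll_self)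
  finally show "homology_group 0 ?X \<cong> free_Abelian_group I" .
  show "trivial_group (homology_group p ?X)" if p: "p \<noteq> 0"
  proof -
    have "trivial_group (homology_group p (subtopology ?X S))" if S: "S \<in> B ` I" for S
    proof -
      obtain i where i: "i \<in> I" "S = B i" using S by blast
      have "trivial_group (reduced_homology_group p (top_of_set (B i)))"
        using con[OF i(1)] by (intro trivial_reduced_homology_group_contractible_space) (simp add: contractible_space_top_of_set)
      then show ?thesis using un_reduced_homology_group[OF p, of "top_of_set (B i)"] sub[OF i(1)] i by simp
    qed
    then have "carrier (sum_group (B ` I) (\<lambda>S. homology_group p (subtopology ?X S))) \<subseteq>
        {\<one>\<^bsub>sum_group (B ` I) (\<lambda>S. homology_group p (subtopology ?X S))\<^esub>}"
      by (auto simp: carrier_sum_group trivial_group_def PiE_iff extensional_def fun_eq_iff)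
    then have "trivial_group (sum_group (B ` I) (\<lambda>S. homology_group p (subtopology ?X S)))"
      by (subst group.trivial_group_subset) auto
    then show ?thesis
      using isomorphic_group_triviality1[OF iso[of p]] by simp
  qed
qed

text \<open>\<open>N\<close> is contractible, so the reduced homology of \<open>N - {v}\<close> is
  wanted. Reduced homology is the homology relative to a contractible subspace, here the piece
  \<open>B 0\<close>; as \<open>B 0\<close> is open and closed it can be excised, which leaves the
  absolute homology of the other \<open>n - 1\<close> pieces.\<close>

lemma homology_free_of_rank_pieces:
  fixes N :: "'a::euclidean_space set"
  assumes N: "contractible N" "v \<in> N" and n: "n > 0"
    and U: "N - {v} = (\<Union>i<n. B i)"
    and disj: "\<And>i j. i < n \<Longrightarrow> j < n \<Longrightarrow> i \<noteq> j \<Longrightarrow> B i \<inter> B j = {}"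
    and op: "\<And>i. i < n \<Longrightarrow> openin (top_of_set (N - {v})) (B i)"
    and ne: "\<And>i. i < n \<Longrightarrow> B i \<noteq> {}" and con: "\<And>i. i < n \<Longrightarrow> contractible (B i)"
  shows "homology_free_of_rank 1 (n - 1) (top_of_set N) (N - {v})"
proof -
  let ?A = "N - {v}" let ?A' = "\<Union>(B ` {1..<n})"
  have A: "?A = B 0 \<union> ?A'"
  proof -
    have "{..<n} = insert 0 {1..<n}" using n by auto
    then show ?thesis unfolding U by simp
  qed
  have disj0: "B 0 \<inter> ?A' = {}" using disj n by fastforce
  have c: "contractible_space (top_of_set N)" using N by (simp add: contractible_space_top_of_set)
  have "openin (top_of_set ?A) ?A'" using op by (intro openin_Union) auto
  then have clo: "closedin (top_of_set ?A) (B 0)"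
  proof -
    assume o: "openin (top_of_set ?A) ?A'"
    have "?A - B 0 = ?A'" "B 0 \<subseteq> ?A" using A disj0 by auto
    then show ?thesis using o unfolding closedin_def by simp
  qed
  have iso: "relative_homology_group p (top_of_set N) ?A \<cong> homology_group (p - 1) (top_of_set ?A')" for p
  proof -
    have "relative_homology_group p (top_of_set N) ?A \<cong> reduced_homology_group (p - 1) (subtopology (top_of_set N) ?A)"
      using c ne[OF n] A by (intro isomorphic_group_relative_homology_of_contractible) auto
    also have "subtopology (top_of_set N) ?A = top_of_set ?A"
      by (simp add: subtopology_subtopology Int_absorb1)
    also have "reduced_homology_group (p - 1) (top_of_set ?A) \<cong> relative_homology_group (p - 1) (top_of_set ?A) (B 0)"
    proof (rule isomorphic_reduced_homology_by_contractible)
      have "subtopology (top_of_set ?A) (B 0) = top_of_set (B 0)"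
        using A by (simp add: subtopology_subtopology Int_absorb1)
      then show "contractible_space (subtopology (top_of_set ?A) (B 0))"
        using con[OF n] by (simp add: contractible_space_top_of_set)
    qed (use ne[OF n] A in auto)
    also have "\<dots> \<cong> homology_group (p - 1) (top_of_set ?A')"
    proof -
      have "top_of_set ?A closure_of B 0 \<subseteq> top_of_set ?A interior_of B 0"
        using clo op[OF n] by (simp add: closure_of_closedin interior_of_openin)
      from homology_excision_axiom[OF this, of ?A "p - 1"] A
      have "relative_homology_group (p - 1) (subtopology (top_of_set ?A) (?A - B 0)) (B 0 - B 0)
        \<cong> relative_homology_group (p - 1) (subtopology (top_of_set ?A) ?A) (B 0)"
        by (auto simp: is_iso_def)
      moreover have "subtopology (top_of_set ?A) (?A - B 0) = top_of_set ?A'"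
      proof -
        have "?A - B 0 = ?A'" "?A \<inter> ?A' = ?A'" using A disj0 by auto
        then show ?thesis by (simp add: subtopology_subtopology)
      qed
      moreover have "subtopology (top_of_set ?A) ?A = top_of_set ?A"
        by (simp add: subtopology_subtopology)
      ultimately show ?thesis by (simp add: group.iso_sym)
    qed
    finally show ?thesis .
  qed
  have op': "openin (top_of_set ?A') (B i)" if "i \<in> {1..<n}" for i
  proof (rule openin_subset_trans)
    show "openin (top_of_set ?A) (B i)" using op that by simp
    show "B i \<subseteq> ?A'" using that by blast
    show "?A' \<subseteq> ?A" unfolding A by blast
  qed
  have 0: "homology_group 0 (top_of_set ?A') \<cong> free_Abelian_group {1..<n}"
    by (rule homology_contractible_pieces(1)) (use disj op' ne con in auto)
  have triv: "trivial_group (homology_group p (top_of_set ?A'))" if "p \<noteq> 0" for p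
    by (rule homology_contractible_pieces(2)) (use disj op' ne con that in auto)
  have "{1..<n} \<approx> {..<n - 1}" by (simp add: eqpoll_iff_card)
  then have "free_Abelian_group {1..<n} \<cong> free_Abelian_group {..<n - 1}"
    by (simp add: isomorphic_free_Abelian_groups)
  with iso[of 1] 0 have "relative_homology_group 1 (top_of_set N) ?A \<cong> free_Abelian_group {..<n - 1}"
    by (auto intro: iso_trans)
  moreover have "trivial_group (relative_homology_group p (top_of_set N) ?A)" if "p \<noteq> 1" for p
    using isomorphic_group_triviality[OF iso[of p]] triv[of "p - 1"] that by simp
  ultimately show ?thesis by (simp add: homology_free_of_rank_def)
qed

section \<open>Sign changes of a piecewise linear function along the circle\<close>

text \<open>The restriction of a linear form with coefficients \<open>A\<close>, \<open>B\<close> to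
  an arc of the unit circle.\<close>

definition trig_linear :: "(real \<Rightarrow> real) \<Rightarrow> real \<Rightarrow> real \<Rightarrow> bool" where
  "trig_linear q a b \<longleftrightarrow> (\<exists>A B. \<forall>t\<in>{a..b}. q t = A * cos t + B * sin t)"

lemma trig_linear_subset: "trig_linear q a b \<Longrightarrow> a \<le> c \<Longrightarrow> d \<le> b \<Longrightarrow> trig_linear q c d"
  unfolding trig_linear_def by (meson atLeastAtMost_iff order_trans)

text \<open>Two directions less than pi apart are linearly independent, so a linear form that
  vanishes on both is zero. The elimination produces the determinant
  \<open>sin (t - s)\<close>.\<close>

lemma trig_two_zeros:
  fixes A B s t :: real
  assumes "A * cos s + B * sin s = 0" "A * cos t + B * sin t = 0" "s < t" "t - s < pi"
  shows "A = 0 \<and> B = 0"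
proof -
  have s0: "sin (t - s) > 0" using assms by (intro sin_gt_zero) auto
  have "A * sin (t - s) = (A * cos s + B * sin s) * sin t - (A * cos t + B * sin t) * sin s"
    by (simp add: sin_diff algebra_simps)
  moreover have "B * sin (t - s) = (A * cos t + B * sin t) * cos s - (A * cos s + B * sin s) * cos t"
    by (simp add: sin_diff algebra_simps)
  ultimately have "A * sin (t - s) = 0" "B * sin (t - s) = 0" unfolding assms(1,2) by simp_all
  then show ?thesis using s0 by simp
qed

text \<open>\<open>q\<close> is a positively homogeneous piecewise linear function of the plane, restricted to the unit
  circle and regarded as a function of the angle.\<close>

locale pl_circle =
  fixes q :: "real \<Rightarrow> real"
  assumes periodic: "q (t + 2 * pi) = q t"
    and right_linear: "\<exists>\<eta>>0. trig_linear q t (t + \<eta>)"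
    and left_linear: "\<exists>\<eta>>0. trig_linear q (t - \<eta>) t"
    and no_extremum: "q t = 0 \<Longrightarrow> \<eta> > 0 \<Longrightarrow>
      (\<exists>s. \<bar>s - t\<bar> < \<eta> \<and> q s > 0) \<and> (\<exists>s. \<bar>s - t\<bar> < \<eta> \<and> q s < 0)"
begin

lemma pl_circle_reflect: "pl_circle (\<lambda>t. q (- t))"
proof
  fix t
  show "q (- (t + 2 * pi)) = q (- t)" using periodic[of "- (t + 2 * pi)"] by simp
  obtain \<eta> A B where "\<eta> > 0" and e: "\<forall>s\<in>{-t - \<eta>..-t}. q s = A * cos s + B * sin s"
    using left_linear[of "-t"] by (auto simp: trig_linear_def)
  then have "trig_linear (\<lambda>t. q (- t)) t (t + \<eta>)"
    unfolding trig_linear_def by (intro exI[of _ A] exI[of _ "-B"]) auto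
  then show "\<exists>\<eta>>0. trig_linear (\<lambda>t. q (- t)) t (t + \<eta>)" using \<open>\<eta> > 0\<close> by blast
  obtain \<eta> A B where "\<eta> > 0" and e: "\<forall>s\<in>{-t..-t + \<eta>}. q s = A * cos s + B * sin s"
    using right_linear[of "-t"] by (auto simp: trig_linear_def)
  then have "trig_linear (\<lambda>t. q (- t)) (t - \<eta>) t"
    unfolding trig_linear_def by (intro exI[of _ A] exI[of _ "-B"]) auto
  then show "\<exists>\<eta>>0. trig_linear (\<lambda>t. q (- t)) (t - \<eta>) t" using \<open>\<eta> > 0\<close> by blast
next
  fix t \<eta> :: real assume "q (- t) = 0" "\<eta> > 0"
  from no_extremum[OF this] obtain s r where "\<bar>s - - t\<bar> < \<eta>" "q s > 0" "\<bar>r - - t\<bar> < \<eta>" "q r < 0" by blast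
  then show "(\<exists>s. \<bar>s - t\<bar> < \<eta> \<and> 0 < q (- s)) \<and> (\<exists>s. \<bar>s - t\<bar> < \<eta> \<and> q (- s) < 0)"
    by (intro conjI exI[of _ "-s"] exI[of _ "-r"]) (simp_all add: abs_minus_commute)
qed

text \<open>Two zeros to the right of \<open>t\<close> on one linear arc would make \<open>q\<close>
  vanish identically there, against \<open>no_extremum\<close>; the bound 1 on the length of the arc
  keeps them less than pi apart. So there is at most one zero, and half the distance to it is a safe
  length.\<close>

lemma right_nonzero:
  obtains \<eta> where "\<eta> > 0" "trig_linear q t (t + \<eta>)" "\<And>s. t < s \<Longrightarrow> s \<le> t + \<eta> \<Longrightarrow> q s \<noteq> 0"
proof -
  obtain \<eta>0 where \<eta>0: "\<eta>0 > 0" "trig_linear q t (t + \<eta>0)" using right_linear by blast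
  define \<eta> where "\<eta> = min \<eta>0 1"
  have \<eta>: "\<eta> > 0" "\<eta> \<le> 1" using \<eta>0 by (auto simp: \<eta>_def)
  have tl: "trig_linear q t (t + \<eta>)" by (rule trig_linear_subset[OF \<eta>0(2)]) (auto simp: \<eta>_def)
  then obtain A B where AB: "\<And>s. t \<le> s \<Longrightarrow> s \<le> t + \<eta> \<Longrightarrow> q s = A * cos s + B * sin s"
    by (auto simp: trig_linear_def)
  have uniq: "s = s'" if s: "t < s" "s \<le> t + \<eta>" "q s = 0" "t < s'" "s' \<le> t + \<eta>" "q s' = 0" for s s'
  proof (rule ccontr)
    assume "s \<noteq> s'"
    have "A = 0 \<and> B = 0"
      using trig_two_zeros[of A s B s'] trig_two_zeros[of A s' B s] AB[of s] AB[of s'] s \<open>s \<noteq> s'\<close> \<eta> pi_gt3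
      by (cases "s < s'") auto
    then have z: "q r = 0" if r: "\<bar>r - (t + \<eta>/2)\<bar> < \<eta>/2" for r
    proof -
      have "t \<le> r" "r \<le> t + \<eta>" using r by linarith+
      then show ?thesis using AB[of r] \<open>A = 0 \<and> B = 0\<close> by simp
    qed
    have "q (t + \<eta>/2) = 0" using z[of "t + \<eta>/2"] \<eta> by simp
    from no_extremum[OF this, of "\<eta>/2"] z \<eta> show False by force
  qed
  show thesis
  proof (cases "\<exists>s. t < s \<and> s \<le> t + \<eta> \<and> q s = 0")
    case True
    then obtain s where s: "t < s" "s \<le> t + \<eta>" "q s = 0" by blast
    show thesis
    proof (rule that[of "(s - t)/2"])
      show "trig_linear q t (t + (s - t)/2)"
        by (rule trig_linear_subset[OF tl]) (use s in auto)
      fix r assume r: "t < r" "r \<le> t + (s - t)/2"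
      then have "r < s" using s by (simp add: field_simps)
      then show "q r \<noteq> 0" using uniq[of s r] s r by auto
    qed (use s in simp)
  next
    case False
    then show thesis using that[of \<eta>] \<eta> tl by blast
  qed
qed

lemma left_nonzero:
  obtains \<eta> where "\<eta> > 0" "trig_linear q (t - \<eta>) t" "\<And>s. s < t \<Longrightarrow> t - \<eta> \<le> s \<Longrightarrow> q s \<noteq> 0"
proof -
  interpret r: pl_circle "\<lambda>t. q (- t)" by (rule pl_circle_reflect)
  obtain \<eta> where \<eta>: "\<eta> > 0" "trig_linear (\<lambda>t. q (- t)) (- t) (- t + \<eta>)"
     "\<And>s. - t < s \<Longrightarrow> s \<le> - t + \<eta> \<Longrightarrow> q (- s) \<noteq> 0"
    using r.right_nonzero[of "- t"] by blast
  then obtain A B where AB: "\<forall>s\<in>{- t..- t + \<eta>}. q (- s) = A * cos s + B * sin s"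
    by (auto simp: trig_linear_def)
  have "q s = A * cos s + (- B) * sin s" if "s \<in> {t - \<eta>..t}" for s
    using AB[rule_format, of "- s"] that by auto
  then have "trig_linear q (t - \<eta>) t" unfolding trig_linear_def by blast
  moreover have "q s \<noteq> 0" if "s < t" "t - \<eta> \<le> s" for s
    using \<eta>(3)[of "- s"] that by auto
  ultimately show thesis using that \<eta>(1) by blast
qed

lemma continuous: "isCont q t"
proof -
  have c: "continuous (at t within {a..b}) q" if tl: "trig_linear q a b" and tab: "t \<in> {a..b}" for a b
  proof -
    obtain A B where AB: "\<forall>t\<in>{a..b}. q t = A * cos t + B * sin t" using tl unfolding trig_linear_def by blast
    have "continuous_on {a..b} (\<lambda>t. A * cos t + B * sin t)" by (intro continuous_intros)
    then have "continuous_on {a..b} q" 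
      by (rule continuous_on_eq) (simp add: AB)
    then show ?thesis using tab by (simp add: continuous_on_eq_continuous_within)
  qed
  obtain \<eta> where "\<eta> > 0" "trig_linear q t (t + \<eta>)" using right_linear by blast
  then have "continuous (at_right t) q"
    using c[of t "t + \<eta>"] by (simp add: continuous_within at_within_Icc_at_right)
  moreover obtain \<eta> where "\<eta> > 0" "trig_linear q (t - \<eta>) t" using left_linear by blast
  then have "continuous (at_left t) q"
    using c[of "t - \<eta>" t] by (simp add: continuous_within at_within_Icc_at_left)
  ultimately show ?thesis by (simp add: continuous_at_split)
qed

lemma constant_sign:
  assumes "\<And>t. a < t \<Longrightarrow> t < b \<Longrightarrow> q t \<noteq> 0"
  shows "(\<forall>t. a < t \<longrightarrow> t < b \<longrightarrow> q t > 0) \<or> (\<forall>t. a < t \<longrightarrow> t < b \<longrightarrow> q t < 0)"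
proof (rule ccontr)
  assume "\<not> ?thesis"
  then obtain s t where st: "a < s" "s < b" "q s < 0" "a < t" "t < b" "q t > 0"
    using assms by (metis less_irrefl linorder_less_linear)
  have "\<exists>x. min s t \<le> x \<and> x \<le> max s t \<and> q x = 0"
  proof (cases "s \<le> t")
    case True
    then show ?thesis using IVT[of q s 0 t] continuous st by auto
  next
    case False
    then show ?thesis using IVT2[of q s 0 t] continuous st by auto
  qed
  then show False using assms st by (auto simp: min_def max_def split: if_splits)
qed

text \<open>The set \<open>E\<close> prescribes further angles at which the circle has to be cut:
  they cannot lie inside an arc, so each arc stays between neighbouring points of
  \<open>E\<close>.\<close>

definition piece :: "real set \<Rightarrow> real \<Rightarrow> real \<Rightarrow> bool" where
  "piece E a b \<longleftrightarrow> a < b \<and> trig_linear q a b \<and> (\<forall>t. a < t \<longrightarrow> t < b \<longrightarrow> q t \<noteq> 0 \<and> t \<notin> E)"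

lemma piece_subset: "piece E a b \<Longrightarrow> a \<le> c \<Longrightarrow> c < d \<Longrightarrow> d \<le> b \<Longrightarrow> piece E c d"
  unfolding piece_def by (meson trig_linear_subset less_le_trans le_less_trans less_imp_le)

text \<open>Bolzano's principle replaces a compactness argument: being joined by a chain of pieces
  is transitive, and a short interval around \<open>x\<close> consists of at most one piece on
  either side of \<open>x\<close>.\<close>

lemma breakpoints:
  assumes E: "finite E" and ab: "a \<le> b"
  obtains u and N :: nat where "u 0 = a" "u N = b" "\<And>i. i < N \<Longrightarrow> piece E (u i) (u (Suc i))"
proof -
  have "(piece E)\<^sup>*\<^sup>* a b"
    using ab
  proof (induction a b rule: Bolzano)
    case (trans a b c)
    then show ?case by simp
  next
    case (local x)
    obtain \<eta>1 where \<eta>1: "\<eta>1 > 0" "trig_linear q x (x + \<eta>1)" "\<And>s. x < s \<Longrightarrow> s \<le> x + \<eta>1 \<Longrightarrow> q s \<noteq> 0"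
      using right_nonzero by blast
    obtain \<eta>2 where \<eta>2: "\<eta>2 > 0" "trig_linear q (x - \<eta>2) x" "\<And>s. s < x \<Longrightarrow> x - \<eta>2 \<le> s \<Longrightarrow> q s \<noteq> 0"
      using left_nonzero by blast
    obtain \<eta>3 where \<eta>3: "\<eta>3 > 0" "\<And>e. e \<in> E \<Longrightarrow> e \<noteq> x \<Longrightarrow> \<eta>3 \<le> dist x e"
      using finite_set_avoid[OF E, of x] by blast
    define d where "d = min (min \<eta>1 \<eta>2) \<eta>3"
    have d: "d > 0" using \<eta>1 \<eta>2 \<eta>3 by (simp add: d_def)
    have d3: "d \<le> \<eta>1" "d \<le> \<eta>2" "d \<le> \<eta>3" by (simp_all add: d_def)
    have E1: "e \<notin> E" if "\<bar>e - x\<bar> < d" "e \<noteq> x" for e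
      using \<eta>3(2)[of e] that d3 by (auto simp: dist_real_def)
    have R: "piece E x (x + d)"
      unfolding piece_def
    proof (intro conjI allI impI)
      show "trig_linear q x (x + d)" by (rule trig_linear_subset[OF \<eta>1(2)]) (use d3 in auto)
      show "q t \<noteq> 0" "t \<notin> E" if "x < t" "t < x + d" for t using \<eta>1(3)[of t] E1[of t] that d3 by auto
    qed (use d in auto)
    have L: "piece E (x - d) x"
      unfolding piece_def
    proof (intro conjI allI impI)
      show "trig_linear q (x - d) x" by (rule trig_linear_subset[OF \<eta>2(2)]) (use d3 in auto)
      show "q t \<noteq> 0" "t \<notin> E" if "x - d < t" "t < x" for t using \<eta>2(3)[of t] E1[of t] that d3 by auto
    qed (use d in auto)
    have "(piece E)\<^sup>*\<^sup>* a b" if "a \<le> x" "x \<le> b" "b - a < d" for a b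
    proof -
      have "(piece E)\<^sup>*\<^sup>* a x"
        using that by (cases "a = x") (auto intro!: r_into_rtranclp piece_subset[OF L])
      moreover have "(piece E)\<^sup>*\<^sup>* x b"
        using that by (cases "b = x") (auto intro!: r_into_rtranclp piece_subset[OF R])
      ultimately show ?thesis by simp
    qed
    then show ?case using d by blast
  qed
  then obtain N where "(piece E ^^ N) a b" using rtranclp_imp_relpowp by metis
  then show thesis using that unfolding relpowp_fun_conv by blast
qed

text \<open>A piece has no zero in its interior, so all zeros are among the finitely many
  breakpoints.\<close>

lemma finite_zeros: "finite {t. a \<le> t \<and> t \<le> b \<and> q t = 0}"
proof (cases "a \<le> b")
  case True
  obtain u and N :: nat where u: "u 0 = a" "u N = b" "\<And>i. i < N \<Longrightarrow> piece {} (u i) (u (Suc i))"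
    using breakpoints[OF finite.emptyI True] by blast
  have "{t. u 0 \<le> t \<and> t \<le> u M \<and> q t = 0} \<subseteq> u ` {..M}" if "M \<le> N" for M
    using that
  proof (induction M)
    case (Suc M)
    show ?case
    proof safe
      fix t assume t: "u 0 \<le> t" "t \<le> u (Suc M)" "q t = 0"
      show "t \<in> u ` {..Suc M}"
      proof (cases "t \<le> u M")
        case True
        then show ?thesis using Suc t by fastforce
      next
        case False
        then have "t = u (Suc M)" using u(3)[of M] Suc t unfolding piece_def by force
        then show ?thesis by simp
      qed
    qed
  qed force
  from this[of N] show ?thesis using u finite_subset[of _ "u ` {..N}"] by auto
next
  case False
  then have "{t. a \<le> t \<and> t \<le> b \<and> q t = 0} = {}" by auto
  then show ?thesis by (metis finite.emptyI)
qed

text \<open>The sign is constant on a short arc on either side of \<open>t\<close>, and by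
  \<open>no_extremum\<close> both signs occur nearby, so the two sides differ.\<close>

lemma crossing:
  assumes "q t = 0"
  obtains \<eta> where "\<eta> > 0" "(\<forall>s. t < s \<and> s < t + \<eta> \<longrightarrow> q s > 0) \<and> (\<forall>s. t - \<eta> < s \<and> s < t \<longrightarrow> q s < 0) \<or>
     (\<forall>s. t < s \<and> s < t + \<eta> \<longrightarrow> q s < 0) \<and> (\<forall>s. t - \<eta> < s \<and> s < t \<longrightarrow> q s > 0)"
proof -
  obtain \<eta>1 where \<eta>1: "\<eta>1 > 0" "\<And>s. t < s \<Longrightarrow> s \<le> t + \<eta>1 \<Longrightarrow> q s \<noteq> 0" using right_nonzero by blast
  obtain \<eta>2 where \<eta>2: "\<eta>2 > 0" "\<And>s. s < t \<Longrightarrow> t - \<eta>2 \<le> s \<Longrightarrow> q s \<noteq> 0" using left_nonzero by blast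
  define \<eta> where "\<eta> = min \<eta>1 \<eta>2"
  have \<eta>: "\<eta> > 0" using \<eta>1 \<eta>2 by (simp add: \<eta>_def)
  have R: "(\<forall>s. t < s \<longrightarrow> s < t + \<eta> \<longrightarrow> q s > 0) \<or> (\<forall>s. t < s \<longrightarrow> s < t + \<eta> \<longrightarrow> q s < 0)"
    using \<eta>1(2) by (intro constant_sign) (auto simp: \<eta>_def)
  have L: "(\<forall>s. t - \<eta> < s \<longrightarrow> s < t \<longrightarrow> q s > 0) \<or> (\<forall>s. t - \<eta> < s \<longrightarrow> s < t \<longrightarrow> q s < 0)"
    using \<eta>2(2) by (intro constant_sign) (auto simp: \<eta>_def)
  obtain x y where xy: "\<bar>x - t\<bar> < \<eta>" "q x > 0" "\<bar>y - t\<bar> < \<eta>" "q y < 0"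
    using no_extremum[OF assms \<eta>] by blast
  have "x \<noteq> t" "y \<noteq> t" using assms xy by auto
  then have x: "t < x \<and> x < t + \<eta> \<or> t - \<eta> < x \<and> x < t" and y: "t < y \<and> y < t + \<eta> \<or> t - \<eta> < y \<and> y < t"
    using xy by (auto simp: abs_less_iff)
  show thesis
    by (rule that[OF \<eta>]) (use R L x y xy in \<open>meson less_asym\<close>)
qed

lemma next_zero_chain:
  assumes "a \<le> b" "q a = 0" "q b = 0"
  shows "(\<lambda>a b. a < b \<and> q a = 0 \<and> q b = 0 \<and> (\<forall>t. a < t \<and> t < b \<longrightarrow> q t \<noteq> 0))\<^sup>*\<^sup>* a b"
    (is "?R\<^sup>*\<^sup>* a b")
  using assms
proof (induction "card {t. a < t \<and> t \<le> b \<and> q t = 0}" arbitrary: a rule: less_induct)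
  case less
  let ?Z = "{t. a < t \<and> t \<le> b \<and> q t = 0}"
  have fin: "finite ?Z" by (rule finite_subset[OF _ finite_zeros[of a b]]) auto
  show ?case
  proof (cases "a = b")
    case False
    then have ne: "b \<in> ?Z" using less by simp
    define c where "c = Min ?Z"
    have c: "c \<in> ?Z" unfolding c_def using ne fin by (intro Min_in) auto
    have "?R a c"
    proof -
      have "q t \<noteq> 0" if "a < t" "t < c" for t
        using Min_le[OF fin, of t] that c unfolding c_def by force
      then show ?thesis using c less by auto
    qed
    moreover have "?R\<^sup>*\<^sup>* c b"
    proof (rule less.hyps)
      show "card {t. c < t \<and> t \<le> b \<and> q t = 0} < card ?Z"
        using c by (intro psubset_card_mono fin) auto
    qed (use c less in auto)
    ultimately show ?thesis by (rule converse_rtranclp_into_rtranclp)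
  qed simp
qed

lemma sign_structure:
  obtains (pos) "\<And>t. q t > 0"
  | (neg) "\<And>t. q t < 0"
  | (alt) n z where "n > 0" "z (2 * n) = z 0 + 2 * pi" "\<And>k. k < 2 * n \<Longrightarrow> z k < z (Suc k)"
      "\<And>k. k \<le> 2 * n \<Longrightarrow> q (z k) = 0"
      "\<And>k t. k < 2 * n \<Longrightarrow> z k < t \<Longrightarrow> t < z (Suc k) \<Longrightarrow> (-1) ^ k * q t > 0"
proof (cases "\<exists>t. q t = 0")
  case False
  then have "(\<forall>t. q t > 0) \<or> (\<forall>t. q t < 0)"
  proof -
    have "q s > 0 \<longleftrightarrow> q t > 0" for s t
    proof -
      have "(\<forall>r. min s t - 1 < r \<longrightarrow> r < max s t + 1 \<longrightarrow> q r > 0) \<or> (\<forall>r. min s t - 1 < r \<longrightarrow> r < max s t + 1 \<longrightarrow> q r < 0)"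
        using False by (intro constant_sign) blast
      moreover have "min s t - 1 < s" "s < max s t + 1" "min s t - 1 < t" "t < max s t + 1" by auto
      ultimately show ?thesis by (metis less_asym)
    qed
    then show ?thesis using False by (metis linorder_neqE_linordered_idom)
  qed
  then show thesis using pos neg by blast
next
  case True
  let ?R = "\<lambda>a b. a < b \<and> q a = 0 \<and> q b = 0 \<and> (\<forall>t. a < t \<and> t < b \<longrightarrow> q t \<noteq> 0)"
  have chain: "\<exists>z M. z 0 = a \<and> z M = a + 2 * pi \<and> (\<forall>k<M. ?R (z k) (z (Suc k))) \<and> M > 0" if "q a = 0" for a
  proof -
    define R where "R = ?R"
    have "R\<^sup>*\<^sup>* a (a + 2 * pi)" unfolding R_def using that periodic[of a] by (intro next_zero_chain) auto
    then obtain M where M: "(R ^^ M) a (a + 2 * pi)" using rtranclp_imp_relpowp by metis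
    obtain z where z0: "z 0 = a" "z M = a + 2 * pi" "\<forall>k<M. R (z k) (z (Suc k))"
      using M unfolding relpowp_fun_conv by blast
    then have z: "z 0 = a" "z M = a + 2 * pi" "\<forall>k<M. ?R (z k) (z (Suc k))" by (simp_all add: R_def)
    moreover have "M > 0" using z pi_gt_zero by (cases M) auto
    ultimately show ?thesis by blast
  qed
  \<comment> \<open>Neighbouring arcs have opposite signs, since their common end is a crossing;
    \<open>s\<close> is the sign on the first arc.\<close>
  have up: "(\<forall>t. z < t \<and> t < z' \<longrightarrow> s * q t > 0) \<Longrightarrow> (\<forall>t. z' < t \<and> t < z'' \<longrightarrow> - s * q t > 0)"
    if R: "?R z z'" "?R z' z''" and s: "s = 1 \<or> s = -1" for z z' z'' s
  proof -
    assume h: "\<forall>t. z < t \<and> t < z' \<longrightarrow> s * q t > 0"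
    obtain \<eta> where \<eta>: "\<eta> > 0" "(\<forall>s. z' < s \<and> s < z' + \<eta> \<longrightarrow> q s > 0) \<and> (\<forall>s. z' - \<eta> < s \<and> s < z' \<longrightarrow> q s < 0) \<or>
     (\<forall>s. z' < s \<and> s < z' + \<eta> \<longrightarrow> q s < 0) \<and> (\<forall>s. z' - \<eta> < s \<and> s < z' \<longrightarrow> q s > 0)"
      using crossing R(1) by blast
    obtain l where l: "max (z' - \<eta>) z < l" "l < z'" using dense[of "max (z' - \<eta>) z" z'] \<eta> R by auto
    obtain r where r: "z' < r" "r < min (z' + \<eta>) z''" using dense[of z' "min (z' + \<eta>) z''"] \<eta> R by auto
    have 1: "s * q l > 0" using h l by auto
    have "q l < 0 \<and> q r > 0 \<or> q l > 0 \<and> q r < 0"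
      using \<eta>(2) by (rule disj_forward) (use l r in auto)
    then have "- s * q r > 0" using 1 s by auto
    moreover have "(\<forall>t. z' < t \<longrightarrow> t < z'' \<longrightarrow> q t > 0) \<or> (\<forall>t. z' < t \<longrightarrow> t < z'' \<longrightarrow> q t < 0)"
      using R(2) by (intro constant_sign) auto
    moreover have "z' < r" "r < z''" using r by auto
    ultimately have "s = 1 \<and> (\<forall>t. z' < t \<longrightarrow> t < z'' \<longrightarrow> q t < 0) \<or> s = -1 \<and> (\<forall>t. z' < t \<longrightarrow> t < z'' \<longrightarrow> q t > 0)"
      using s by (metis less_asym mult_1 mult_minus1 neg_less_0_iff_less minus_minus)
    then show "\<forall>t. z' < t \<and> t < z'' \<longrightarrow> - s * q t > 0" by auto
  qed
  obtain a where a: "q a = 0" using True by blast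
  \<comment> \<open>The enumeration must begin at a crossing from negative to positive, so that the
    arc number \<open>k\<close> has sign \<open>(-1) ^ k\<close>. If \<open>a\<close> is a crossing
    of the other kind, the next zero is of this one.\<close>
  obtain a' where a': "q a' = 0" "\<exists>\<eta>>0. (\<forall>s. a' < s \<and> s < a' + \<eta> \<longrightarrow> q s > 0) \<and> (\<forall>s. a' - \<eta> < s \<and> s < a' \<longrightarrow> q s < 0)"
  proof -
    obtain z M where z: "z 0 = a" "\<forall>k<M. ?R (z k) (z (Suc k))" "M > 0" using chain[OF a] by blast
    have R: "?R a (z 1)" using z(2)[rule_format, of 0] z(1,3) by simp
    obtain \<eta> where \<eta>: "\<eta> > 0" "(\<forall>s. a < s \<and> s < a + \<eta> \<longrightarrow> q s > 0) \<and> (\<forall>s. a - \<eta> < s \<and> s < a \<longrightarrow> q s < 0) \<or>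
     (\<forall>s. a < s \<and> s < a + \<eta> \<longrightarrow> q s < 0) \<and> (\<forall>s. a - \<eta> < s \<and> s < a \<longrightarrow> q s > 0)"
      using crossing a by blast
    obtain \<eta>' where \<eta>': "\<eta>' > 0" "(\<forall>s. z 1 < s \<and> s < z 1 + \<eta>' \<longrightarrow> q s > 0) \<and> (\<forall>s. z 1 - \<eta>' < s \<and> s < z 1 \<longrightarrow> q s < 0) \<or>
     (\<forall>s. z 1 < s \<and> s < z 1 + \<eta>' \<longrightarrow> q s < 0) \<and> (\<forall>s. z 1 - \<eta>' < s \<and> s < z 1 \<longrightarrow> q s > 0)"
      using crossing[of "z 1"] R by metis
    obtain l where l: "max (z 1 - \<eta>') a < l" "l < z 1" using dense[of "max (z 1 - \<eta>') a" "z 1"] \<eta>' R by auto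
    obtain r where r: "a < r" "r < min (a + \<eta>) (z 1)" using dense[of a "min (a + \<eta>) (z 1)"] \<eta> R by auto
    have "(\<forall>t. a < t \<longrightarrow> t < z 1 \<longrightarrow> q t > 0) \<or> (\<forall>t. a < t \<longrightarrow> t < z 1 \<longrightarrow> q t < 0)"
      using R by (intro constant_sign) auto
    then have same: "q l > 0 \<longleftrightarrow> q r > 0" using l r by (auto dest: less_asym)
    show thesis
    proof (cases "q r > 0")
      case True
      then have "\<not> (\<forall>s. a < s \<and> s < a + \<eta> \<longrightarrow> q s < 0)" using r by (auto dest: less_asym)
      then have "(\<forall>s. a < s \<and> s < a + \<eta> \<longrightarrow> q s > 0) \<and> (\<forall>s. a - \<eta> < s \<and> s < a \<longrightarrow> q s < 0)"
        using \<eta>(2) by blast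
      then show thesis using that[of a] a \<eta>(1) by blast
    next
      case False
      then have "\<not> (\<forall>s. z 1 - \<eta>' < s \<and> s < z 1 \<longrightarrow> q s > 0)" using l same by auto
      then have "(\<forall>s. z 1 < s \<and> s < z 1 + \<eta>' \<longrightarrow> q s > 0) \<and> (\<forall>s. z 1 - \<eta>' < s \<and> s < z 1 \<longrightarrow> q s < 0)"
        using \<eta>'(2) by blast
      then show thesis using that[of "z 1"] R \<eta>'(1) by blast
    qed
  qed
  obtain z M where z: "z 0 = a'" "z M = a' + 2 * pi" "\<And>k. k < M \<Longrightarrow> ?R (z k) (z (Suc k))" "M > 0"
    using chain[OF a'(1)] by blast
  obtain \<eta> where \<eta>: "\<eta> > 0" "\<And>s. a' < s \<Longrightarrow> s < a' + \<eta> \<Longrightarrow> q s > 0" "\<And>s. a' - \<eta> < s \<Longrightarrow> s < a' \<Longrightarrow> q s < 0"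
    using a'(2) by blast
  have sgn: "\<forall>t. z k < t \<and> t < z (Suc k) \<longrightarrow> (-1) ^ k * q t > 0" if "k < M" for k
    using that
  proof (induction k)
    case 0
    have R: "?R (z 0) (z (Suc 0))" using z(3)[OF 0] .
    obtain r where r: "z 0 < r" "r < min (z 0 + \<eta>) (z (Suc 0))" using dense[of "z 0" "min (z 0 + \<eta>) (z (Suc 0))"] \<eta> R by auto
    have "(\<forall>t. z 0 < t \<longrightarrow> t < z (Suc 0) \<longrightarrow> q t > 0) \<or> (\<forall>t. z 0 < t \<longrightarrow> t < z (Suc 0) \<longrightarrow> q t < 0)"
      using R by (intro constant_sign) auto
    moreover have "q r > 0" using \<eta>(2)[of r] r z(1) by auto
    ultimately show ?case using r by (auto dest: less_asym)
  next
    case (Suc k)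
    then show ?case
      using up[of "z k" "z (Suc k)" "z (Suc (Suc k))" "(-1) ^ k"] z(3)[of k] z(3)[of "Suc k"]
      by (simp add: power_minus1_even neg_one_even_power minus_one_power_iff)
  qed
  \<comment> \<open>If \<open>M\<close> were odd, the last arc would be positive; but it ends at
    \<open>a' + 2 * pi\<close>, a copy of \<open>a'\<close>, to whose left \<open>q\<close> is
    negative.\<close>
  have "even M"
  proof (rule ccontr)
    assume odd: "odd M"
    define k where "k = M - 1"
    have k: "k < M" "Suc k = M" "even k" using z(4) odd by (auto simp: k_def)
    obtain l where l: "max (z M - \<eta>) (z k) < l" "l < z M"
      using dense[of "max (z M - \<eta>) (z k)" "z M"] \<eta> z(3)[OF k(1)] k by auto
    have "q l > 0" using sgn[OF k(1)] l k by auto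
    moreover have "q l < 0" using \<eta>(3)[of "l - 2 * pi"] periodic[of "l - 2 * pi"] l z(2) by auto
    ultimately show False by simp
  qed
  then obtain n where n: "M = 2 * n" by blast
  show thesis
  proof (rule alt[of n z])
    show "q (z k) = 0" if "k \<le> 2 * n" for k
      using that z(1) a'(1) z(3)[of "k - 1"] n by (cases k) auto
    show "z k < z (Suc k)" if "k < 2 * n" for k using that z(3) n by blast
    show "(-1) ^ k * q t > 0" if "k < 2 * n" "z k < t" "t < z (Suc k)" for k t using sgn that n by blast
  qed (use z n in auto)
qed

end

section \<open>Piecewise linear maps and fans in the plane\<close>

text \<open>A half-space pulls back under an affine map to a set of the same form, whose normal
  vector is given by the adjoint; the intersection with \<open>P\<close> keeps the result
  bounded.\<close>

lemma polytope_affine_preimage: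
  fixes g :: "'a::euclidean_space \<Rightarrow> 'b::euclidean_space"
  assumes P: "polytope P" and Q: "polytope Q" and g: "affine_on P g"
  shows "polytope {x \<in> P. g x \<in> Q}"
proof -
  obtain l c where l: "linear l" and gx: "\<And>x. x \<in> P \<Longrightarrow> g x = l x + c"
    using g by (auto simp: affine_on_def)
  obtain F where F: "finite F" "Q = \<Inter> F" "\<forall>h\<in>F. \<exists>a b. a \<noteq> 0 \<and> h = {x. a \<bullet> x \<le> b}"
    using polytope_imp_polyhedron[OF Q] by (auto simp: polyhedron_def)
  have "polyhedron {x. l x + c \<in> h}" if hF: "h \<in> F" for h
  proof -
    obtain a b where h: "h = {x. a \<bullet> x \<le> b}" using bspec[OF F(3) hF] by blast
    have "a \<bullet> l x = adjoint l a \<bullet> x" for x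
      using adjoint_works[OF l, of x a] by (simp add: inner_commute)
    then have "{x. l x + c \<in> h} = {x. adjoint l a \<bullet> x \<le> b - a \<bullet> c}"
      by (simp add: h inner_add_right le_diff_eq)
    then show ?thesis by (simp add: polyhedron_halfspace_le)
  qed
  then have "polyhedron (\<Inter>h\<in>F. {x. l x + c \<in> h})"
    using F(1) by (intro polyhedron_Inter) auto
  moreover have "{x \<in> P. g x \<in> Q} = P \<inter> (\<Inter>h\<in>F. {x. l x + c \<in> h})"
    using gx F(2) by auto
  ultimately show ?thesis using P by (simp add: polytope_Int_polyhedron)
qed

lemma affine_on_subset: "affine_on P g \<Longrightarrow> Q \<subseteq> P \<Longrightarrow> affine_on Q g"
  unfolding affine_on_def by blast

lemma affine_on_compose:
  assumes "affine_on P g" "affine_on Q k" "g ` P \<subseteq> Q"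
  shows "affine_on P (\<lambda>x. k (g x))"
proof -
  obtain l c where l: "linear l" "\<And>x. x \<in> P \<Longrightarrow> g x = l x + c" using assms(1) by (auto simp: affine_on_def)
  obtain m d where m: "linear m" "\<And>x. x \<in> Q \<Longrightarrow> k x = m x + d" using assms(2) by (auto simp: affine_on_def)
  have "linear (m \<circ> l)" using l m by (intro linear_compose)
  moreover have "k (g x) = (m \<circ> l) x + (m c + d)" if "x \<in> P" for x
  proof -
    have "g x \<in> Q" using assms(3) that by blast
    then show ?thesis using l m that by (simp add: linear_add)
  qed
  ultimately show ?thesis unfolding affine_on_def by blast
qed

text \<open>The common refinement consists of the parts of a piece \<open>P\<close> that
  \<open>g\<close> sends into a piece \<open>Q\<close>. The pieces of \<open>k\<close> cover only a
  neighbourhood of \<open>g x\<close>, and continuity of \<open>g\<close> pulls this neighbourhood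
  back.\<close>

lemma PL_map_compose:
  assumes g: "PL_map X g" and k: "PL_map Y k" and cont: "continuous_on X g" and sub: "g ` X \<subseteq> Y"
  shows "PL_map X (\<lambda>x. k (g x))"
  unfolding PL_map_def
proof
  fix x assume x: "x \<in> X"
  obtain \<P> W where P: "finite \<P>" "\<And>P. P \<in> \<P> \<Longrightarrow> polytope P \<and> P \<subseteq> X \<and> affine_on P g"
    and W: "open W" "x \<in> W" "X \<inter> W \<subseteq> \<Union>\<P>" using g x unfolding PL_map_def by metis
  have "g x \<in> Y" using sub x by blast
  then obtain \<Q> V where Q: "finite \<Q>" "\<And>Q. Q \<in> \<Q> \<Longrightarrow> polytope Q \<and> Q \<subseteq> Y \<and> affine_on Q k"
    and V: "open V" "g x \<in> V" "Y \<inter> V \<subseteq> \<Union>\<Q>" using k unfolding PL_map_def by metis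
  obtain T where T: "open T" "T \<inter> X = g -` V \<inter> X"
    using cont V(1) by (metis continuous_on_open_invariant)
  let ?S = "(\<lambda>(P, Q). {x \<in> P. g x \<in> Q}) ` (\<P> \<times> \<Q>)"
  show "\<exists>\<P> W. finite \<P> \<and> (\<forall>P\<in>\<P>. polytope P \<and> P \<subseteq> X \<and> affine_on P (\<lambda>x. k (g x))) \<and>
          open W \<and> x \<in> W \<and> X \<inter> W \<subseteq> \<Union>\<P>"
  proof (intro exI[of _ ?S] exI[of _ "W \<inter> T"] conjI ballI)
    fix A assume "A \<in> ?S"
    then obtain P Q where PQ: "P \<in> \<P>" "Q \<in> \<Q>" "A = {x \<in> P. g x \<in> Q}" by auto
    show "polytope A" "A \<subseteq> X" using PQ P(2)[OF PQ(1)] Q(2)[OF PQ(2)] by (auto intro: polytope_affine_preimage)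
    show "affine_on A (\<lambda>x. k (g x))"
      using P(2)[OF PQ(1)] Q(2)[OF PQ(2)] PQ(3)
      by (intro affine_on_compose[of A g Q k]) (auto intro: affine_on_subset)
  next
    show "x \<in> W \<inter> T" using W V T x by auto
    show "X \<inter> (W \<inter> T) \<subseteq> \<Union> ?S"
    proof
      fix y assume y: "y \<in> X \<inter> (W \<inter> T)"
      then obtain P where "P \<in> \<P>" "y \<in> P" using W by blast
      moreover have "g y \<in> Y \<inter> V" using y T sub by auto
      then obtain Q where "Q \<in> \<Q>" "g y \<in> Q" using V by blast
      ultimately show "y \<in> \<Union> ?S" by auto
    qed
  qed (use P Q W T in auto)
qed

text \<open>A piece may leave \<open>U\<close>, so it is cut with a closed box inside the open set
  that defines \<open>U\<close>; a closed box is a polytope, and the open box serves in the new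
  neighbourhood.\<close>

lemma PL_map_open_subset:
  assumes g: "PL_map X g" and U: "openin (top_of_set X) U"
  shows "PL_map U g"
  unfolding PL_map_def
proof
  fix x assume x: "x \<in> U"
  obtain T where T: "open T" "U = X \<inter> T" using U by (auto simp: openin_open)
  obtain \<P> W where P: "finite \<P>" "\<And>P. P \<in> \<P> \<Longrightarrow> polytope P \<and> P \<subseteq> X \<and> affine_on P g"
    and W: "open W" "x \<in> W" "X \<inter> W \<subseteq> \<Union>\<P>" using g x T unfolding PL_map_def by (metis IntE)
  have "x \<in> T" using x T(2) by blast
  then obtain a b where ab: "cbox a b \<subseteq> T" "x \<in> box a b"
    by (rule open_contains_cbox[OF T(1)])
  let ?S = "(\<lambda>P. P \<inter> cbox a b) ` \<P>"
  show "\<exists>\<P> W. finite \<P> \<and> (\<forall>P\<in>\<P>. polytope P \<and> P \<subseteq> U \<and> affine_on P g) \<and>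
          open W \<and> x \<in> W \<and> U \<inter> W \<subseteq> \<Union>\<P>"
  proof (intro exI[of _ ?S] exI[of _ "W \<inter> box a b"] conjI ballI)
    fix A assume "A \<in> ?S"
    then obtain Q where Q: "Q \<in> \<P>" "A = Q \<inter> cbox a b" by auto
    show "polytope A" "A \<subseteq> U" "affine_on A g"
      using P(2)[OF Q(1)] Q(2) ab(1) T(2)
      by (auto intro: polytope_Int polytope_interval affine_on_subset)
  next
    show "U \<inter> (W \<inter> box a b) \<subseteq> \<Union> ?S"
      using W(3) T(2) box_subset_cbox[of a b] by fastforce
  qed (use P W ab open_box in auto)
qed

lemma PL_map_affine:
  fixes l :: "'a::euclidean_space \<Rightarrow> 'b::euclidean_space"
  assumes l: "linear l" and X: "open X"
  shows "PL_map X (\<lambda>x. l x + c)"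
proof -
  have "PL_map UNIV (\<lambda>x. l x + c)"
    unfolding PL_map_def
  proof
    fix x :: 'a
    obtain a b where "x \<in> box a b" by (rule open_contains_cbox[OF open_UNIV UNIV_I, of x])
    then show "\<exists>\<P> W. finite \<P> \<and> (\<forall>P\<in>\<P>. polytope P \<and> P \<subseteq> UNIV \<and> affine_on P (\<lambda>x. l x + c)) \<and>
          open W \<and> x \<in> W \<and> UNIV \<inter> W \<subseteq> \<Union>\<P>"
      using l box_subset_cbox[of a b]
      by (intro exI[of _ "{cbox a b}"] exI[of _ "box a b"])
         (auto simp: polytope_interval affine_on_def open_box)
  qed
  then show ?thesis by (rule PL_map_open_subset) (simp add: X)
qed

section \<open>Fans of sectors and the maps that are linear on them\<close>

definition cross :: "complex \<Rightarrow> complex \<Rightarrow> real" where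
  "cross x y = Im (cnj x * y)"

lemma cross_simps:
  "cross x (y + z) = cross x y + cross x z" "cross (x + y) z = cross x z + cross y z"
  "cross x (a *\<^sub>R y) = a * cross x y" "cross (a *\<^sub>R x) y = a * cross x y" "cross x x = 0"
  by (simp_all add: cross_def algebra_simps)

lemma cross_cis: "cross (cis s) (cis t) = sin (t - s)"
  by (simp add: cross_def cis_cnj cis_mult)

text \<open>Gaps below pi make neighbouring rays linearly independent and the sectors convex; the
  last angle is the first ray again after one turn.\<close>

definition fan :: "nat \<Rightarrow> (nat \<Rightarrow> real) \<Rightarrow> bool" where
  "fan N u \<longleftrightarrow> N > 0 \<and> u N = u 0 + 2 * pi \<and> (\<forall>i<N. u i < u (Suc i) \<and> u (Suc i) - u i < pi)"

definition sector :: "(nat \<Rightarrow> real) \<Rightarrow> nat \<Rightarrow> complex set" where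
  "sector u i = {z. 0 \<le> cross (cis (u i)) z \<and> 0 \<le> cross z (cis (u (Suc i)))}"

text \<open>Cramer's rule: \<open>cross\<close> is the determinant, so the two quotients are the
  coordinates of \<open>z\<close> with respect to the bounding rays, which are sent to
  \<open>w i\<close> and \<open>w (Suc i)\<close>.\<close>

definition sector_map :: "(nat \<Rightarrow> real) \<Rightarrow> (nat \<Rightarrow> complex) \<Rightarrow> nat \<Rightarrow> complex \<Rightarrow> complex" where
  "sector_map u w i z =
     (cross z (cis (u (Suc i))) / sin (u (Suc i) - u i)) *\<^sub>R w i +
     (cross (cis (u i)) z / sin (u (Suc i) - u i)) *\<^sub>R w (Suc i)"

text \<open>Sectors overlap in rays, so a sector has to be picked; by \<open>fan_map_agree\<close>
  the pick is immaterial as soon as \<open>w N = w 0\<close>.\<close>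

definition fan_map :: "nat \<Rightarrow> (nat \<Rightarrow> real) \<Rightarrow> (nat \<Rightarrow> complex) \<Rightarrow> complex \<Rightarrow> complex" where
  "fan_map N u w z = sector_map u w (SOME i. i < N \<and> z \<in> sector u i) z"

lemma fan_sin: "fan N u \<Longrightarrow> i < N \<Longrightarrow> sin (u (Suc i) - u i) > 0"
  by (auto simp: fan_def intro!: sin_gt_zero)

lemma sector_map_comb:
  assumes "fan N u" "i < N"
  shows "sector_map u w i (a *\<^sub>R cis (u i) + b *\<^sub>R cis (u (Suc i))) = a *\<^sub>R w i + b *\<^sub>R w (Suc i)"
  using fan_sin[OF assms] by (simp add: sector_map_def cross_simps cross_cis)

lemma sector_decomp:
  assumes "fan N u" "i < N"
  shows "z = (cross z (cis (u (Suc i))) / sin (u (Suc i) - u i)) *\<^sub>R cis (u i) +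
     (cross (cis (u i)) z / sin (u (Suc i) - u i)) *\<^sub>R cis (u (Suc i))" (is "z = ?r")
proof -
  let ?s = "sin (u (Suc i) - u i)"
  have s: "?s > 0" using fan_sin[OF assms] .
  have "?s *\<^sub>R z = cross z (cis (u (Suc i))) *\<^sub>R cis (u i) + cross (cis (u i)) z *\<^sub>R cis (u (Suc i))"
    by (simp add: complex_eq_iff cross_def sin_diff algebra_simps)
  then have "(1 / ?s) *\<^sub>R (?s *\<^sub>R z) = ?r" by (simp add: scaleR_add_right)
  then show ?thesis using s by simp
qed

lemma sector_comb:
  assumes f: "fan N u" "i < N"
  shows "z \<in> sector u i \<longleftrightarrow> (\<exists>a\<ge>0. \<exists>b\<ge>0. z = a *\<^sub>R cis (u i) + b *\<^sub>R cis (u (Suc i)))"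
proof
  assume "z \<in> sector u i"
  then show "\<exists>a\<ge>0. \<exists>b\<ge>0. z = a *\<^sub>R cis (u i) + b *\<^sub>R cis (u (Suc i))"
    using sector_decomp[OF f, of z] fan_sin[OF f]
    by (metis (no_types, lifting) divide_nonneg_pos mem_Collect_eq sector_def)
next
  assume "\<exists>a\<ge>0. \<exists>b\<ge>0. z = a *\<^sub>R cis (u i) + b *\<^sub>R cis (u (Suc i))"
  then show "z \<in> sector u i"
    using fan_sin[OF f] by (auto simp: sector_def cross_simps cross_cis)
qed

text \<open>The two determinants are positive multiples of \<open>sin (t - u i)\<close> and
  \<open>sin (u (Suc i) - t)\<close>. The first confines \<open>t\<close> to half a turn after
  \<open>u i\<close>; then, as the gap is below pi, the second excludes angles beyond
  \<open>u (Suc i)\<close>.\<close>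

lemma sector_polar:
  assumes f: "fan N u" "i < N"
  shows "z \<in> sector u i \<longleftrightarrow> (\<exists>r\<ge>0. \<exists>t. u i \<le> t \<and> t \<le> u (Suc i) \<and> z = r *\<^sub>R cis t)"
proof
  have gap: "u i < u (Suc i)" "u (Suc i) - u i < pi" using f by (auto simp: fan_def)
  {
    assume z: "z \<in> sector u i"
    define t where "t = u i + Arg2pi (z * cis (- u i))"
    have zt: "z = norm z *\<^sub>R cis t"
    proof -
      have "z * cis (- u i) = of_real (norm z) * cis (Arg2pi (z * cis (- u i)))"
        using Arg2pi_eq[of "z * cis (- u i)"] by (simp add: norm_mult cis_conv_exp mult.commute)
      then have "z * cis (- u i) * cis (u i) = of_real (norm z) * cis (Arg2pi (z * cis (- u i))) * cis (u i)" by simp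
      then show ?thesis by (simp add: mult.assoc cis_mult t_def scaleR_conv_of_real add.commute)
    qed
    show "\<exists>r\<ge>0. \<exists>t. u i \<le> t \<and> t \<le> u (Suc i) \<and> z = r *\<^sub>R cis t"
    proof (cases "z = 0")
      case True
      then show ?thesis using gap by (intro exI[of _ 0]) auto
    next
      case False
      have t: "u i \<le> t" "t < u i + 2 * pi" using Arg2pi_ge_0 Arg2pi_lt_2pi by (auto simp: t_def)
      have "0 \<le> norm z * sin (t - u i)" "0 \<le> norm z * sin (u (Suc i) - t)"
        using z zt by (metis (no_types, lifting) cross_cis cross_simps(3,4) mem_Collect_eq sector_def)+
      then have s: "0 \<le> sin (t - u i)" "0 \<le> sin (u (Suc i) - t)"
        using False by (simp_all add: zero_le_mult_iff)
      have "t - u i \<le> pi"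
        using sin_lt_zero[of "t - u i"] s t by force
      then have "t \<le> u (Suc i)"
        using sin_gt_zero[of "t - u (Suc i)"] s gap sin_minus[of "t - u (Suc i)"] by force
      then show ?thesis using zt t by (intro exI[of _ "norm z"]) auto
    qed
  }
  assume "\<exists>r\<ge>0. \<exists>t. u i \<le> t \<and> t \<le> u (Suc i) \<and> z = r *\<^sub>R cis t"
  then obtain r t where "r \<ge> 0" "u i \<le> t" "t \<le> u (Suc i)" "z = r *\<^sub>R cis t" by blast
  moreover from this have "sin (t - u i) \<ge> 0" "sin (u (Suc i) - t) \<ge> 0"
    using gap by (auto intro!: sin_ge_zero)
  ultimately show "z \<in> sector u i" by (auto simp: sector_def cross_simps cross_cis)
qed

lemma fan_mono:
  assumes "fan N u" "i \<le> j" "j \<le> N" shows "u i \<le> u j" "i < j \<Longrightarrow> u i < u j"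
proof -
  have "i < j \<longrightarrow> u i < u j" if "j \<le> N" for j
    using that
  proof (induction j)
    case (Suc j)
    then have "u j < u (Suc j)" using assms(1) by (simp add: fan_def)
    then show ?case using Suc by (auto simp: less_Suc_eq)
  qed simp
  then show "i < j \<Longrightarrow> u i < u j" "u i \<le> u j" using assms by (auto simp: le_less)
qed

lemma locate_interval:
  fixes u :: "nat \<Rightarrow> 'a::linorder"
  assumes t: "u 0 \<le> t" "t \<le> u N" and N: "N > 0"
  obtains i where "i < N" "u i \<le> t" "t \<le> u (Suc i)"
proof -
  \<comment> \<open>Index 0 is excluded, so that \<open>t = u 0\<close> falls into the first
    interval and \<open>j - 1\<close> is a genuine predecessor.\<close>
  define j where "j = (LEAST j. t \<le> u j \<and> 0 < j)"
  have ex: "t \<le> u N \<and> 0 < N" using N t by simp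
  have j: "t \<le> u j" "0 < j" "j \<le> N"
    using LeastI[of "\<lambda>j. t \<le> u j \<and> 0 < j", OF ex] Least_le[of "\<lambda>j. t \<le> u j \<and> 0 < j", OF ex] by (auto simp: j_def)
  have "u (j - 1) \<le> t"
  proof (cases "j = 1")
    case False
    then have "\<not> (t \<le> u (j - 1) \<and> 0 < j - 1)"
      using not_less_Least[of "j - 1" "\<lambda>j. t \<le> u j \<and> 0 < j"] j by (simp add: j_def)
    then show ?thesis using False j by auto
  qed (use t in simp)
  then show thesis using that[of "j - 1"] j by simp
qed

lemma polar_from:
  obtains t where "a \<le> t" "t < a + 2 * pi" "z = norm z *\<^sub>R cis t"
proof -
  let ?t = "a + Arg2pi (z * cis (- a))"
  have "z * cis (- a) = of_real (norm z) * cis (Arg2pi (z * cis (- a)))"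
    using Arg2pi_eq[of "z * cis (- a)"] by (simp add: norm_mult cis_conv_exp mult.commute)
  then have "z * cis (- a) * cis a = of_real (norm z) * cis (Arg2pi (z * cis (- a))) * cis a" by simp
  then have "z = norm z *\<^sub>R cis ?t" by (simp add: mult.assoc cis_mult scaleR_conv_of_real add.commute)
  then show thesis using that[of ?t] Arg2pi_ge_0 Arg2pi_lt_2pi by auto
qed

lemma fan_cover:
  assumes f: "fan N u" obtains i where "i < N" "z \<in> sector u i"
proof -
  obtain t where t: "u 0 \<le> t" "t < u 0 + 2 * pi" "z = norm z *\<^sub>R cis t" using polar_from .
  then have "t \<le> u N" using f by (simp add: fan_def)
  then obtain i where "i < N" "u i \<le> t" "t \<le> u (Suc i)"
    using locate_interval[of u t N] t(1) f by (auto simp: fan_def)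
  then show thesis using that[of i] sector_polar[OF f, of i z] t(3) norm_ge_zero by blast
qed

text \<open>The angles of \<open>z\<close> in the two sectors differ by 0 or by a full turn. In the
  first case the sectors are neighbours and share the ray \<open>u j\<close>; in the second they are
  the first and the last one, and their common ray is treated alike because
  \<open>w N = w 0\<close>.\<close>

lemma fan_map_agree:
  assumes f: "fan N u" and w: "w N = w 0" and ij: "i < j" "j < N"
    and z: "z \<in> sector u i" "z \<in> sector u j"
  shows "sector_map u w i z = sector_map u w j z"
proof (cases "z = 0")
  case True
  then show ?thesis by (simp add: sector_map_def cross_def)
next
  case False
  have iN: "i < N" using ij by simp
  obtain r t where t: "r \<ge> 0" "u i \<le> t" "t \<le> u (Suc i)" "z = r *\<^sub>R cis t" using z(1) sector_polar[OF f iN] by blast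
  obtain r' t' where t': "r' \<ge> 0" "u j \<le> t'" "t' \<le> u (Suc j)" "z = r' *\<^sub>R cis t'" using z(2) sector_polar[OF f ij(2)] by blast
  have "norm z = r" unfolding t(4) using t(1) by simp
  moreover have "norm z = r'" unfolding t'(4) using t'(1) by simp
  ultimately have r: "r = r'" "r > 0" using False by auto
  then have "cis t = cis t'" using t(4) t'(4) by (metis scaleR_left_imp_eq less_irrefl)
  then have "cis (t' - t) = 1" by (simp add: cis_divide[symmetric])
  then have "cos (t' - t) = 1" by (metis cis.sel(1) one_complex.sel(1))
  then obtain k :: int where k: "t' - t = 2 * pi * of_int k"
    unfolding cos_one_2pi_int by (auto simp: mult_ac)
  have le: "u 0 \<le> u i" "u (Suc i) \<le> u j" "u (Suc j) \<le> u N"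
    using fan_mono(1)[OF f] ij by auto
  have N: "u N = u 0 + 2 * pi" using f by (simp add: fan_def)
  have "0 \<le> t' - t" "t' - t \<le> 2 * pi" using t t' le N by auto
  then have "0 \<le> real_of_int k" "real_of_int k \<le> 1"
    using k pi_gt_zero by (simp_all add: zero_le_mult_iff)
  then have "0 \<le> k" "k \<le> 1" by simp_all
  then consider "k = 0" | "k = 1" by linarith
  then show ?thesis
  proof cases
    case 1
    then have "t = u (Suc i)" "t' = u j" "u (Suc i) = u j" using k t t' le by auto
    then have j: "j = Suc i" using fan_mono(2)[OF f, of "Suc i" j] ij by force
    have "z = 0 *\<^sub>R cis (u i) + r *\<^sub>R cis (u (Suc i))" "z = r *\<^sub>R cis (u j) + 0 *\<^sub>R cis (u (Suc j))"
      using t \<open>t = u (Suc i)\<close> j by auto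
    then show ?thesis
      using sector_map_comb[OF f iN, of w 0 r] sector_map_comb[OF f ij(2), of w r 0] j by simp
  next
    case 2
    then have e: "t = u 0" "t' = u N" "u 0 = u i" "u (Suc j) = u N" using k t t' le N by auto
    have i: "i = 0" using fan_mono(2)[OF f, of 0 i] e iN by force
    have j: "Suc j = N" using fan_mono(2)[OF f, of "Suc j" N] e ij by force
    have "z = r *\<^sub>R cis (u 0)" using t(4) unfolding e(1) .
    then have zi: "z = r *\<^sub>R cis (u i) + 0 *\<^sub>R cis (u (Suc i))" by (simp add: i)
    have "z = r *\<^sub>R cis (u N)" using t'(4) unfolding e(2) r(1) .
    then have zj: "z = 0 *\<^sub>R cis (u j) + r *\<^sub>R cis (u (Suc j))" by (simp add: e(4))
    have "sector_map u w i z = r *\<^sub>R w i"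
      using sector_map_comb[OF f iN, of w r 0] unfolding zi[symmetric] by simp
    moreover have "sector_map u w j z = r *\<^sub>R w (Suc j)"
      using sector_map_comb[OF f ij(2), of w 0 r] unfolding zj[symmetric] by simp
    ultimately show ?thesis using w i j by simp
  qed
qed

lemma fan_map_eq:
  assumes f: "fan N u" and w: "w N = w 0" and i: "i < N" "z \<in> sector u i"
  shows "fan_map N u w z = sector_map u w i z"
proof -
  let ?j = "SOME i. i < N \<and> z \<in> sector u i"
  have j: "?j < N \<and> z \<in> sector u ?j" using i by (metis (mono_tags, lifting) someI)
  then have "sector_map u w ?j z = sector_map u w i z"
    using fan_map_agree[OF f w, of i ?j z] fan_map_agree[OF f w, of ?j i z] i
    by (metis linorder_neqE_nat)
  then show ?thesis by (simp add: fan_map_def)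
qed

lemma linear_sector_map: "linear (sector_map u w i)"
  by (rule linearI) (simp_all add: sector_map_def cross_simps add_divide_distrib scaleR_add_left scaleR_add_right)

lemma polyhedron_sector: "polyhedron (sector u i)"
proof -
  have "sector u i = {z. (\<i> * cis (u i)) \<bullet> z \<ge> 0} \<inter> {z. (- \<i> * cis (u (Suc i))) \<bullet> z \<ge> 0}"
    by (auto simp: sector_def cross_def inner_complex_def algebra_simps)
  then show ?thesis by (simp add: polyhedron_halfspace_ge polyhedron_halfspace_le)
qed

lemma continuous_fan_map:
  assumes f: "fan N u" and w: "w N = w 0"
  shows "continuous_on UNIV (fan_map N u w)"
proof -
  have "continuous_on (\<Union>i<N. sector u i) (fan_map N u w)"
  proof (rule continuous_on_closed_Union)
    fix i assume i: "i \<in> {..<N}"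
    show "closed (sector u i)" by (rule polyhedron_imp_closed[OF polyhedron_sector])
    have "continuous_on (sector u i) (sector_map u w i)"
      by (intro linear_continuous_on linear_conv_bounded_linear[THEN iffD1] linear_sector_map)
    then show "continuous_on (sector u i) (fan_map N u w)"
      by (rule continuous_on_eq) (use fan_map_eq[OF f w] i in auto)
  qed simp
  moreover have "(\<Union>i<N. sector u i) = UNIV" using fan_cover[OF f] by blast
  ultimately show ?thesis by simp
qed

lemma PL_fan_map:
  assumes f: "fan N u" and w: "w N = w 0"
  shows "PL_map UNIV (fan_map N u w)"
  unfolding PL_map_def
proof
  fix x :: complex
  obtain a b where ab: "x \<in> box a b" by (rule open_contains_cbox[OF open_UNIV UNIV_I, of x])
  let ?S = "(\<lambda>i. cbox a b \<inter> sector u i) ` {..<N}"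
  show "\<exists>\<P> W. finite \<P> \<and> (\<forall>P\<in>\<P>. polytope P \<and> P \<subseteq> UNIV \<and> affine_on P (fan_map N u w)) \<and>
          open W \<and> x \<in> W \<and> UNIV \<inter> W \<subseteq> \<Union>\<P>"
  proof (intro exI[of _ ?S] exI[of _ "box a b"] conjI ballI)
    fix P assume "P \<in> ?S"
    then obtain i where i: "i < N" "P = cbox a b \<inter> sector u i" by auto
    show "polytope P" unfolding i(2) by (intro polytope_Int_polyhedron polytope_interval polyhedron_sector)
    have "\<forall>z\<in>P. fan_map N u w z = sector_map u w i z + 0" using fan_map_eq[OF f w] i by auto
    then show "affine_on P (fan_map N u w)" unfolding affine_on_def using linear_sector_map by blast
  next
    show "UNIV \<inter> box a b \<subseteq> \<Union> ?S"
    proof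
      fix z assume "z \<in> UNIV \<inter> box a b"
      then have "z \<in> cbox a b" using box_subset_cbox by blast
      moreover obtain i where "i < N" "z \<in> sector u i" using fan_cover[OF f] .
      ultimately show "z \<in> \<Union> ?S" by blast
    qed
  qed (use ab open_box in auto)
qed

text \<open>Positive factors \<open>R i\<close> send each sector of one fan into the sector of the
  other fan with the same index. On matching sectors both maps are linear, and they invert each
  other on the bounding rays.\<close>

lemma fan_map_inverse:
  assumes f: "fan N u" and g: "fan N \<alpha>" and R: "\<And>i. i \<le> N \<Longrightarrow> R i > 0" "R N = R 0"
  shows "fan_map N \<alpha> (\<lambda>i. (1 / R i) *\<^sub>R cis (u i)) (fan_map N u (\<lambda>i. R i *\<^sub>R cis (\<alpha> i)) z) = z"
proof -
  have per: "cis (u N) = cis (u 0)" "cis (\<alpha> N) = cis (\<alpha> 0)"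
    using f g by (simp_all add: fan_def flip: cis_mult)
  obtain i where i: "i < N" "z \<in> sector u i" using fan_cover[OF f] .
  obtain a b where ab: "a \<ge> 0" "b \<ge> 0" "z = a *\<^sub>R cis (u i) + b *\<^sub>R cis (u (Suc i))"
    using i sector_comb[OF f] by blast
  let ?y = "(a * R i) *\<^sub>R cis (\<alpha> i) + (b * R (Suc i)) *\<^sub>R cis (\<alpha> (Suc i))"
  have Ri: "R i > 0" "R (Suc i) > 0" using R(1) i by auto
  have 1: "fan_map N u (\<lambda>i. R i *\<^sub>R cis (\<alpha> i)) z = ?y"
    using fan_map_eq[OF f _ i(1,2), of "\<lambda>i. R i *\<^sub>R cis (\<alpha> i)"] R per
    by (simp add: ab(3) sector_map_comb[OF f i(1)])
  have y: "?y \<in> sector \<alpha> i"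
    unfolding sector_comb[OF g i(1)]
    by (intro exI[of _ "a * R i"] exI[of _ "b * R (Suc i)"] conjI refl) (use ab Ri in auto)
  have "fan_map N \<alpha> (\<lambda>i. (1 / R i) *\<^sub>R cis (u i)) ?y = z"
    using fan_map_eq[OF g _ i(1) y, of "\<lambda>i. (1 / R i) *\<^sub>R cis (u i)"] R(2) per Ri
    by (simp add: ab(3) sector_map_comb[OF g i(1)])
  then show ?thesis unfolding 1 .
qed

section \<open>Normal form of a conic piecewise linear function\<close>

text \<open>The continuous piecewise linear function that takes the value \<open>j\<close> at \<open>e j\<close> for \<open>j \<le> J\<close>.\<close>

definition interp :: "(nat \<Rightarrow> real) \<Rightarrow> nat \<Rightarrow> real \<Rightarrow> real" where
  "interp e J t = (\<Sum>j<J. max 0 (min 1 ((t - e j) / (e (Suc j) - e j))))"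

lemma increasing_le:
  fixes e :: "nat \<Rightarrow> real"
  assumes e: "\<forall>j<J. e j < e (Suc j)" and "i \<le> j" "j \<le> J"
  shows "e i \<le> e j"
  using assms(2,3)
proof (induction j)
  case (Suc j)
  then show ?case using e[rule_format, of j] by (cases "i = Suc j") auto
qed simp

lemma interp_at:
  assumes e: "\<forall>j<J. e j < e (Suc j)" and k: "k \<le> J"
  shows "interp e J (e k) = k"
proof -
  have "interp e J (e k) = (\<Sum>j<J. if j < k then 1 else 0)"
    unfolding interp_def
  proof (rule sum.cong[OF refl])
    fix j assume "j \<in> {..<J}"
    then have j: "j < J" by simp
    show "max 0 (min 1 ((e k - e j) / (e (Suc j) - e j))) = (if j < k then 1 else 0)"
    proof (cases "j < k")
      case True
      then have "e (Suc j) \<le> e k" using increasing_le[OF e, of "Suc j" k] k by simp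
      then have "1 \<le> (e k - e j) / (e (Suc j) - e j)" using e[rule_format, OF j] by (simp add: le_divide_eq)
      then show ?thesis using True by simp
    next
      case False
      then have "e k \<le> e j" using increasing_le[OF e, of k j] j by simp
      then have "(e k - e j) / (e (Suc j) - e j) \<le> 0" using e[rule_format, OF j] by (simp add: divide_le_0_iff)
      then show ?thesis using False by simp
    qed
  qed
  also have "\<dots> = card {j\<in>{..<J}. j < k}" by (simp add: sum.If_cases Int_def)
  also have "{j\<in>{..<J}. j < k} = {..<k}" using k by auto
  finally show ?thesis by simp
qed

lemma interp_strict:
  assumes e: "\<forall>j<J. e j < e (Suc j)" and t: "e 0 \<le> s" "s < t" "t \<le> e J"
  shows "interp e J s < interp e J t"
  unfolding interp_def
proof (rule sum_strict_mono_ex1)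
  have J: "J > 0" using t by (cases J) auto
  show "\<forall>j\<in>{..<J}. max 0 (min 1 ((s - e j) / (e (Suc j) - e j))) \<le> max 0 (min 1 ((t - e j) / (e (Suc j) - e j)))"
  proof
    fix j assume "j \<in> {..<J}"
    then have "(s - e j) / (e (Suc j) - e j) \<le> (t - e j) / (e (Suc j) - e j)"
      using e t by (intro divide_right_mono) auto
    then show "max 0 (min 1 ((s - e j) / (e (Suc j) - e j))) \<le> max 0 (min 1 ((t - e j) / (e (Suc j) - e j)))"
      by (auto simp: max_def min_def)
  qed
  \<comment> \<open>A point strictly between \<open>s\<close> and \<open>t\<close>. The ramp whose
    interval contains \<open>m\<close> starts before \<open>t\<close> and ends after
    \<open>s\<close>, hence it increases strictly from \<open>s\<close> to \<open>t\<close>.\<close>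
  define m where "m = (s + min t (e J)) / 2"
  have "e 0 \<le> m" "m \<le> e J" using t by (auto simp: m_def)
  then obtain j where "j < J" "e j \<le> m" "m \<le> e (Suc j)" using locate_interval[of e m J] J by blast
  moreover have "s < m" "m < t" using t by (auto simp: m_def)
  ultimately have j: "j < J" "e j < t" "s < e (Suc j)" by auto
  have "max 0 (min 1 ((s - e j) / (e (Suc j) - e j))) < max 0 (min 1 ((t - e j) / (e (Suc j) - e j)))"
  proof -
    have "(s - e j) / (e (Suc j) - e j) < (t - e j) / (e (Suc j) - e j)"
      using e[rule_format, OF j(1)] t by (intro divide_strict_right_mono) auto
    moreover have "0 < (t - e j) / (e (Suc j) - e j)" using j e[rule_format, OF j(1)] by simp
    moreover have "(s - e j) / (e (Suc j) - e j) < 1" using j e[rule_format, OF j(1)] by (simp add: divide_less_eq)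
    ultimately show ?thesis by (auto simp: max_def min_def)
  qed
  then show "\<exists>a\<in>{..<J}. max 0 (min 1 ((s - e a) / (e (Suc a) - e a))) < max 0 (min 1 ((t - e a) / (e (Suc a) - e a)))"
    using j by blast
qed simp

text \<open>On the sector, \<open>Q\<close> coincides with the linear form whose restriction to the
  arc is \<open>q\<close>, and a linear form respects combinations.\<close>

lemma homogeneous_sector_linear:
  assumes f: "fan N u" "i < N" and lin: "trig_linear q (u i) (u (Suc i))"
    and Q: "\<And>r t. r \<ge> 0 \<Longrightarrow> Q (r *\<^sub>R cis t) = r * q t" and ab: "a \<ge> 0" "b \<ge> 0"
  shows "Q (a *\<^sub>R cis (u i) + b *\<^sub>R cis (u (Suc i))) = a * q (u i) + b * q (u (Suc i))"
proof -
  obtain A B where AB: "\<And>t. u i \<le> t \<Longrightarrow> t \<le> u (Suc i) \<Longrightarrow> q t = A * cos t + B * sin t"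
    using lin by (auto simp: trig_linear_def)
  let ?z = "a *\<^sub>R cis (u i) + b *\<^sub>R cis (u (Suc i))"
  have "?z \<in> sector u i" using sector_comb[OF f] ab by blast
  then obtain r t where rt: "r \<ge> 0" "u i \<le> t" "t \<le> u (Suc i)" "?z = r *\<^sub>R cis t"
    using sector_polar[OF f] by blast
  have "Q ?z = A * Re ?z + B * Im ?z" unfolding rt(4) using Q[OF rt(1)] AB[OF rt(2,3)] by (simp add: algebra_simps)
  moreover have "u i \<le> u (Suc i)" using f by (auto simp: fan_def intro: less_imp_le)
  ultimately show ?thesis using AB[of "u i"] AB[of "u (Suc i)"] by (simp add: algebra_simps)
qed

context pl_circle
begin

text \<open>Both functions are positively homogeneous and have the same cyclic sign pattern. The
  circles are cut at matching angles \<open>u i\<close> and \<open>\<alpha> i\<close>, finely enough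
  for both functions to be linear on matching sectors and with zeros matched to zeros. The map
  linear on sectors that sends \<open>cis (u i)\<close> to
  \<open>R i *\<^sub>R cis (\<alpha> i)\<close>, with \<open>R i\<close> the quotient of the two
  values, then carries one function to the other, because both sides agree on the rays.\<close>

lemma normal_form:
  fixes n :: nat and z :: "nat \<Rightarrow> real" and l :: "real \<Rightarrow> real" and \<gamma> :: real
  assumes n: "n > 0" and z: "z (2 * n) = z 0 + 2 * pi" "\<And>k. k < 2 * n \<Longrightarrow> z k < z (Suc k)"
      "\<And>k. k \<le> 2 * n \<Longrightarrow> q (z k) = 0"
      "\<And>k t. k < 2 * n \<Longrightarrow> z k < t \<Longrightarrow> t < z (Suc k) \<Longrightarrow> (-1) ^ k * q t > 0"
    and l: "\<And>j. j < 4 * n \<Longrightarrow> trig_linear l (\<gamma> + j * pi / (2 * n)) (\<gamma> + Suc j * pi / (2 * n))"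
      "\<And>k. k \<le> 2 * n \<Longrightarrow> l (\<gamma> + k * pi / n) = 0"
      "\<And>k t. k < 2 * n \<Longrightarrow> \<gamma> + k * pi / n < t \<Longrightarrow> t < \<gamma> + Suc k * pi / n \<Longrightarrow> (-1) ^ k * l t > 0"
    and Q: "\<And>r t. r \<ge> 0 \<Longrightarrow> Q (r *\<^sub>R cis t) = r * q t"
    and \<Lambda>: "\<And>r t. r \<ge> 0 \<Longrightarrow> \<Lambda> (r *\<^sub>R cis t) = r * l t"
  obtains \<Phi> \<Psi> :: "complex \<Rightarrow> complex" where "PL_homeomorphism UNIV UNIV \<Phi> \<Psi>" "\<Phi> 0 = 0" "\<And>w. Q w = \<Lambda> (\<Phi> w)"
proof -
  \<comment> \<open>Zeros at the even indices and midpoints between them at the odd ones. The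
    midpoints correspond to the places where the model may have a kink between two zeros, which is
    why \<open>l\<close> is linear only on arcs of length \<open>pi / (2 * n)\<close>; they also
    keep the model sectors narrower than pi when \<open>n = 1\<close>.\<close>
  define e where "e j = (if even j then z (j div 2) else (z (j div 2) + z (Suc (j div 2))) / 2)" for j
  have e: "e j < e (Suc j)" if "j < 4 * n" for j
  proof (cases "even j")
    case True
    then obtain i where "j = 2 * i" by blast
    then show ?thesis using z(2)[of i] that by (simp add: e_def)
  next
    case False
    then obtain i where "j = 2 * i + 1" by (metis oddE)
    then show ?thesis using z(2)[of i] that by (simp add: e_def)
  qed
  then have e': "\<forall>j<4 * n. e j < e (Suc j)" by blast
  have z2: "\<forall>k<2 * n. z k < z (Suc k)" using z(2) by blast
  have ez: "e (2 * k) = z k" for k by (simp add: e_def)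
  have e0: "e 0 = z 0" and eJ: "e (4 * n) = z 0 + 2 * pi" using ez[of 0] ez[of "2 * n"] z(1) by simp_all
  \<comment> \<open>After scaling by \<open>\<omega>\<close> and shifting by \<open>\<gamma>\<close>
    this is an increasing change of angle that takes \<open>e j\<close> to the j-th division point
    of the model.\<close>
  define \<beta> where "\<beta> = interp e (4 * n)"
  have \<beta>e: "\<beta> (e k) = k" if "k \<le> 4 * n" for k unfolding \<beta>_def by (rule interp_at[OF e' that])
  have \<beta>m: "\<beta> s < \<beta> t" if "e 0 \<le> s" "s < t" "t \<le> e (4 * n)" for s t
    unfolding \<beta>_def by (rule interp_strict[OF e' that])
  have \<beta>le: "\<beta> s \<le> \<beta> t" if "e 0 \<le> s" "s \<le> t" "t \<le> e (4 * n)" for s t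
    using \<beta>m[of s t] that by (cases "s = t") auto
  define \<omega> where "\<omega> = pi / (2 * real n)"
  have \<omega>: "\<omega> > 0" "4 * real n * \<omega> = 2 * pi" using n by (simp_all add: \<omega>_def)
  have \<omega>pi: "\<omega> < pi"
  proof -
    have "1 < 2 * real n" using n by simp
    then show ?thesis using pi_gt_zero by (simp add: \<omega>_def divide_less_eq)
  qed
  \<comment> \<open>The points \<open>e j\<close> are imposed as cuts, so that each sector lies
    between two consecutive ones and its image lies in one linear arc of the model.\<close>
  have "finite (e ` {..4 * n})" by simp
  moreover have "z 0 \<le> z 0 + 2 * pi" by simp
  ultimately obtain u and N :: nat where u: "u 0 = z 0" "u N = z 0 + 2 * pi"
     "\<And>i. i < N \<Longrightarrow> piece (e ` {..4 * n}) (u i) (u (Suc i))"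
    using breakpoints by blast
  have N: "N > 0" using u(1,2) pi_gt_zero by (cases N) auto
  have um: "u i < u (Suc i)" if "i < N" for i using u(3)[OF that] by (simp add: piece_def)
  then have um': "\<forall>i<N. u i < u (Suc i)" by blast
  have ub: "e 0 \<le> u i" "u i \<le> e (4 * n)" if "i \<le> N" for i
    using increasing_le[OF um', of 0 i] increasing_le[OF um', of i N] that u e0 eJ by auto
  define \<alpha> where "\<alpha> i = \<gamma> + \<omega> * \<beta> (u i)" for i
  have loc: "\<exists>j<4 * n. e j \<le> u i \<and> u (Suc i) \<le> e (Suc j)" if "i < N" for i
  proof -
    define m where "m = (u i + u (Suc i)) / 2"
    have m: "u i < m" "m < u (Suc i)" using um[OF that] by (auto simp: m_def)
    then have "e 0 \<le> m" "m \<le> e (4 * n)" using ub[of i] ub[of "Suc i"] that by auto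
    then obtain j where j: "j < 4 * n" "e j \<le> m" "m \<le> e (Suc j)" using locate_interval[of e m "4 * n"] n by auto
    have "\<not> (u i < e k \<and> e k < u (Suc i))" if "k \<le> 4 * n" for k
      using u(3)[OF \<open>i < N\<close>] that unfolding piece_def by blast
    from this[of j] this[of "Suc j"] show ?thesis using j m by (intro exI[of _ j]) auto
  qed
  have \<alpha>loc: "\<exists>j<4 * n. \<gamma> + \<omega> * j \<le> \<alpha> i \<and> \<alpha> i < \<alpha> (Suc i) \<and> \<alpha> (Suc i) \<le> \<gamma> + \<omega> * Suc j" if i: "i < N" for i
  proof -
    obtain j where j: "j < 4 * n" "e j \<le> u i" "u (Suc i) \<le> e (Suc j)" using loc[OF i] by blast
    have b: "e 0 \<le> e j" "e (Suc j) \<le> e (4 * n)" using increasing_le[OF e'] j by auto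
    have "real j \<le> \<beta> (u i)" using \<beta>le[of "e j" "u i"] \<beta>e[of j] j b ub[of i] i by simp
    moreover have "\<beta> (u i) < \<beta> (u (Suc i))" using \<beta>m[OF _ um[OF i]] ub[of i] ub[of "Suc i"] i by simp
    moreover have "\<beta> (u (Suc i)) \<le> Suc j" using \<beta>le[of "u (Suc i)" "e (Suc j)"] \<beta>e[of "Suc j"] j b ub[of "Suc i"] i by simp
    ultimately show ?thesis using j(1) \<omega>(1) unfolding \<alpha>_def
      by (intro exI[of _ j] conjI) (auto intro!: mult_left_mono)
  qed
  have fu: "fan N u"
    unfolding fan_def
  proof (intro conjI allI impI)
    fix i assume i: "i < N"
    obtain j where j: "j < 4 * n" "e j \<le> u i" "u (Suc i) \<le> e (Suc j)" using loc[OF i] by blast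
    show "u i < u (Suc i)" by (rule um[OF i])
    obtain A B where AB: "\<And>t. u i \<le> t \<Longrightarrow> t \<le> u (Suc i) \<Longrightarrow> q t = A * cos t + B * sin t" and nz: "\<And>t. u i < t \<Longrightarrow> t < u (Suc i) \<Longrightarrow> q t \<noteq> 0"
      using u(3)[OF i] by (auto simp: piece_def trig_linear_def)
    \<comment> \<open>On an arc longer than pi the linear form would take opposite values at
      antipodal angles, against its constant sign. An arc of length exactly pi would fill the
      interval from \<open>e j\<close> to \<open>e (Suc j)\<close>, half of the distance between
      consecutive zeros; these would be a full turn apart, so there would be only one arc, although
      their number \<open>2 * n\<close> is even.\<close>
    show "u (Suc i) - u i < pi"
    proof (rule ccontr)
      assume "\<not> u (Suc i) - u i < pi"
      then have le: "u i + pi \<le> u (Suc i)" by simp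
      show False
      proof (cases "u i + pi < u (Suc i)")
        case True
        define s where "s = (u (Suc i) - (u i + pi)) / 2"
        have s: "s > 0" "u i + s + pi < u (Suc i)" using True by (simp_all add: s_def field_simps)
        have "q (u i + s + pi) = - q (u i + s)"
          using AB[of "u i + s + pi"] AB[of "u i + s"] s pi_gt_zero by (simp add: algebra_simps)
        moreover have "(\<forall>t. u i < t \<longrightarrow> t < u (Suc i) \<longrightarrow> q t > 0) \<or> (\<forall>t. u i < t \<longrightarrow> t < u (Suc i) \<longrightarrow> q t < 0)"
          using nz by (rule constant_sign)
        moreover have "u i < u i + s" "u i + s < u (Suc i)" "u i < u i + s + pi" using s pi_gt_zero by linarith+
        ultimately show False using s(2) by (metis less_asym neg_0_less_iff_less neg_less_0_iff_less)
      next
        case False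
        then have eq: "u (Suc i) = u i + pi" using le by simp
        define k where "k = j div 2"
        have k: "k < 2 * n" using j(1) by (simp add: k_def)
        have half: "e (Suc j) - e j = (z (Suc k) - z k) / 2"
          by (cases "even j") (auto simp: e_def k_def field_simps elim!: oddE)
        have "z (Suc k) - z k \<le> 2 * pi"
          using increasing_le[OF z2, of 0 k] increasing_le[OF z2, of "Suc k" "2 * n"] z(1) k by auto
        then have "e j = u i" "e (Suc j) = u (Suc i)" "z (Suc k) - z k = 2 * pi" using j eq half by auto
        moreover have "k = 0 \<and> Suc k = 2 * n"
        proof -
          have "z 0 < z k" if "k > 0" using increasing_le[OF z2, of "Suc 0" k] z(2)[of 0] that k by auto
          moreover have "z (Suc k) < z (2 * n)" if "Suc k < 2 * n"
            using increasing_le[OF z2, of "Suc (Suc k)" "2 * n"] z(2)[of "Suc k"] that by auto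
          moreover have "z 0 \<le> z k" "z (Suc k) \<le> z (2 * n)"
            using increasing_le[OF z2, of 0 k] increasing_le[OF z2, of "Suc k" "2 * n"] k by auto
          ultimately show ?thesis using \<open>z (Suc k) - z k = 2 * pi\<close> z(1) k by (cases "k > 0"; cases "Suc k < 2 * n") auto
        qed
        ultimately show False by presburger
      qed
    qed
  qed (use N u in auto)
  have f\<alpha>: "fan N \<alpha>"
    unfolding fan_def
  proof (intro conjI allI impI)
    have "\<beta> (u 0) = 0" "\<beta> (u N) = 4 * n" using \<beta>e[of 0] \<beta>e[of "4 * n"] u e0 eJ by simp_all
    then show "\<alpha> N = \<alpha> 0 + 2 * pi" using \<omega>(2) by (simp add: \<alpha>_def algebra_simps)
    fix i assume "i < N"
    then obtain j where j: "\<gamma> + \<omega> * real j \<le> \<alpha> i" "\<alpha> i < \<alpha> (Suc i)" "\<alpha> (Suc i) \<le> \<gamma> + \<omega> * real (Suc j)" using \<alpha>loc by blast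
    show "\<alpha> i < \<alpha> (Suc i)" by fact
    have "\<alpha> (Suc i) - \<alpha> i \<le> \<omega>" using j by (simp add: algebra_simps)
    then show "\<alpha> (Suc i) - \<alpha> i < pi" using \<omega>pi by simp
  qed (rule N)
  have ll: "trig_linear l (\<alpha> i) (\<alpha> (Suc i))" if i: "i < N" for i
  proof -
    obtain j where j: "j < 4 * n" "\<gamma> + \<omega> * real j \<le> \<alpha> i" "\<alpha> (Suc i) \<le> \<gamma> + \<omega> * real (Suc j)" using \<alpha>loc[OF i] by blast
    have eq: "\<gamma> + real m * pi / real (2 * n) = \<gamma> + \<omega> * m" for m :: nat by (simp add: \<omega>_def)
    show ?thesis using trig_linear_subset[OF l(1)[OF j(1)], unfolded eq] j(2,3) by blast
  qed
  \<comment> \<open>Between two zeros both functions have the sign \<open>(-1) ^ k\<close>, so their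
    quotient is positive; at a zero both vanish and the factor 1 is taken.\<close>
  have sgn: "\<exists>r>0. q (u i) = r * l (\<alpha> i)" if i: "i \<le> N" for i
  proof -
    have "z 0 \<le> u i" "u i \<le> z (2 * n)" using ub[OF i] e0 eJ z(1) by auto
    then obtain k where k: "k < 2 * n" "z k \<le> u i" "u i \<le> z (Suc k)" using locate_interval[of z "u i" "2 * n"] n by auto
    have \<alpha>z: "\<gamma> + \<omega> * \<beta> (z m) = \<gamma> + m * pi / n" if "m \<le> 2 * n" for m
      using \<beta>e[of "2 * m"] that by (simp add: ez \<omega>_def)
    consider "u i = z k" | "u i = z (Suc k)" | "z k < u i" "u i < z (Suc k)" using k by force
    then show ?thesis
    proof cases
      case 1
      then show ?thesis using z(3)[of k] l(2)[of k] \<alpha>z[of k] k by (intro exI[of _ 1]) (simp add: \<alpha>_def)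
    next
      case 2
      then show ?thesis using z(3)[of "Suc k"] l(2)[of "Suc k"] \<alpha>z[of "Suc k"] k by (intro exI[of _ 1]) (simp add: \<alpha>_def)
    next
      case 3
      have zb: "e 0 \<le> z k" "z (Suc k) \<le> e (4 * n)"
        using increasing_le[OF z2, of 0 k] increasing_le[OF z2, of "Suc k" "2 * n"] z(1) k e0 eJ by auto
      have "\<beta> (z k) < \<beta> (u i)" "\<beta> (u i) < \<beta> (z (Suc k))" using \<beta>m 3 zb ub[OF i] by auto
      then have "\<gamma> + \<omega> * \<beta> (z k) < \<alpha> i" "\<alpha> i < \<gamma> + \<omega> * \<beta> (z (Suc k))" using \<omega>(1) by (auto simp: \<alpha>_def)
      then have "(-1) ^ k * l (\<alpha> i) > 0" using l(3)[of k "\<alpha> i"] \<alpha>z[of k] \<alpha>z[of "Suc k"] k by simp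
      moreover have "(-1) ^ k * q (u i) > 0" using z(4)[OF k(1)] 3 by simp
      ultimately have "q (u i) / l (\<alpha> i) > 0 \<and> l (\<alpha> i) \<noteq> 0"
        by (cases "even k") (auto simp: zero_less_divide_iff)
      then show ?thesis by (intro exI[of _ "q (u i) / l (\<alpha> i)"]) simp
    qed
  qed
  then obtain R0 where R0: "\<And>i. i \<le> N \<Longrightarrow> R0 i > 0 \<and> q (u i) = R0 i * l (\<alpha> i)" by metis
  \<comment> \<open>The factors were chosen independently, so those for \<open>u 0\<close> and
    \<open>u N\<close>, which give the same ray, may differ; the value at \<open>N\<close> is
    overwritten to close the fan.\<close>
  define R where "R i = (if i = N then R0 0 else R0 i)" for i
  have per: "cis (\<alpha> N) = cis (\<alpha> 0)" "cis (u N) = cis (u 0)"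
    using fu f\<alpha> by (simp_all add: fan_def flip: cis_mult)
  have R: "R i > 0" if "i \<le> N" for i using R0 that N by (auto simp: R_def)
  have RN: "R N = R 0" using N by (simp add: R_def)
  have Rq: "q (u i) = R i * l (\<alpha> i)" if i: "i \<le> N" for i
  proof (cases "i = N")
    case True
    have "q (u N) = q (u 0)" using u periodic[of "z 0"] by simp
    moreover have "l (\<alpha> N) = l (\<alpha> 0)" using \<Lambda>[of 1 "\<alpha> N"] \<Lambda>[of 1 "\<alpha> 0"] per by simp
    ultimately show ?thesis using R0[of 0] True by (simp add: R_def)
  qed (use R0[OF i] in \<open>simp add: R_def\<close>)
  define \<Phi> where "\<Phi> = fan_map N u (\<lambda>i. R i *\<^sub>R cis (\<alpha> i))"
  define \<Psi> where "\<Psi> = fan_map N \<alpha> (\<lambda>i. (1 / R i) *\<^sub>R cis (u i))"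
  have w: "R N *\<^sub>R cis (\<alpha> N) = R 0 *\<^sub>R cis (\<alpha> 0)" "(1 / R N) *\<^sub>R cis (u N) = (1 / R 0) *\<^sub>R cis (u 0)"
    using per RN by simp_all
  have \<Psi>\<Phi>: "\<Psi> (\<Phi> x) = x" for x
    unfolding \<Phi>_def \<Psi>_def by (rule fan_map_inverse[OF fu f\<alpha> R RN])
  have \<Phi>\<Psi>: "\<Phi> (\<Psi> x) = x" for x
    using fan_map_inverse[OF f\<alpha> fu, of "\<lambda>i. 1 / R i" x] R RN by (simp add: \<Phi>_def \<Psi>_def)
  have PL: "PL_map UNIV \<Phi>" "PL_map UNIV \<Psi>"
    unfolding \<Phi>_def \<Psi>_def using PL_fan_map[OF fu, of "\<lambda>i. R i *\<^sub>R cis (\<alpha> i)"] PL_fan_map[OF f\<alpha>, of "\<lambda>i. (1 / R i) *\<^sub>R cis (u i)"] w by simp_all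
  have cont: "continuous_on UNIV \<Phi>" "continuous_on UNIV \<Psi>"
    unfolding \<Phi>_def \<Psi>_def using continuous_fan_map[OF fu, of "\<lambda>i. R i *\<^sub>R cis (\<alpha> i)"] continuous_fan_map[OF f\<alpha>, of "\<lambda>i. (1 / R i) *\<^sub>R cis (u i)"] w by simp_all
  have main: "Q x = \<Lambda> (\<Phi> x)" for x
  proof -
    obtain i where i: "i < N" "x \<in> sector u i" using fan_cover[OF fu] .
    obtain a b where ab: "a \<ge> 0" "b \<ge> 0" "x = a *\<^sub>R cis (u i) + b *\<^sub>R cis (u (Suc i))"
      using i sector_comb[OF fu] by blast
    have 1: "\<Phi> x = (a * R i) *\<^sub>R cis (\<alpha> i) + (b * R (Suc i)) *\<^sub>R cis (\<alpha> (Suc i))"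
      using fan_map_eq[OF fu _ i(1,2), of "\<lambda>i. R i *\<^sub>R cis (\<alpha> i)"] w(1)
      by (simp add: \<Phi>_def ab(3) sector_map_comb[OF fu i(1)])
    have "trig_linear q (u i) (u (Suc i))" using u(3)[OF i(1)] by (simp add: piece_def)
    then have "Q x = a * q (u i) + b * q (u (Suc i))"
      unfolding ab(3) using homogeneous_sector_linear[OF fu i(1) _ Q ab(1,2)] by blast
    moreover have "\<Lambda> (\<Phi> x) = (a * R i) * l (\<alpha> i) + (b * R (Suc i)) * l (\<alpha> (Suc i))"
      unfolding 1 using R[of i] R[of "Suc i"] i(1) ab
      by (intro homogeneous_sector_linear[OF f\<alpha> i(1) ll[OF i(1)] \<Lambda>]) auto
    ultimately show ?thesis using Rq[of i] Rq[of "Suc i"] i by simp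
  qed
  have 0: "\<Phi> 0 = 0"
  proof -
    obtain i where i: "i < N" "0 \<in> sector u i" using fan_cover[OF fu] .
    then show ?thesis
      using fan_map_eq[OF fu _ i, of "\<lambda>i. R i *\<^sub>R cis (\<alpha> i)"] w(1) by (simp add: \<Phi>_def sector_map_def cross_def)
  qed
  have "homeomorphism UNIV UNIV \<Phi> \<Psi>"
    using cont \<Psi>\<Phi> \<Phi>\<Psi> by (intro homeomorphismI) auto
  then show thesis using that[of \<Phi> \<Psi>] PL main 0 by (simp add: PL_homeomorphism_def)
qed

end

section \<open>The conic germ of a piecewise linear function\<close>

text \<open>Near the origin only the polytopes through the origin count. Each of them is convex and
  contains 0, and \<open>G\<close> is linear on it since \<open>G 0 = 0\<close>, so \<open>G\<close>
  is positively homogeneous on a small ball. That finitely many pieces suffice gives one-sided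
  linearity of the angular profile: some piece is met by angles arbitrarily close to
  \<open>t\<close> on the given side.\<close>

lemma conic_germ:
  fixes G :: "complex \<Rightarrow> real"
  assumes PL: "PL_map (ball 0 \<delta>0) G" and \<delta>0: "\<delta>0 > 0" and G0: "G 0 = 0"
    and noext: "\<And>z T. z \<in> ball 0 \<delta>0 \<Longrightarrow> z \<noteq> 0 \<Longrightarrow> G z = 0 \<Longrightarrow> open T \<Longrightarrow> z \<in> T \<Longrightarrow>
        (\<exists>y\<in>T \<inter> ball 0 \<delta>0. G y > 0) \<and> (\<exists>y\<in>T \<inter> ball 0 \<delta>0. G y < 0)"
  obtains \<delta> q Q where "0 < \<delta>" "\<delta> \<le> \<delta>0" "pl_circle q"
    "\<And>r t. r \<ge> 0 \<Longrightarrow> Q (r *\<^sub>R cis t) = r * q t" "\<And>z. z \<in> ball 0 \<delta> \<Longrightarrow> G z = Q z"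
proof -
  obtain \<P> W where P: "finite \<P>" "\<And>P. P \<in> \<P> \<Longrightarrow> polytope P \<and> P \<subseteq> ball 0 \<delta>0 \<and> affine_on P G"
    and W: "open W" "0 \<in> W" "ball 0 \<delta>0 \<inter> W \<subseteq> \<Union>\<P>"
    using PL \<delta>0 unfolding PL_map_def by (metis centre_in_ball)
  define \<C> where "\<C> = {P\<in>\<P>. 0 \<in> P}"
  have fin: "finite \<C>" using P(1) by (simp add: \<C>_def)
  have C: "convex C" "closed C" "0 \<in> C" "affine_on C G" if "C \<in> \<C>" for C
    using that P(2)[of C] by (auto simp: \<C>_def polytope_imp_convex polytope_imp_closed)
  \<comment> \<open>Removing the finitely many closed polytopes that miss the origin leaves an open
    neighbourhood of it, covered by the polytopes through the origin.\<close>
  let ?V = "ball 0 \<delta>0 \<inter> W - \<Union>(\<P> - \<C>)"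
  have "closed (\<Union>(\<P> - \<C>))"
    using P by (intro closed_Union) (auto simp: polytope_imp_closed)
  then have "open ?V" by (intro open_Diff open_Int open_ball W(1))
  moreover have "0 \<in> ?V" using W \<delta>0 by (auto simp: \<C>_def)
  ultimately obtain \<delta> where \<delta>: "\<delta> > 0" "ball 0 \<delta> \<subseteq> ?V" by (meson open_contains_ball)
  have cov: "\<exists>C\<in>\<C>. z \<in> C" if z: "z \<in> ball 0 \<delta>" for z
  proof -
    have zV: "z \<in> ?V" using z \<delta>(2) by blast
    then obtain P where "P \<in> \<P>" "z \<in> P" using W(3) by blast
    then show ?thesis using zV by blast
  qed
  have \<delta>le: "\<delta> \<le> \<delta>0"
  proof -
    have "ball (0::complex) \<delta> \<subseteq> ball 0 \<delta>0" using \<delta>(2) by blast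
    then show ?thesis using \<delta>(1) by (simp add: ball_subset_ball_iff)
  qed
  have lin: "\<exists>l. linear l \<and> (\<forall>z\<in>C. G z = l z)" if CC: "C \<in> \<C>" for C
  proof -
    obtain l c where l: "linear l" "\<forall>z\<in>C. G z = l z + c" using C(4)[OF CC] by (auto simp: affine_on_def)
    then have "c = 0" using G0 C(3)[OF CC] linear_0[OF l(1)] by auto
    then show ?thesis using l by auto
  qed
  have hom: "G (s *\<^sub>R z) = s * G z" if z: "z \<in> ball 0 \<delta>" and s: "0 \<le> s" "s \<le> 1" for s z
  proof -
    obtain C' where C': "C' \<in> \<C>" "z \<in> C'" using cov[OF z] by blast
    obtain l where l: "linear l" "\<forall>z\<in>C'. G z = l z" using lin[OF C'(1)] by blast
    have "s *\<^sub>R z + (1 - s) *\<^sub>R 0 \<in> C'" using C[OF C'(1)] C'(2) s by (intro convexD) auto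
    then show ?thesis using l C' by (simp add: linear_scale)
  qed
  \<comment> \<open>The profile is sampled at radius \<open>\<delta> / 2\<close>, well inside the
    ball on which \<open>G\<close> is homogeneous, and rescaled to radius 1.\<close>
  define q where "q t = (2 / \<delta>) * G ((\<delta> / 2) *\<^sub>R cis t)" for t
  define Q where "Q z = (2 / \<delta>) * norm z * G ((\<delta> / 2) *\<^sub>R sgn z)" for z :: complex
  have Q: "Q (r *\<^sub>R cis t) = r * q t" if "r \<ge> 0" for r t
    using that by (cases "r = 0") (simp_all add: Q_def q_def sgn_div_norm norm_mult)
  have Gr: "G (r *\<^sub>R cis t) = r * q t" if r: "0 \<le> r" "r < \<delta>" for r t
  proof (cases "r \<le> \<delta> / 2")
    case True
    have "G ((2 * r / \<delta>) *\<^sub>R ((\<delta> / 2) *\<^sub>R cis t)) = (2 * r / \<delta>) * G ((\<delta> / 2) *\<^sub>R cis t)"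
      using \<delta>(1) r True by (intro hom) (auto simp: divide_le_eq)
    then show ?thesis using \<delta>(1) by (simp add: q_def)
  next
    case False
    then have r0: "r > 0" using \<delta>(1) by simp
    have "G ((\<delta> / (2 * r)) *\<^sub>R (r *\<^sub>R cis t)) = (\<delta> / (2 * r)) * G (r *\<^sub>R cis t)"
      using \<delta>(1) r False r0 by (intro hom) (auto simp: divide_le_eq)
    then show ?thesis using \<delta>(1) r0 by (simp add: q_def field_simps)
  qed
  have GQ: "G z = Q z" if "z \<in> ball 0 \<delta>" for z
  proof (cases "z = 0")
    case False
    obtain t where "z = norm z *\<^sub>R cis t" using polar_from by blast
    then show ?thesis using Gr[of "norm z" t] Q[of "norm z" t] that by simp
  qed (simp add: Q_def G0)
  \<comment> \<open>A convex piece that contains the ends of an arc contains the chord, not the arc.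
    Every direction between the ends meets the chord, and homogeneity transfers the value found
    there back to the circle.\<close>
  have two: "trig_linear q a b"
    if ab: "C0 \<in> \<C>" "(\<delta> / 2) *\<^sub>R cis a \<in> C0" "(\<delta> / 2) *\<^sub>R cis b \<in> C0" "a < b" "b < a + pi" for a b C0
  proof -
    obtain l where l: "linear l" "\<forall>z\<in>C0. G z = l z" using lin[OF ab(1)] by blast
    have s0: "sin (b - a) > 0" using ab by (intro sin_gt_zero) auto
    have "q \<tau> = l 1 * cos \<tau> + l \<i> * sin \<tau>" if \<tau>: "a \<le> \<tau>" "\<tau> \<le> b" for \<tau>
    proof -
      define A B where "A = sin (b - \<tau>) / sin (b - a)" and "B = sin (\<tau> - a) / sin (b - a)"
      have AB: "A \<ge> 0" "B \<ge> 0"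
        using s0 \<tau> ab unfolding A_def B_def by (auto intro!: divide_nonneg_pos sin_ge_zero)
      have "sin (b - a) *\<^sub>R cis \<tau> = sin (b - \<tau>) *\<^sub>R cis a + sin (\<tau> - a) *\<^sub>R cis b"
      proof (rule complex_eqI)
        have "cos a * cos a + sin a * sin a = 1" "cos b * cos b + sin b * sin b = 1" by (metis power2_eq_square sin_cos_squared_add2 add.commute)+
        then show "Re (sin (b - a) *\<^sub>R cis \<tau>) = Re (sin (b - \<tau>) *\<^sub>R cis a + sin (\<tau> - a) *\<^sub>R cis b)"
           "Im (sin (b - a) *\<^sub>R cis \<tau>) = Im (sin (b - \<tau>) *\<^sub>R cis a + sin (\<tau> - a) *\<^sub>R cis b)"
          by (simp_all add: sin_diff algebra_simps)
      qed
      then have "(1 / sin (b - a)) *\<^sub>R (sin (b - a) *\<^sub>R cis \<tau>) = A *\<^sub>R cis a + B *\<^sub>R cis b"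
        by (simp add: A_def B_def scaleR_add_right)
      then have cis: "cis \<tau> = A *\<^sub>R cis a + B *\<^sub>R cis b" using s0 by simp
      \<comment> \<open>Division by \<open>\<sigma>\<close> turns the conic combination into a
        convex one, that is, moves the point onto the chord. The triangle inequality gives
        \<open>\<sigma> \<ge> 1\<close>, so the radius \<open>\<delta> / (2 * \<sigma>)\<close>
        stays below \<open>\<delta>\<close>.\<close>
      define \<sigma> where "\<sigma> = A + B"
      have "norm (cis \<tau>) \<le> norm (A *\<^sub>R cis a) + norm (B *\<^sub>R cis b)" unfolding cis by (rule norm_triangle_ineq)
      then have \<sigma>: "\<sigma> \<ge> 1" using AB by (simp add: \<sigma>_def)
      let ?\<zeta> = "(\<delta> / (2 * \<sigma>)) *\<^sub>R cis \<tau>"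
      have "?\<zeta> = (A / \<sigma>) *\<^sub>R ((\<delta> / 2) *\<^sub>R cis a) + (B / \<sigma>) *\<^sub>R ((\<delta> / 2) *\<^sub>R cis b)"
        using \<sigma> by (simp add: cis scaleR_add_right mult.commute)
      also have "\<dots> \<in> C0"
        using AB \<sigma> C(1)[OF ab(1)] ab by (intro convexD) (auto simp: \<sigma>_def simp flip: add_divide_distrib)
      finally have "G ?\<zeta> = l ?\<zeta>" using l by blast
      moreover have "\<delta> / (2 * \<sigma>) < \<delta>" using \<delta>(1) \<sigma> by (simp add: divide_less_eq)
      then have "G ?\<zeta> = \<delta> / (2 * \<sigma>) * q \<tau>" using \<delta>(1) \<sigma> by (intro Gr) auto
      moreover have "l ?\<zeta> = \<delta> / (2 * \<sigma>) * l (cis \<tau>)" by (simp add: linear_scale[OF l(1)])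
      ultimately have "q \<tau> = l (cis \<tau>)" using \<delta>(1) \<sigma> by simp
      also have "cis \<tau> = cos \<tau> *\<^sub>R 1 + sin \<tau> *\<^sub>R \<i>" by (simp add: complex_eq_iff)
      also have "l \<dots> = l 1 * cos \<tau> + l \<i> * sin \<tau>" by (simp add: linear_add[OF l(1)] linear_scale[OF l(1)])
      finally show ?thesis .
    qed
    then show ?thesis unfolding trig_linear_def by auto
  qed
  \<comment> \<open>The pieces are closed, so a piece met frequently as the angle tends to
    \<open>t\<close> also contains the point of angle \<open>t\<close>.\<close>
  have lim: "(\<delta> / 2) *\<^sub>R cis t \<in> C0"
    if C0: "C0 \<in> \<C>" and fr: "\<exists>\<^sub>F s in F. (\<delta> / 2) *\<^sub>R cis s \<in> C0" and F: "F \<le> at t" for C0 F t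
  proof (rule ccontr)
    assume "(\<delta> / 2) *\<^sub>R cis t \<notin> C0"
    then have "open (- C0)" "(\<delta> / 2) *\<^sub>R cis t \<in> - C0" using C(2)[OF C0] by auto
    moreover have "isCont (\<lambda>s. (\<delta> / 2) *\<^sub>R cis s) t" 
    proof -
      have "isCont (\<lambda>s. exp (\<i> * of_real s)) t" by (intro continuous_intros)
      then show ?thesis unfolding cis_conv_exp by (intro continuous_intros)
    qed
    ultimately have "\<forall>\<^sub>F s in at t. (\<delta> / 2) *\<^sub>R cis s \<in> - C0"
      by (metis isCont_def topological_tendstoD)
    then have "\<forall>\<^sub>F s in F. (\<delta> / 2) *\<^sub>R cis s \<notin> C0" using F by (auto simp: le_filter_def)
    then show False using fr by (simp add: frequently_def)
  qed
  \<comment> \<open>A pigeonhole argument: every angle lies in one of finitely many pieces, so some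
    piece is met frequently along the filter.\<close>
  have pick: "\<exists>C0\<in>\<C>. \<exists>\<^sub>F s in F. (\<delta> / 2) *\<^sub>R cis s \<in> C0" if "F \<noteq> bot" for F
  proof -
    have "\<exists>\<^sub>F s in F. \<exists>C0\<in>\<C>. (\<delta> / 2) *\<^sub>R cis s \<in> C0"
      using cov \<delta>(1) that by (intro eventually_frequently always_eventually) auto
    then show ?thesis by (rule frequently_bex_finite[OF fin])
  qed
  have "pl_circle q"
  proof
    fix t
    have "cis (t + 2 * pi) = cis t" by (simp flip: cis_mult)
    then show "q (t + 2 * pi) = q t" by (simp add: q_def)
    show "\<exists>\<eta>>0. trig_linear q t (t + \<eta>)"
    proof -
      obtain C0 where C0: "C0 \<in> \<C>" "\<exists>\<^sub>F s in at_right t. (\<delta> / 2) *\<^sub>R cis s \<in> C0" using pick[of "at_right t"] by auto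
      have "\<forall>\<^sub>F s in at_right t. t < s \<and> s < t + 1" using eventually_at_right_real[of t "t + 1"] by auto
      then obtain s where "t < s" "s < t + 1" "(\<delta> / 2) *\<^sub>R cis s \<in> C0"
        using frequently_eventually_frequently[OF C0(2)] frequently_ex by blast
      then have "trig_linear q t s" using lim[OF C0] C0(1) pi_gt3 by (intro two[of C0]) (auto simp: at_le)
      then show ?thesis using \<open>t < s\<close> by (intro exI[of _ "s - t"]) simp
    qed
    show "\<exists>\<eta>>0. trig_linear q (t - \<eta>) t"
    proof -
      obtain C0 where C0: "C0 \<in> \<C>" "\<exists>\<^sub>F s in at_left t. (\<delta> / 2) *\<^sub>R cis s \<in> C0" using pick[of "at_left t"] by auto
      have "\<forall>\<^sub>F s in at_left t. t - 1 < s \<and> s < t" using eventually_at_left_real[of "t - 1" t] by auto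
      then obtain s where "s < t" "t - 1 < s" "(\<delta> / 2) *\<^sub>R cis s \<in> C0"
        using frequently_eventually_frequently[OF C0(2)] frequently_ex by blast
      then have "trig_linear q s t" using lim[OF C0] C0(1) pi_gt3 by (intro two[of C0]) (auto simp: at_le)
      then show ?thesis using \<open>s < t\<close> by (intro exI[of _ "t - s"]) simp
    qed
  next
    fix t \<eta> :: real assume qt: "q t = 0" and \<eta>: "\<eta> > 0"
    let ?y = "(\<delta> / 2) *\<^sub>R cis t"
    have yb: "?y \<in> ball 0 \<delta>" using \<delta>(1) by simp
    have Gy: "G ?y = 0" "?y \<noteq> 0" using qt \<delta>(1) by (simp_all add: q_def)
    \<comment> \<open>Rotating by \<open>- t\<close> puts the point on the positive real axis, where
      \<open>Arg\<close> is continuous. Hence points near \<open>?y\<close> have angles close to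
      \<open>t\<close>, and the two signs of \<open>G\<close> near \<open>?y\<close> become two
      signs of \<open>q\<close> near \<open>t\<close>.\<close>
    have y1: "?y * cis (- t) = of_real (\<delta> / 2)" by (simp add: scaleR_conv_of_real mult.assoc cis_mult)
    have "isCont Arg (?y * cis (- t))" unfolding y1 using \<delta>(1) by (intro continuous_at_Arg) (auto simp: complex_nonpos_Reals_iff)
    then have "isCont (\<lambda>z. Arg (z * cis (- t))) ?y"
      by (intro isCont_o2[where g = Arg and f = "\<lambda>z. z * cis (- t)"] continuous_intros)
    then have "((\<lambda>z. Arg (z * cis (- t))) \<longlongrightarrow> Arg (?y * cis (- t))) (nhds ?y)"
      unfolding isCont_def using tendsto_at_iff_tendsto_nhds[of "\<lambda>z. Arg (z * cis (- t))" ?y] by blast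
    moreover have "Arg (?y * cis (- t)) = 0" unfolding y1 using \<delta>(1) Arg_of_real[of "\<delta> / 2"] by simp
    ultimately have "\<forall>\<^sub>F z in nhds ?y. dist (Arg (z * cis (- t))) 0 < \<eta>" using \<eta> tendstoD by metis
    moreover have "\<forall>\<^sub>F z in nhds ?y. z \<in> ball 0 \<delta> - {0}"
      using yb Gy by (intro eventually_nhds_in_open open_Diff) auto
    ultimately have "\<forall>\<^sub>F z in nhds ?y. \<bar>Arg (z * cis (- t))\<bar> < \<eta> \<and> z \<in> ball 0 \<delta> - {0}"
      by eventually_elim simp
    then obtain T where T: "open T" "?y \<in> T" "\<And>z. z \<in> T \<Longrightarrow> \<bar>Arg (z * cis (- t))\<bar> < \<eta> \<and> z \<in> ball 0 \<delta> - {0}"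
      unfolding eventually_nhds by blast
    have tr: "\<exists>s. \<bar>s - t\<bar> < \<eta> \<and> G z = norm z * q s \<and> norm z > 0" if zT: "z \<in> T" for z
    proof -
      let ?s = "t + Arg (z * cis (- t))"
      have z0: "z \<noteq> 0" "norm z < \<delta>" using T(3)[OF zT] by auto
      have "z * cis (- t) = of_real (norm z) * cis (Arg (z * cis (- t)))"
        using Arg_eq[of "z * cis (- t)"] z0 by (simp add: norm_mult cis_conv_exp mult.commute)
      then have "z * cis (- t) * cis t = of_real (norm z) * cis (Arg (z * cis (- t))) * cis t" by simp
      then have "z = norm z *\<^sub>R cis ?s" by (simp add: mult.assoc cis_mult scaleR_conv_of_real add.commute)
      then have "G z = norm z * q ?s" using Gr[of "norm z" ?s] z0 by simp
      then show ?thesis using T(3)[OF zT] z0 by (intro exI[of _ ?s]) auto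
    qed
    have "?y \<in> ball 0 \<delta>0" using yb \<delta>le by auto
    from noext[OF this Gy(2,1) T(1,2)] obtain y1 y2 where "y1 \<in> T" "G y1 > 0" "y2 \<in> T" "G y2 < 0" by blast
    then show "(\<exists>s. \<bar>s - t\<bar> < \<eta> \<and> q s > 0) \<and> (\<exists>s. \<bar>s - t\<bar> < \<eta> \<and> q s < 0)"
      using tr[of y1] tr[of y2] by (auto simp: zero_less_mult_iff mult_less_0_iff)
  qed
  then show thesis using that[OF \<delta>(1) \<delta>le] Q GQ by blast
qed

section \<open>Reduction of a vertex to a germ in the plane\<close>

text \<open>A point outside the relative interior lies on a facet, whose dimension is smaller. The
  summand 1 in the measure accounts for the dimension -1 of the empty set.\<close>

lemma polytope_rel_interior_face:
  fixes P :: "'a::euclidean_space set"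
  assumes P: "polytope P" "x \<in> P"
  obtains F where "F face_of P" "x \<in> rel_interior F"
  using P
proof (induction "nat (aff_dim P + 1)" arbitrary: P thesis rule: less_induct)
  case less
  show ?case
  proof (cases "x \<in> rel_interior P")
    case True
    then show ?thesis using less.prems(1)[of P] less.prems(2) polytope_imp_convex face_of_refl by blast
  next
    case False
    then have "x \<in> P - rel_interior P" using less.prems by blast
    then obtain F where F: "F facet_of P" "x \<in> F"
      using rel_boundary_of_polyhedron[OF polytope_imp_polyhedron[OF less.prems(2)]] by blast
    have FP: "F face_of P" using F facet_of_imp_face_of by blast
    have "aff_dim F = aff_dim P - 1" using F by (simp add: facet_of_def)
    moreover have "aff_dim F \<ge> 0" 
    proof -
      have "aff_dim F \<noteq> - 1" using F(2) aff_dim_empty[of F] by blast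
      then show ?thesis using aff_dim_geq[of F] by linarith
    qed
    ultimately have "nat (aff_dim F + 1) < nat (aff_dim P + 1)" by simp
    then obtain F' where "F' face_of F" "x \<in> rel_interior F'"
      using less.hyps[of F] F(2) face_of_polytope_polytope[OF less.prems(2) FP] by blast
    then show ?thesis using less.prems(1)[of F'] face_of_trans[OF _ FP] by blast
  qed
qed

text \<open>A cell that meets the relative interior of another contains it, and each point lies in
  the relative interior of some cell. As a complement of finitely many closed cells, the star is
  visibly open in the polyhedron.\<close>

lemma open_star_eq:
  assumes K: "polytopal_complex K" and v: "{v} \<in> K"
  shows "open_star K {v} = \<Union>K - \<Union>{Q\<in>K. v \<notin> Q}"
proof
  show "open_star K {v} \<subseteq> \<Union>K - \<Union>{Q\<in>K. v \<notin> Q}"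
  proof
    fix x assume "x \<in> open_star K {v}"
    then obtain Q where Q: "Q \<in> K" "{v} face_of Q" "x \<in> rel_interior Q" by (auto simp: open_star_def)
    have "v \<in> Q'" if "Q' \<in> K" "x \<in> Q'" for Q'
    proof -
      have "Q \<inter> Q' face_of Q" using K Q(1) that(1) by (auto simp: polytopal_complex_def)
      moreover have "Q \<inter> Q' \<inter> rel_interior Q \<noteq> {}" using Q(3) that(2) rel_interior_subset by blast
      ultimately have "Q \<subseteq> Q \<inter> Q'" using subset_of_face_of[of "Q \<inter> Q'" Q Q] by blast
      then show ?thesis using Q(2) face_of_imp_subset by blast
    qed
    then show "x \<in> \<Union>K - \<Union>{Q\<in>K. v \<notin> Q}" using Q rel_interior_subset by blast
  qed
  show "\<Union>K - \<Union>{Q\<in>K. v \<notin> Q} \<subseteq> open_star K {v}"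
  proof
    fix x assume x: "x \<in> \<Union>K - \<Union>{Q\<in>K. v \<notin> Q}"
    then obtain P where P: "P \<in> K" "x \<in> P" by blast
    have "polytope P" using K P by (auto simp: polytopal_complex_def)
    then obtain F where F: "F face_of P" "x \<in> rel_interior F" using polytope_rel_interior_face P(2) by metis
    have FK: "F \<in> K" using K P F by (auto simp: polytopal_complex_def)
    have "v \<in> F" using x FK F(2) rel_interior_subset by blast
    moreover have "F \<inter> {v} face_of F" using K FK v by (auto simp: polytopal_complex_def)
    ultimately have "{v} face_of F" by simp
    then show "x \<in> open_star K {v}" using FK F(2) by (auto simp: open_star_def)
  qed
qed

lemma openin_open_star:
  assumes K: "polytopal_complex K" and v: "{v} \<in> K"
  shows "openin (top_of_set (\<Union>K)) (open_star K {v})"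
proof -
  have "closed (\<Union>{Q\<in>K. v \<notin> Q})"
    using K by (intro closed_Union) (auto simp: polytopal_complex_def polytope_imp_closed)
  then show ?thesis unfolding open_star_eq[OF assms]
    by (metis Diff_eq open_Compl openin_open_Int)
qed

lemma center_in_open_star: "{v} \<in> K \<Longrightarrow> v \<in> open_star K {v}"
  using face_of_refl[of "{v}"] by (auto simp: open_star_def)

text \<open>A cell with the vertex \<open>v\<close> other than \<open>{v}\<close> has a second vertex, so by genericity \<open>f\<close> is a
  nonconstant affine function on it, and has no extremum in its relative interior.\<close>

lemma generic_no_extremum:
  assumes K: "polytopal_complex K" and f: "generic_PL K f"
    and x: "x \<in> open_star K {v}" "x \<noteq> v" and O: "open O'" "x \<in> O'"
  shows "\<exists>y\<in>O' \<inter> open_star K {v}. f y > f x" "\<exists>y\<in>O' \<inter> open_star K {v}. f y < f x"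
proof -
  obtain P where P: "P \<in> K" "{v} face_of P" "x \<in> rel_interior P" using x by (auto simp: open_star_def)
  have poly: "polytope P" using K P by (auto simp: polytopal_complex_def)
  have vP: "v \<in> P" using P(2) face_of_imp_subset by blast
  have xP: "x \<in> P" using P(3) rel_interior_subset by blast
  obtain w where w: "w extreme_point_of P" "w \<noteq> v"
  proof -
    have "P = convex hull {y. y extreme_point_of P}"
      using poly by (intro Krein_Milman_Minkowski polytope_imp_compact polytope_imp_convex)
    moreover have "{y. y extreme_point_of P} \<subseteq> {v}" if "\<nexists>w. w extreme_point_of P \<and> w \<noteq> v" using that by blast
    ultimately have "P \<subseteq> {v}" if "\<nexists>w. w extreme_point_of P \<and> w \<noteq> v"
      using that hull_mono[of "{y. y extreme_point_of P}" "{v}" convex] by simp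
    then show thesis using that xP x(2) by blast
  qed
  have wP: "w \<in> P" using w(1) by (simp add: extreme_point_of_def)
  have "{w} \<in> K" "{v} \<in> K"
    using K P w(1) by (auto simp: polytopal_complex_def face_of_singleton)
  then have fw: "f w \<noteq> f v" using f w(2) by (auto simp: generic_PL_def vertices_def inj_on_def)
  obtain l c where l: "linear l" "\<And>y. y \<in> P \<Longrightarrow> f y = l y + c"
    using f P(1) by (auto simp: generic_PL_def affine_on_def)
  \<comment> \<open>The difference of the two vertices, oriented so that \<open>f\<close> increases
    along it. It is parallel to the affine hull of \<open>P\<close>, so small steps from
    \<open>x\<close> in both directions remain in the relative interior.\<close>
  define d where "d = (if f v < f w then w - v else v - w)"
  have ld: "l d > 0" using l(2)[OF vP] l(2)[OF wP] fw by (auto simp: d_def linear_diff[OF l(1)])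
  obtain T where T: "open T" "rel_interior P = affine hull P \<inter> T"
    using openin_rel_interior[of P] by (auto simp: openin_open)
  have "x \<in> T \<inter> O'" using P(3) T(2) O(2) by blast
  then obtain e where e: "e > 0" "ball x e \<subseteq> T \<inter> O'" using T(1) O(1) by (meson open_Int open_contains_ball)
  define s where "s = e / (2 * (norm d + 1))"
  have s: "s > 0" "s * norm d < e"
  proof -
    show "s > 0" using e by (simp add: s_def add_nonneg_pos)
    have "s * norm d \<le> s * (norm d + 1)" using \<open>s > 0\<close> by (intro mult_left_mono) auto
    also have "\<dots> = e / 2" using norm_ge_zero[of d] by (simp add: s_def field_simps add_nonneg_eq_0_iff)
    finally show "s * norm d < e" using e by simp
  qed
  have mem: "x + r *\<^sub>R d \<in> rel_interior P \<inter> O'" if r: "\<bar>r\<bar> = s" for r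
  proof -
    have "x + r *\<^sub>R d \<in> ball x e" using s r by (simp add: dist_norm)
    moreover have "x \<in> affine hull P" "w \<in> affine hull P" "v \<in> affine hull P"
      using xP wP vP hull_subset[of P affine] by auto
    then have "x + r *\<^sub>R (w - v) \<in> affine hull P" "x + (- r) *\<^sub>R (w - v) \<in> affine hull P"
      by (intro mem_affine_3_minus affine_affine_hull; simp)+
    then have "x + r *\<^sub>R d \<in> affine hull P" by (auto simp: d_def algebra_simps)
    ultimately show ?thesis using T(2) e(2) by blast
  qed
  have val: "f (x + r *\<^sub>R d) = f x + r * l d" if "\<bar>r\<bar> = s" for r
    using mem[OF that] rel_interior_subset[of P] l xP by (auto simp: linear_add linear_scale subset_iff)
  have star: "rel_interior P \<subseteq> open_star K {v}" using P by (auto simp: open_star_def)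
  show "\<exists>y\<in>O' \<inter> open_star K {v}. f y > f x"
    using mem[of s] val[of s] s star ld by (intro bexI[of _ "x + s *\<^sub>R d"]) auto
  show "\<exists>y\<in>O' \<inter> open_star K {v}. f y < f x"
    using mem[of "- s"] val[of "- s"] s star ld by (intro bexI[of _ "x + (- s) *\<^sub>R d"]) (auto simp: mult_pos_pos)
qed

lemma PL_homeomorphism_trans:
  assumes "PL_homeomorphism X Y g h" "PL_homeomorphism Y Z g' h'"
  shows "PL_homeomorphism X Z (\<lambda>x. g' (g x)) (\<lambda>z. h (h' z))"
proof -
  have hom: "homeomorphism X Y g h" "homeomorphism Y Z g' h'"
    and PL: "PL_map X g" "PL_map Y h" "PL_map Y g'" "PL_map Z h'"
    using assms by (auto simp: PL_homeomorphism_def)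
  have "homeomorphism X Z (\<lambda>x. g' (g x)) (\<lambda>z. h (h' z))"
    using homeomorphism_compose[OF hom] by (simp add: o_def)
  moreover have "PL_map X (\<lambda>x. g' (g x))"
    using hom by (intro PL_map_compose[OF PL(1,3)]) (auto simp: homeomorphism_def)
  moreover have "PL_map Z (\<lambda>z. h (h' z))"
    using hom by (intro PL_map_compose[OF PL(4,2)]) (auto simp: homeomorphism_def)
  ultimately show ?thesis by (simp add: PL_homeomorphism_def)
qed

lemma PL_homeomorphism_sym: "PL_homeomorphism X Y g h \<Longrightarrow> PL_homeomorphism Y X h g"
  by (auto simp: PL_homeomorphism_def homeomorphism_symD)

lemma PL_homeomorphism_restrict:
  assumes gh: "PL_homeomorphism X Y g h" and V: "openin (top_of_set Y) V"
  shows "PL_homeomorphism (h ` V) V g h" "openin (top_of_set X) (h ` V)"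
proof -
  have hom: "homeomorphism X Y g h" and PL: "PL_map X g" "PL_map Y h"
    using gh by (auto simp: PL_homeomorphism_def)
  have VY: "V \<subseteq> Y" using V by (simp add: openin_imp_subset)
  show o: "openin (top_of_set X) (h ` V)"
    using homeomorphism_imp_open_map[OF homeomorphism_symD[OF hom] V] .
  have "g (h y) = y" if "y \<in> V" for y using hom VY that by (auto simp: homeomorphism_def)
  then have "g ` h ` V = V" by (force simp: image_image)
  moreover have "h ` V \<subseteq> X" using hom VY by (auto simp: homeomorphism_def)
  ultimately have "homeomorphism (h ` V) V g h"
    using VY by (intro homeomorphism_of_subsets[OF hom])
  then show "PL_homeomorphism (h ` V) V g h"
    using PL_map_open_subset[OF PL(1) o] PL_map_open_subset[OF PL(2) V] by (simp add: PL_homeomorphism_def)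
qed

lemma PL_homeomorphism_affine:
  fixes l :: "'a::euclidean_space \<Rightarrow> 'b::euclidean_space"
  assumes l: "linear l" "linear l'" and inv: "\<And>x. l' (l x) = x" "\<And>y. l (l' y) = y"
  shows "PL_homeomorphism UNIV UNIV (\<lambda>x. l x + c) (\<lambda>y. l' y + - l' c)"
proof -
  have "homeomorphism UNIV UNIV (\<lambda>x. l x + c) (\<lambda>y. l' y + - l' c)"
    using l inv by (intro homeomorphismI continuous_intros linear_continuous_on linear_conv_bounded_linear[THEN iffD1])
      (auto simp: linear_add linear_diff)
  then show ?thesis unfolding PL_homeomorphism_def
    using PL_map_affine[OF l(1) open_UNIV] PL_map_affine[OF l(2) open_UNIV] by blast
qed

definition plane_complex :: "real^2 \<Rightarrow> complex" where
  "plane_complex x = Complex (x $ 1) (x $ 2)"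

definition complex_plane :: "complex \<Rightarrow> real^2" where
  "complex_plane z = (\<chi> i. if i = 1 then Re z else Im z)"

lemma linear_plane_complex: "linear plane_complex"
  by (rule linearI) (simp_all add: plane_complex_def complex_eq_iff)

lemma linear_complex_plane: "linear complex_plane"
  by (rule linearI) (simp_all add: complex_plane_def vec_eq_iff)

lemma complex_plane_inverse [simp]: "complex_plane (plane_complex x) = x" "plane_complex (complex_plane z) = z"
  by (simp_all add: complex_plane_def plane_complex_def vec_eq_iff forall_2)

text \<open>The chart of the star is followed by a translation that moves the image of
  \<open>v\<close> to the origin, and is then restricted to a ball small enough for
  \<open>conic_germ\<close>.\<close>

lemma vertex_germ:
  assumes M: "PL_manifold TYPE(2) K" and f: "generic_PL K f" and v: "v \<in> vertices K"
  obtains U \<phi> \<psi> \<delta> q Q where "\<delta> > 0" "openin (top_of_set (\<Union>K)) U" "v \<in> U" "\<phi> v = 0"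
    "PL_homeomorphism U (ball (0::complex) \<delta>) \<phi> \<psi>" "pl_circle q"
    "\<And>r t. r \<ge> 0 \<Longrightarrow> Q (r *\<^sub>R cis t) = r * q t" "\<And>x. x \<in> U \<Longrightarrow> f x = f v + Q (\<phi> x)"
proof -
  have K: "polytopal_complex K" and vK: "{v} \<in> K" using M v by (auto simp: PL_manifold_def vertices_def)
  let ?S = "open_star K {v}"
  obtain g h where gh: "PL_homeomorphism ?S (ball (0 :: real^2) 1) g h"
    using M vK unfolding PL_manifold_def by (metis insert_not_empty)
  define a where "a = plane_complex (- g v)"
  define A where "A x = plane_complex x + a" for x
  define B where "B y = complex_plane y + - complex_plane a" for y
  have AB: "PL_homeomorphism UNIV UNIV A B"
    unfolding A_def B_def by (rule PL_homeomorphism_affine) (simp_all add: linear_plane_complex linear_complex_plane)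
  have vS: "v \<in> ?S" by (rule center_in_open_star[OF vK])
  have homAB: "homeomorphism UNIV UNIV A B" using AB by (simp add: PL_homeomorphism_def)
  have BAx: "B (A x) = x" "A (B y) = y" for x y using homAB by (auto simp: homeomorphism_def)
  have o1: "openin (top_of_set UNIV) (ball (0 :: real^2) 1)" by simp
  note R = PL_homeomorphism_restrict[OF PL_homeomorphism_sym[OF AB] o1]
  have AB1: "PL_homeomorphism (ball 0 1) (A ` ball 0 1) A B" by (rule PL_homeomorphism_sym[OF R(1)])
  have star: "PL_homeomorphism ?S (A ` ball 0 1) (\<lambda>x. A (g x)) (\<lambda>z. h (B z))"
    by (rule PL_homeomorphism_trans[OF gh AB1])
  have gv: "g v \<in> ball 0 1" using gh vS by (auto simp: PL_homeomorphism_def homeomorphism_def)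
  have A0: "A (g v) = 0"
    by (simp add: A_def a_def linear_neg[OF linear_plane_complex])
  then have "0 \<in> A ` ball 0 1" using gv by (metis imageI)
  moreover have "open (A ` ball 0 1)" using R(2) by simp
  ultimately obtain \<delta>0 where \<delta>0: "\<delta>0 > 0" "ball 0 \<delta>0 \<subseteq> A ` ball 0 1" by (meson open_contains_ball)
  define \<phi> where "\<phi> x = A (g x)" for x
  define \<psi> where "\<psi> z = h (B z)" for z
  have oB: "openin (top_of_set (A ` ball 0 1)) (ball 0 r)" if "r \<le> \<delta>0" for r
    using \<delta>0(2) subset_ball[OF that, of "0::complex"] by (intro open_subset open_ball) blast
  have loc: "PL_homeomorphism (\<psi> ` ball 0 r) (ball 0 r) \<phi> \<psi>" "openin (top_of_set ?S) (\<psi> ` ball 0 r)" if "r \<le> \<delta>0" for r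
    using PL_homeomorphism_restrict[OF star oB[OF that]] by (simp_all add: \<phi>_def[abs_def] \<psi>_def[abs_def])
  have \<phi>v: "\<phi> v = 0" by (simp add: \<phi>_def A0)
  have \<psi>0: "\<psi> 0 = v" using star vS \<phi>v by (auto simp: PL_homeomorphism_def homeomorphism_def \<phi>_def \<psi>_def A0)
  have hom0: "homeomorphism (\<psi> ` ball 0 \<delta>0) (ball 0 \<delta>0) \<phi> \<psi>" and PL\<psi>: "PL_map (ball 0 \<delta>0) \<psi>"
    using loc(1)[of \<delta>0] by (auto simp: PL_homeomorphism_def)
  define G where "G z = f (\<psi> z) - f v" for z
  have SK: "?S \<subseteq> \<Union>K" using openin_imp_subset[OF openin_open_star[OF K vK]] .
  have \<psi>S: "\<psi> ` ball 0 \<delta>0 \<subseteq> ?S" using loc(2)[of \<delta>0] openin_imp_subset by blast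
  have PLf: "PL_map (\<Union>K) f"
    unfolding PL_map_def using K f
    by (intro ballI exI[of _ K] exI[of _ UNIV]) (auto simp: polytopal_complex_def generic_PL_def)
  have "PL_map (ball 0 \<delta>0) (\<lambda>z. f (\<psi> z))"
    using hom0 \<psi>S SK by (intro PL_map_compose[OF PL\<psi> PLf]) (auto simp: homeomorphism_def)
  moreover have "continuous_on (\<Union>K) f"
  proof -
    have "continuous_on (\<Union>P\<in>K. P) f"
    proof (rule continuous_on_closed_Union)
      fix P assume P: "P \<in> K"
      obtain l c where l: "linear l" "\<And>y. y \<in> P \<Longrightarrow> f y = l y + c"
        using f P by (auto simp: generic_PL_def affine_on_def)
      have "continuous_on P (\<lambda>y. l y + c)"
        using l(1) by (intro continuous_intros linear_continuous_on linear_conv_bounded_linear[THEN iffD1])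
      then show "continuous_on P f" by (rule continuous_on_eq) (simp add: l(2))
      show "closed P" using K P by (auto simp: polytopal_complex_def polytope_imp_closed)
    qed (use K in \<open>simp add: polytopal_complex_def\<close>)
    then show ?thesis by simp
  qed
  then have "continuous_on (ball 0 \<delta>0) (\<lambda>z. f (\<psi> z))"
  proof (rule continuous_on_compose2)
    show "continuous_on (ball 0 \<delta>0) \<psi>" using hom0 by (simp add: homeomorphism_def)
    show "\<psi> ` ball 0 \<delta>0 \<subseteq> \<Union>K" using \<psi>S SK by blast
  qed
  ultimately have PLG: "PL_map (ball 0 \<delta>0) G"
    using PL_map_compose[of "ball 0 \<delta>0" "\<lambda>z. f (\<psi> z)" UNIV "\<lambda>y. id y + - f v"] PL_map_affine[of "id :: real \<Rightarrow> real" UNIV "- f v"]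
    by (simp add: G_def[abs_def] linear_id)
  \<comment> \<open>The inverse chart is open, so it carries
    \<open>T \<inter> ball 0 \<delta>0\<close> to an open subset of the star, and
    \<open>generic_no_extremum\<close> applies to that subset at the point
    \<open>\<psi> z\<close>.\<close>
  have noext: "(\<exists>y\<in>T \<inter> ball 0 \<delta>0. G y > 0) \<and> (\<exists>y\<in>T \<inter> ball 0 \<delta>0. G y < 0)"
    if z: "z \<in> ball 0 \<delta>0" "z \<noteq> 0" "G z = 0" and T: "open T" "z \<in> T" for z T
  proof -
    have "openin (top_of_set (A ` ball 0 1)) (T \<inter> ball 0 \<delta>0)"
      using T(1) \<delta>0(2) by (intro open_subset open_Int open_ball) blast+
    then have "openin (top_of_set ?S) (\<psi> ` (T \<inter> ball 0 \<delta>0))"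
      using PL_homeomorphism_restrict(2)[OF star] by (simp add: \<psi>_def[abs_def])
    then obtain O' where O': "open O'" "\<psi> ` (T \<inter> ball 0 \<delta>0) = ?S \<inter> O'" by (auto simp: openin_open)
    have xS: "\<psi> z \<in> ?S" "\<psi> z \<in> O'" using O'(2) z T by blast+
    have "\<psi> z \<noteq> v"
      using hom0 z \<phi>v by (metis homeomorphism_def)
    note ne = generic_no_extremum[OF K f xS(1) this O'(1) xS(2)]
    have fz: "f (\<psi> z) = f v" using z(3) by (simp add: G_def)
    obtain y1 where y1: "y1 \<in> O' \<inter> ?S" "f y1 > f v" using ne(1) fz by auto
    then have "y1 \<in> \<psi> ` (T \<inter> ball 0 \<delta>0)" unfolding O'(2) by blast
    then obtain z1 where z1: "z1 \<in> T \<inter> ball 0 \<delta>0" "y1 = \<psi> z1" by blast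
    obtain y2 where y2: "y2 \<in> O' \<inter> ?S" "f y2 < f v" using ne(2) fz by auto
    then have "y2 \<in> \<psi> ` (T \<inter> ball 0 \<delta>0)" unfolding O'(2) by blast
    then obtain z2 where z2: "z2 \<in> T \<inter> ball 0 \<delta>0" "y2 = \<psi> z2" by blast
    show ?thesis using z1 z2 y1(2) y2(2) unfolding G_def by (intro conjI bexI[of _ z1] bexI[of _ z2]) auto
  qed
  have G0: "G 0 = 0" by (simp add: G_def \<psi>0)
  obtain \<delta> q Q where \<delta>: "0 < \<delta>" "\<delta> \<le> \<delta>0" "pl_circle q"
    and Q: "\<And>r t. r \<ge> 0 \<Longrightarrow> Q (r *\<^sub>R cis t) = r * q t" "\<And>z. z \<in> ball 0 \<delta> \<Longrightarrow> G z = Q z"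
  proof (rule conic_germ[OF PLG \<delta>0(1) G0])
    show "(\<exists>y\<in>T \<inter> ball 0 \<delta>0. G y > 0) \<and> (\<exists>y\<in>T \<inter> ball 0 \<delta>0. G y < 0)"
      if "z \<in> ball 0 \<delta>0" "z \<noteq> 0" "G z = 0" "open T" "z \<in> T" for z T
      using that by (rule noext)
  qed (rule that)
  let ?U = "\<psi> ` ball 0 \<delta>"
  show thesis
  proof (rule that[of \<delta> ?U \<phi> \<psi> q Q])
    show "openin (top_of_set (\<Union>K)) ?U"
      using openin_trans[OF loc(2)[OF \<delta>(2)] openin_open_star[OF K vK]] .
    show "v \<in> ?U" using \<psi>0 \<delta>(1) by (metis centre_in_ball imageI)
    show "PL_homeomorphism ?U (ball 0 \<delta>) \<phi> \<psi>" by (rule loc(1)[OF \<delta>(2)])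
    fix x assume x: "x \<in> ?U"
    then have "\<phi> x \<in> ball 0 \<delta>" "\<psi> (\<phi> x) = x" using loc(1)[OF \<delta>(2)] by (auto simp: PL_homeomorphism_def homeomorphism_def)
    then show "f x = f v + Q (\<phi> x)" using Q(2)[of "\<phi> x"] by (simp add: G_def)
  qed (use \<delta> \<phi>v Q in auto)
qed

section \<open>Classification of the vertices\<close>

text \<open>The integral rank does not depend on \<open>F\<close>, so one integral computation
  serves all fields; the total multiplicity is a sum with at most one nonzero term.\<close>

lemma vertex_homology_free:
  fixes F :: "('k, 'm) ring_scheme"
  assumes F: "field F"
    and fr: "homology_free_of_rank (int k) m (top_of_set (sublevel K f (f v))) (sublevel K f (f v) - {v})"
  shows "multiplicity_of_index F K f v p = (if p = k then enat m else 0)"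
    and "H_critical_of_index F K f v p \<longleftrightarrow> p = k \<and> m \<noteq> 0"
    and "H_critical F K f v \<longleftrightarrow> m \<noteq> 0"
    and "total_multiplicity F K f v = enat m"
proof -
  obtain z where z: "free_homology k m z (top_of_set (sublevel K f (f v))) (sublevel K f (f v) - {v})"
    using free_homology_exists[OF fr] by blast
  show m: "multiplicity_of_index F K f v p = (if p = k then enat m else 0)" for p
    using rel_homology_free(1)[OF F z] by (simp add: multiplicity_of_index_def vertex_homology_def)
  show c: "H_critical_of_index F K f v p \<longleftrightarrow> p = k \<and> m \<noteq> 0" for p
    using rel_homology_free(2)[OF F z] by (auto simp: H_critical_of_index_def vertex_homology_def)
  show "H_critical F K f v \<longleftrightarrow> m \<noteq> 0" by (auto simp: H_critical_def c)
  have "total_multiplicity F K f v = (\<Sum>p\<in>{k}. multiplicity_of_index F K f v p)"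
    unfolding total_multiplicity_def by (rule suminf_finite) (simp_all add: m)
  then show "total_multiplicity F K f v = enat m" by (simp add: m)
qed

text \<open>Regularity over one field already forces strong regularity; the definition of \<^const>\<open>H_regular\<close>
  ranges over fields carried by natural numbers.\<close>

definition two_element_field :: "nat ring" where
  "two_element_field = \<lparr>carrier = {0, 1}, mult = (\<lambda>a b. a * b), one = 1, zero = 0, add = (\<lambda>a b. (a + b) mod 2)\<rparr>"

lemma field_two_element_field: "field two_element_field"
proof -
  have "cring two_element_field"
  proof (rule cringI)
    show "abelian_group two_element_field"
      by (rule abelian_groupI) (auto simp: two_element_field_def)
    show "comm_monoid two_element_field"
      by (rule comm_monoidI) (auto simp: two_element_field_def)
  qed (auto simp: two_element_field_def)
  then show ?thesis
    by (rule cring.cring_fieldI2) (auto simp: two_element_field_def)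
qed

section \<open>Homology of the negative cone\<close>

lemma sector_piece_contractible:
  assumes ab: "a \<le> b" "b < a + 2 * pi"
  shows "contractible {r *\<^sub>R cis t | r t. 0 < r \<and> r < \<delta> \<and> a \<le> t \<and> t \<le> b}"
proof -
  let ?B = "{r *\<^sub>R cis t | r t. 0 < r \<and> r < \<delta> \<and> a \<le> t \<and> t \<le> b}"
  let ?R = "{0<..<\<delta>} \<times> {a..b}"
  \<comment> \<open>Rotation by the middle angle places the sector symmetrically about the positive
    real axis with half-opening below pi, so it avoids the cut of \<open>Arg\<close>, and polar
    coordinates identify it with a convex rectangle.\<close>
  define m where "m = (a + b) / 2"
  have inv: "Arg (r *\<^sub>R cis t * cis (- m)) = t - m \<and> r *\<^sub>R cis t * cis (- m) \<notin> \<real>\<^sub>\<le>\<^sub>0 \<and> norm (r *\<^sub>R cis t) = r"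
    if "0 < r" "a \<le> t" "t \<le> b" for r t
  proof -
    have e: "r *\<^sub>R cis t * cis (- m) = of_real r * exp (\<i> * of_real (t - m))"
      by (simp add: scaleR_conv_of_real cis_mult cis_conv_exp mult.assoc exp_add[symmetric] algebra_simps)
    have t: "- pi < t - m" "t - m < pi" using that ab by (auto simp: m_def field_simps)
    have A: "Arg (r *\<^sub>R cis t * cis (- m)) = t - m"
      unfolding e by (rule Arg_unique[of r]) (use that t in auto)
    moreover have "r *\<^sub>R cis t * cis (- m) \<notin> \<real>\<^sub>\<le>\<^sub>0"
    proof
      assume N: "r *\<^sub>R cis t * cis (- m) \<in> \<real>\<^sub>\<le>\<^sub>0"
      have "r *\<^sub>R cis t * cis (- m) \<noteq> 0" using that by simp
      have "Re w < 0 \<and> Im w = 0" if "w \<in> \<real>\<^sub>\<le>\<^sub>0" "w \<noteq> 0" for w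
        using that by (auto simp: complex_nonpos_Reals_iff complex_eq_iff)
      then have "Arg (r *\<^sub>R cis t * cis (- m)) = pi"
        unfolding Arg_eq_pi using N \<open>r *\<^sub>R cis t * cis (- m) \<noteq> 0\<close> by blast
      then show False using A t by simp
    qed
    ultimately show ?thesis using that by simp
  qed
  have "homeomorphism ?R ?B (\<lambda>(r, t). r *\<^sub>R cis t) (\<lambda>z. (norm z, m + Arg (z * cis (- m))))"
  proof (rule homeomorphismI)
    show "continuous_on ?R (\<lambda>(r, t). r *\<^sub>R cis t)"
      unfolding case_prod_unfold by (intro continuous_intros)
    show "continuous_on ?B (\<lambda>z. (norm z, m + Arg (z * cis (- m))))"
      using inv by (intro continuous_intros) auto
    show "(\<lambda>(r, t). r *\<^sub>R cis t) ` ?R \<subseteq> ?B" by force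
    show "(\<lambda>z. (norm z, m + Arg (z * cis (- m)))) ` ?B \<subseteq> ?R" using inv by auto
    show "(\<lambda>z. (norm z, m + Arg (z * cis (- m)))) ((\<lambda>(r, t). r *\<^sub>R cis t) x) = x" if "x \<in> ?R" for x
      using that inv by auto
    show "(\<lambda>(r, t). r *\<^sub>R cis t) ((\<lambda>z. (norm z, m + Arg (z * cis (- m)))) y) = y" if "y \<in> ?B" for y
      using that inv by auto
  qed
  then have "?R homeomorphic ?B" by (auto simp: homeomorphic_def)
  moreover have "contractible ?R" by (intro convex_imp_contractible convex_Times) auto
  ultimately show ?thesis using homeomorphic_contractible by blast
qed

context pl_circle
begin

text \<open>By the alternation of signs \<open>q\<close> is nonpositive exactly on the closed arcs
  from \<open>z (2 * i + 1)\<close> to \<open>z (2 * i + 2)\<close>, up to full turns. The cone is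
  starlike about its apex, hence contractible, and without the apex it falls into the
  \<open>n\<close> sectors over these arcs.\<close>

lemma negative_cone_homology:
  fixes Q :: "complex \<Rightarrow> real"
  assumes Q: "\<And>r t. r \<ge> 0 \<Longrightarrow> Q (r *\<^sub>R cis t) = r * q t" and \<delta>: "\<delta> > 0"
    and n: "n > 0" and z: "z (2 * n) = z 0 + 2 * pi" "\<And>k. k < 2 * n \<Longrightarrow> z k < z (Suc k)"
      "\<And>k. k \<le> 2 * n \<Longrightarrow> q (z k) = 0"
      "\<And>k t. k < 2 * n \<Longrightarrow> z k < t \<Longrightarrow> t < z (Suc k) \<Longrightarrow> (-1) ^ k * q t > 0"
  defines "N \<equiv> {w \<in> ball 0 \<delta>. Q w \<le> 0}"
  shows "homology_free_of_rank 1 (n - 1) (top_of_set N) (N - {0})"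
proof -
  have z2: "\<forall>k<2 * n. z k < z (Suc k)" using z(2) by blast
  have zle: "z i \<le> z j" if "i \<le> j" "j \<le> 2 * n" for i j by (rule increasing_le[OF z2 that])
  have zless: "z i < z j" if "i < j" "j \<le> 2 * n" for i j
    using zle[of "Suc i" j] z(2)[of i] that by fastforce
  have Q0: "Q 0 = 0" using Q[of 0 0] by simp
  define B where "B i = {r *\<^sub>R cis t | r t. 0 < r \<and> r < \<delta> \<and> z (2 * i + 1) \<le> t \<and> t \<le> z (2 * i + 2)}" for i
  have qneg: "q t \<le> 0" if i: "i < n" and t: "z (2 * i + 1) \<le> t" "t \<le> z (2 * i + 2)" for i t
  proof -
    consider "t = z (2 * i + 1)" | "t = z (2 * i + 2)" | "z (2 * i + 1) < t" "t < z (Suc (2 * i + 1))" using t by force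
    then show ?thesis
    proof cases
      case 3
      then show ?thesis using z(4)[of "2 * i + 1" t] i by simp
    qed (use z(3)[of "2 * i + 1"] z(3)[of "2 * i + 2"] i in auto)
  qed
  have U: "N - {0} = (\<Union>i<n. B i)"
  proof
    show "N - {0} \<subseteq> (\<Union>i<n. B i)"
    proof
      fix w assume w: "w \<in> N - {0}"
      obtain t where t: "z 0 \<le> t" "t < z 0 + 2 * pi" "w = norm w *\<^sub>R cis t" using polar_from by blast
      have r: "0 < norm w" "norm w < \<delta>" using w by (auto simp: N_def)
      have "norm w * q t \<le> 0" using w Q[of "norm w" t] t(3) by (simp add: N_def)
      then have qt: "q t \<le> 0" using r by (simp add: mult_le_0_iff)
      have inB: "w \<in> B i" if "z (2 * i + 1) \<le> s" "s \<le> z (2 * i + 2)" "cis s = cis t" for i s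
        unfolding B_def mem_Collect_eq by (rule exI[of _ "norm w"], rule exI[of _ s]) (use that r t(3) in simp)
      obtain k where k: "k < 2 * n" "z k \<le> t" "t \<le> z (Suc k)"
        using locate_interval[of z t "2 * n"] t z(1) n by auto
      show "w \<in> (\<Union>i<n. B i)"
      proof (cases "odd k")
        case True
        then obtain i where i: "k = 2 * i + 1" by (rule oddE)
        then show ?thesis using k inB[of i t] by auto
      next
        case False
        then obtain i where i: "k = 2 * i" by (auto elim: evenE)
        have "t = z k \<or> t = z (Suc k)" using z(4)[OF k(1), of t] qt False k by fastforce
        then show ?thesis
        proof
          assume "t = z (Suc k)"
          then show ?thesis using k i inB[of i t] zle[of "2 * i + 1" "2 * i + 2"] by auto
        next
          assume tk: "t = z k"
          show ?thesis
          proof (cases i)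
            \<comment> \<open>The ray of angle \<open>z 0\<close> closes the last negative arc,
              whose end is \<open>z (2 * n) = z 0 + 2 * pi\<close>.\<close>
            case 0
            have "cis (z 0 + 2 * pi) = cis (z 0)" by (simp flip: cis_mult)
            have e: "2 * (n - 1) + 2 = 2 * n" using n by simp
            have "w \<in> B (n - 1)"
            proof (rule inB)
              show "z (2 * (n - 1) + 1) \<le> z (2 * n)" using n by (intro zle) auto
              show "z (2 * n) \<le> z (2 * (n - 1) + 2)" unfolding e by simp
              show "cis (z (2 * n)) = cis t" using \<open>cis (z 0 + 2 * pi) = cis (z 0)\<close> tk i 0 z(1) by simp
            qed
            then show ?thesis using n by auto
          next
            case (Suc j)
            then have "w \<in> B j" using inB[of j t] zle[of "2 * j + 1" "2 * j + 2"] tk i k by auto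
            then show ?thesis using Suc i k by auto
          qed
        qed
      qed
    qed
    show "(\<Union>i<n. B i) \<subseteq> N - {0}"
      using qneg Q by (force simp: B_def N_def mult_nonneg_nonpos)
  qed
  have per: "False" if "cis s = cis t" "s < t" "t < s + 2 * pi" for s t
  proof -
    have "cis (t - s) = 1" using that(1) by (simp add: cis_divide[symmetric])
    then have "cos (t - s) = 1" by (metis cis.sel(1) one_complex.sel(1))
    then obtain k :: int where k: "t - s = of_int k * 2 * pi" unfolding cos_one_2pi_int by blast
    then have "of_int k * (2 * pi) = t - s" by simp
    then have "0 < of_int k * (2 * pi)" "of_int k * (2 * pi) < 1 * (2 * pi)" using that(2,3) by linarith+
    then have "0 < real_of_int k" "real_of_int k < 1"
      by (simp_all only: zero_less_mult_iff mult_less_cancel_right) (use pi_gt_zero in auto)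
    then show False by simp
  qed
  have disj: "B i \<inter> B j = {}" if ij: "i < j" "j < n" for i j
  proof (rule ccontr)
    assume "B i \<inter> B j \<noteq> {}"
    then obtain w where "w \<in> B i" "w \<in> B j" by blast
    then obtain r t r' t' where w: "w = r *\<^sub>R cis t" "0 < r" "z (2 * i + 1) \<le> t" "t \<le> z (2 * i + 2)"
      "w = r' *\<^sub>R cis t'" "0 < r'" "z (2 * j + 1) \<le> t'" "t' \<le> z (2 * j + 2)" unfolding B_def by blast
    have "norm w = r" unfolding w(1) using w(2) by simp
    moreover have "norm w = r'" unfolding w(5) using w(6) by simp
    ultimately have "cis t = cis t'" using w(1,2,5) by simp
    moreover have "t < t'" using w zless[of "2 * i + 2" "2 * j + 1"] ij by simp
    moreover have "t' < t + 2 * pi"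
      using w zless[of 0 "2 * i + 1"] zle[of "2 * j + 2" "2 * n"] z(1) ij by simp
    ultimately show False using per by blast
  qed
  have clo: "closedin (top_of_set (N - {0})) (B i)" if i: "i < n" for i
  proof -
    define C where "C = (\<lambda>(r, t). r *\<^sub>R cis t) ` ({0..\<delta>} \<times> {z (2 * i + 1)..z (2 * i + 2)})"
    have "compact C"
      unfolding C_def case_prod_unfold by (intro compact_continuous_image continuous_intros compact_Times) auto
    moreover have "B i = (N - {0}) \<inter> C"
    proof
      show "B i \<subseteq> (N - {0}) \<inter> C"
      proof
        fix w assume w: "w \<in> B i"
        then have "w \<in> N - {0}" using U i by blast
        moreover have "w \<in> C" using w by (force simp: B_def C_def)
        ultimately show "w \<in> (N - {0}) \<inter> C" by blast
      qed
      show "(N - {0}) \<inter> C \<subseteq> B i"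
      proof
        fix w assume w: "w \<in> (N - {0}) \<inter> C"
        then obtain r t where rt: "w = r *\<^sub>R cis t" "0 \<le> r" "z (2 * i + 1) \<le> t" "t \<le> z (2 * i + 2)" by (auto simp: C_def)
        have "w \<noteq> 0" "norm w < \<delta>" using w by (auto simp: N_def)
        then have "0 < r" "r < \<delta>" using rt by auto
        then show "w \<in> B i" using rt by (auto simp: B_def)
      qed
    qed
    ultimately show ?thesis using compact_imp_closed closedin_closed_Int by metis
  qed
  \<comment> \<open>Each of the finitely many disjoint sectors is closed in the punctured cone,
    hence each is also open, being the complement of the others.\<close>
  have op: "openin (top_of_set (N - {0})) (B i)" if i: "i < n" for i
  proof -
    have "closedin (top_of_set (N - {0})) (\<Union>j\<in>{..<n} - {i}. B j)"
      by (intro closedin_Union) (use clo in auto)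
    moreover have "(N - {0}) - (\<Union>j\<in>{..<n} - {i}. B j) = B i"
    proof -
      have "B i \<inter> B j = {}" if "j \<in> {..<n} - {i}" for j
        using disj[of i j] disj[of j i] that i by (cases "i < j") auto
      then show ?thesis unfolding U using i by blast
    qed
    ultimately show ?thesis using openin_diff[OF openin_topspace] by (metis topspace_euclidean_subtopology)
  qed
  have lt: "z (2 * i + 1) < z (2 * i + 2)" "z (2 * i + 2) < z (2 * i + 1) + 2 * pi" if "i < n" for i
    using zless[of "2 * i + 1" "2 * i + 2"] zless[of 0 "2 * i + 1"] zle[of "2 * i + 2" "2 * n"] z(1) that by auto
  have star: "closed_segment 0 w \<subseteq> N" if w: "w \<in> N" for w
  proof
    fix y assume "y \<in> closed_segment 0 w"
    then obtain s where s: "0 \<le> s" "s \<le> 1" "y = s *\<^sub>R w" by (auto simp: in_segment)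
    obtain t where t: "w = norm w *\<^sub>R cis t" using polar_from by blast
    have y: "y = (s * norm w) *\<^sub>R cis t" using s(3) t by (metis scaleR_scaleR)
    have "Q y = s * Q w" unfolding y using Q[of "s * norm w" t] Q[of "norm w" t] t s by simp
    moreover have "norm y \<le> norm w" unfolding s(3) using s by (simp add: mult_left_le_one_le)
    ultimately show "y \<in> N" using w s by (auto simp: N_def mult_nonneg_nonpos)
  qed
  have "0 \<in> N" using \<delta> Q0 by (simp add: N_def)
  then have "contractible N" using star by (intro starlike_imp_contractible) (auto simp: starlike_def)
  then show ?thesis
  proof (rule homology_free_of_rank_pieces[OF _ \<open>0 \<in> N\<close> n U])
    show "B i \<inter> B j = {}" if "i < n" "j < n" "i \<noteq> j" for i j
      using disj[of i j] disj[of j i] that by (cases "i < j") auto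
    show "B i \<noteq> {}" if "i < n" for i
    proof -
      have "(\<delta> / 2) *\<^sub>R cis (z (2 * i + 1)) \<in> B i" 
        unfolding B_def mem_Collect_eq
        by (rule exI[of _ "\<delta> / 2"], rule exI[of _ "z (2 * i + 1)"]) (use lt[OF that] \<delta> in simp)
      then show ?thesis by blast
    qed
    show "contractible (B i)" if "i < n" for i
      unfolding B_def using lt[OF that] by (intro sector_piece_contractible) auto
  qed (use op in auto)
qed

end

section \<open>The model germs for one and two negative sectors\<close>

definition saddle_profile :: "real \<Rightarrow> real" where
  "saddle_profile t = \<bar>sin t\<bar> - \<bar>cos t\<bar>"

text \<open>The profile is \<open>\<bar>y\<bar> - \<bar>x\<bar>\<close> on the unit circle, and a
  quarter turn exchanges the two absolute values. All zeros, kinks and signs follow from those on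
  one quarter.\<close>

lemma saddle_profile_shift: "saddle_profile (t + real k * pi / 2) = (-1) ^ k * saddle_profile t"
proof (induction k)
  case (Suc k)
  have "saddle_profile (u + pi / 2) = - saddle_profile u" for u
    by (simp add: saddle_profile_def sin_add cos_add)
  moreover have "t + real (Suc k) * pi / 2 = (t + real k * pi / 2) + pi / 2" by (simp add: field_simps)
  ultimately have "saddle_profile (t + real (Suc k) * pi / 2) = - saddle_profile (t + real k * pi / 2)" by (simp only:)
  then show ?case unfolding Suc by simp
qed simp

text \<open>The zeros are the odd multiples of \<open>pi / 4\<close> and the kinks the multiples of
  \<open>pi / 2\<close>, so no kink lies inside these arcs. The first two fill a quarter turn, and
  quarter turns produce the rest.\<close>

lemma saddle_profile_trig_linear:
  "trig_linear saddle_profile (pi / 4 + real j * pi / 4) (pi / 4 + real (Suc j) * pi / 4)"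
proof -
  have base: "trig_linear saddle_profile (pi / 4) (pi / 2)" "trig_linear saddle_profile (pi / 2) (3 * pi / 4)"
    unfolding trig_linear_def saddle_profile_def
  proof -
    have "\<bar>sin t\<bar> - \<bar>cos t\<bar> = (-1) * cos t + 1 * sin t" if "t \<in> {pi/4..pi/2}" for t
    proof -
      have "sin t \<ge> 0" "cos t \<ge> 0" using that by (auto intro!: sin_ge_zero cos_ge_zero)
      then show ?thesis by simp
    qed
    then show "\<exists>A B. \<forall>t\<in>{pi/4..pi/2}. \<bar>sin t\<bar> - \<bar>cos t\<bar> = A * cos t + B * sin t" by blast
    have "\<bar>sin t\<bar> - \<bar>cos t\<bar> = 1 * cos t + 1 * sin t" if "t \<in> {pi/2..3*pi/4}" for t
    proof -
      have "sin t \<ge> 0" using that by (auto intro!: sin_ge_zero)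
      moreover have "cos t \<le> 0"
      proof -
        have "cos (pi - t) \<ge> 0" using that by (intro cos_ge_zero) auto
        then show ?thesis by simp
      qed
      ultimately show ?thesis by simp
    qed
    then show "\<exists>A B. \<forall>t\<in>{pi/2..3*pi/4}. \<bar>sin t\<bar> - \<bar>cos t\<bar> = A * cos t + B * sin t" by blast
  qed
  have shift: "trig_linear saddle_profile (a + real k * pi / 2) (b + real k * pi / 2)" if ab: "trig_linear saddle_profile a b" for a b k
  proof -
    obtain A B where AB: "\<And>t. a \<le> t \<Longrightarrow> t \<le> b \<Longrightarrow> saddle_profile t = A * cos t + B * sin t"
      using ab by (auto simp: trig_linear_def)
    let ?c = "real k * pi / 2"
    have "saddle_profile t = ((-1) ^ k * (A * cos ?c - B * sin ?c)) * cos t + ((-1) ^ k * (A * sin ?c + B * cos ?c)) * sin t"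
      if "t \<in> {a + ?c..b + ?c}" for t
    proof -
      have "saddle_profile t = (-1) ^ k * saddle_profile (t - ?c)" using saddle_profile_shift[of "t - ?c" k] by simp
      also have "saddle_profile (t - ?c) = A * cos (t - ?c) + B * sin (t - ?c)" using that by (intro AB) auto
      finally show ?thesis by (simp add: cos_diff sin_diff algebra_simps)
    qed
    then show ?thesis unfolding trig_linear_def by blast
  qed
  show ?thesis
  proof (cases "even j")
    case True
    then obtain k where "j = 2 * k" by blast
    then have "pi / 4 + real j * pi / 4 = pi / 4 + real k * pi / 2" "pi / 4 + real (Suc j) * pi / 4 = pi / 2 + real k * pi / 2"
      by (simp_all add: field_simps)
    then show ?thesis using shift[OF base(1), of k] by (simp only:)
  next
    case False
    then obtain k where "j = 2 * k + 1" by (rule oddE)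
    then have "pi / 4 + real j * pi / 4 = pi / 2 + real k * pi / 2" "pi / 4 + real (Suc j) * pi / 4 = 3 * pi / 4 + real k * pi / 2"
      by (simp_all add: field_simps)
    then show ?thesis using shift[OF base(2), of k] by (simp only:)
  qed
qed

lemma saddle_profile_sign:
  assumes "pi / 4 < t" "t < 3 * pi / 4" shows "saddle_profile t > 0"
proof -
  have "sin t > 0" using assms by (intro sin_gt_zero) auto
  moreover have "\<bar>cos t\<bar> < sin t"
  proof -
    \<comment> \<open>Rotation by \<open>pi / 4\<close> turns the comparison of \<open>sin t\<close>
      with \<open>cos t\<close> and \<open>- cos t\<close> into the sign of a sine on an interval
      inside \<open>(0, pi)\<close>.\<close>
    have "sin (t - pi / 4) = sqrt 2 / 2 * (sin t - cos t)" "sin (t + pi / 4) = sqrt 2 / 2 * (sin t + cos t)"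
      unfolding sin_diff sin_add sin_45 cos_45 by (simp_all add: algebra_simps)
    moreover have "sin (t - pi / 4) > 0" "sin (t + pi / 4) > 0"
      using assms by (auto intro!: sin_gt_zero)
    ultimately have "0 < sqrt 2 / 2 * (sin t - cos t)" "0 < sqrt 2 / 2 * (sin t + cos t)" by (simp_all only:)
    then have "cos t < sin t" "- cos t < sin t" by (simp_all add: zero_less_mult_iff)
    then show ?thesis by linarith
  qed
  ultimately show ?thesis by (simp add: saddle_profile_def)
qed

text \<open>The model is the height \<open>Im\<close>, whose profile \<open>sin\<close> turns
  positive at angle 0; hence the phase 0.\<close>

lemma (in pl_circle) regular_form:
  assumes "z 2 = z 0 + 2 * pi" "\<And>k. k < 2 \<Longrightarrow> z k < z (Suc k)" "\<And>k. k \<le> 2 \<Longrightarrow> q (z k) = 0"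
      "\<And>k t. k < 2 \<Longrightarrow> z k < t \<Longrightarrow> t < z (Suc k) \<Longrightarrow> (-1) ^ k * q t > 0"
    and Q: "\<And>r t. r \<ge> 0 \<Longrightarrow> Q (r *\<^sub>R cis t) = r * q t"
  obtains \<Phi> \<Psi> :: "complex \<Rightarrow> complex" where "PL_homeomorphism UNIV UNIV \<Phi> \<Psi>" "\<Phi> 0 = 0" "\<And>w. Q w = Im (\<Phi> w)"
proof (rule normal_form[of 1 z sin 0 Q Im])
  show "trig_linear sin (0 + real j * pi / real (2 * 1)) (0 + real (Suc j) * pi / real (2 * 1))" for j
    unfolding trig_linear_def by (intro exI[of _ 0] exI[of _ 1]) simp
  show "sin (0 + real k * pi / real 1) = 0" for k by simp
  show "0 < (- 1) ^ k * sin t" if "k < 2 * 1" "0 + real k * pi / real 1 < t" "t < 0 + real (Suc k) * pi / real 1" for k t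
  proof (cases "k = 0")
    case False
    then have "k = 1" using that by simp
    then have "sin (t - pi) > 0" using that by (intro sin_gt_zero) auto
    then show ?thesis using \<open>k = 1\<close> by simp
  qed (use that in \<open>auto intro: sin_gt_zero\<close>)
qed (use assms that in auto)

text \<open>The phase is \<open>pi / 4\<close> because the positive sector of the model about the
  positive imaginary axis begins there, to be matched with \<open>z 0\<close>, where
  \<open>q\<close> turns positive.\<close>

lemma (in pl_circle) saddle_form:
  assumes "z 4 = z 0 + 2 * pi" "\<And>k. k < 4 \<Longrightarrow> z k < z (Suc k)" "\<And>k. k \<le> 4 \<Longrightarrow> q (z k) = 0"
      "\<And>k t. k < 4 \<Longrightarrow> z k < t \<Longrightarrow> t < z (Suc k) \<Longrightarrow> (-1) ^ k * q t > 0"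
    and Q: "\<And>r t. r \<ge> 0 \<Longrightarrow> Q (r *\<^sub>R cis t) = r * q t"
  obtains \<Phi> \<Psi> :: "complex \<Rightarrow> complex" where "PL_homeomorphism UNIV UNIV \<Phi> \<Psi>" "\<Phi> 0 = 0"
    "\<And>w. Q w = \<bar>Im (\<Phi> w)\<bar> - \<bar>Re (\<Phi> w)\<bar>"
proof (rule normal_form[of 2 z saddle_profile "pi / 4" Q "\<lambda>w. \<bar>Im w\<bar> - \<bar>Re w\<bar>"])
  show "trig_linear saddle_profile (pi / 4 + real j * pi / real (2 * 2)) (pi / 4 + real (Suc j) * pi / real (2 * 2))" for j
    using saddle_profile_trig_linear[of j] by simp
  show "saddle_profile (pi / 4 + real k * pi / real 2) = 0" for k
    using saddle_profile_shift[of "pi / 4" k] by (simp add: saddle_profile_def sin_45 cos_45)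
  show "0 < (- 1) ^ k * saddle_profile t"
    if "k < 2 * 2" "pi / 4 + real k * pi / real 2 < t" "t < pi / 4 + real (Suc k) * pi / real 2" for k t
  proof -
    have "saddle_profile (t - real k * pi / 2) > 0" using that by (intro saddle_profile_sign) (auto simp: field_simps)
    moreover have "saddle_profile t = (-1) ^ k * saddle_profile (t - real k * pi / 2)"
      using saddle_profile_shift[of "t - real k * pi / 2" k] by simp
    ultimately show ?thesis by (simp flip: mult.assoc power_add power_mult_distrib)
  qed
  show "\<bar>Im (r *\<^sub>R cis t)\<bar> - \<bar>Re (r *\<^sub>R cis t)\<bar> = r * saddle_profile t" if "0 \<le> r" for r t
    using that by (simp add: saddle_profile_def abs_mult algebra_simps)
qed (use assms that in auto)

section \<open>From germs back to the surface\<close>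

lemma PL_chart_at_plane:
  assumes U: "openin (top_of_set M) U" "v \<in> U" "\<phi> v = 0" "PL_homeomorphism U (ball (0::complex) \<delta>) \<phi> \<psi>"
    and \<Phi>: "PL_homeomorphism UNIV UNIV \<Phi> \<Psi>" "\<Phi> 0 = 0"
  shows "PL_chart_at M v U (\<lambda>x. complex_plane (\<Phi> (\<phi> x)))"
proof -
  have "PL_homeomorphism UNIV UNIV (\<lambda>z. complex_plane z + 0) (\<lambda>x. plane_complex x + - plane_complex 0)"
    by (rule PL_homeomorphism_affine) (simp_all add: linear_plane_complex linear_complex_plane)
  then have "PL_homeomorphism UNIV UNIV complex_plane plane_complex"
    by (simp add: linear_0[OF linear_plane_complex])
  from PL_homeomorphism_trans[OF \<Phi>(1) this]
  have H: "PL_homeomorphism UNIV UNIV (\<lambda>z. complex_plane (\<Phi> z)) (\<lambda>x. \<Psi> (plane_complex x))" .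
  let ?H = "\<lambda>z. complex_plane (\<Phi> z)"
  have o: "openin (top_of_set UNIV) (ball (0::complex) \<delta>)" by simp
  note R = PL_homeomorphism_restrict[OF PL_homeomorphism_sym[OF H] o]
  have "PL_homeomorphism U (?H ` ball 0 \<delta>) (\<lambda>x. ?H (\<phi> x)) (\<lambda>y. \<psi> (\<Psi> (plane_complex y)))"
    by (rule PL_homeomorphism_trans[OF U(4) PL_homeomorphism_sym[OF R(1)]])
  moreover have "open (?H ` ball 0 \<delta>)" using R(2) by simp
  moreover have "?H (\<phi> v) = 0" by (simp add: U(3) \<Phi>(2) linear_0[OF linear_complex_plane])
  ultimately show ?thesis using U(1,2) unfolding PL_chart_at_def by blast
qed

text \<open>The cases are those of \<open>sign_structure\<close> for the germ at \<open>v\<close>.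
  The last one includes \<open>n = 1\<close>, a single negative sector, where the rank
  \<open>n - 1\<close> is zero: these are the regular vertices.\<close>

lemma vertex_classification:
  fixes K :: "'a::euclidean_space set set"
  assumes M: "PL_manifold TYPE(2) K" and f: "generic_PL K f" and v: "v \<in> vertices K"
  defines "Y \<equiv> sublevel K f (f v)"
  obtains (minimum) "homology_free_of_rank 0 1 (top_of_set Y) (Y - {v})" "local_minimum K f v"
  | (maximum) "homology_free_of_rank 2 1 (top_of_set Y) (Y - {v})" "local_maximum K f v"
  | (saddle) n where "n > 0" "homology_free_of_rank 1 (n - 1) (top_of_set Y) (Y - {v})"
      "\<not> local_minimum K f v" "\<not> local_maximum K f v"
      "n = 1 \<Longrightarrow> strongly_regular TYPE(2) K f v" "n = 2 \<Longrightarrow> nondegenerate_critical TYPE(2) K f v 1"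
proof -
  obtain U \<phi> \<psi> \<delta> q Q where \<delta>: "\<delta> > 0" and U: "openin (top_of_set (\<Union>K)) U" "v \<in> U" "\<phi> v = 0"
    and hom: "PL_homeomorphism U (ball (0::complex) \<delta>) \<phi> \<psi>" and q: "pl_circle q"
    and Q: "\<And>r t. r \<ge> 0 \<Longrightarrow> Q (r *\<^sub>R cis t) = r * q t" and fQ: "\<And>x. x \<in> U \<Longrightarrow> f x = f v + Q (\<phi> x)"
    using vertex_germ[OF M f v] by metis
  interpret pl_circle q by (rule q)
  obtain W where W: "open W" "U = \<Union>K \<inter> W" using U(1) by (auto simp: openin_open)
  have h: "homeomorphism U (ball 0 \<delta>) \<phi> \<psi>" using hom by (simp add: PL_homeomorphism_def)
  define N where "N = {w \<in> ball 0 \<delta>. Q w \<le> 0}"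
  define Y' where "Y' = Y \<inter> U"
  \<comment> \<open>Excision replaces the sublevel set by its part in the chart domain, and the
    chart identifies that part with the cone \<open>N\<close>.\<close>
  have red: "homology_free_of_rank k m (top_of_set Y) (Y - {v})"
    if "homology_free_of_rank k m (top_of_set N) (N - {0})" for k m
  proof (rule homology_free_of_rank_excision)
    have "Y' = Y \<inter> W" using W by (auto simp: Y'_def Y_def sublevel_def)
    then show "openin (top_of_set Y) Y'" using W(1) by (metis openin_open_Int)
    show "v \<in> Y'" using U W by (auto simp: Y'_def Y_def sublevel_def)
    have "\<phi> ` Y' = N"
    proof
      show "\<phi> ` Y' \<subseteq> N" using h fQ by (auto simp: Y'_def Y_def sublevel_def N_def homeomorphism_def)
      show "N \<subseteq> \<phi> ` Y'"
      proof
        fix w assume w: "w \<in> N"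
        then have "\<psi> w \<in> U" "\<phi> (\<psi> w) = w" using h by (auto simp: homeomorphism_def N_def)
        moreover from this have "\<psi> w \<in> Y'" using fQ[of "\<psi> w"] w W by (auto simp: Y'_def Y_def sublevel_def N_def)
        ultimately show "w \<in> \<phi> ` Y'" by force
      qed
    qed
    then have "homeomorphism Y' N \<phi> \<psi>"
      by (intro homeomorphism_of_subsets[OF h]) (auto simp: Y'_def N_def)
    then show "homology_free_of_rank k m (top_of_set Y') (Y' - {v})"
      by (rule homology_free_of_rank_homeomorphism) (use \<open>v \<in> Y'\<close> that U(3) in auto)
  qed
  have pol: "\<exists>t. Q w = norm w * q t" for w
    using polar_from[of 0 w] Q[of "norm w"] by (metis norm_ge_zero)
  show thesis
  proof (rule sign_structure)
    assume pos: "\<And>t. q t > 0"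
    have Qp: "Q w > 0" if "w \<noteq> 0" for w using pol[of w] pos that by auto
    have Q0: "Q 0 = 0" using pol[of 0] by auto
    have "N = {0}" using Qp Q0 \<delta> by (force simp: N_def)
    then have "homology_free_of_rank 0 1 (top_of_set Y) (Y - {v})"
      using homology_free_of_rank_point[of "0::complex"] by (intro red) simp
    moreover have "local_minimum K f v"
      unfolding local_minimum_def
    proof (intro exI[of _ W] conjI ballI)
      show "v \<in> W" using U(2) W(2) by blast
      fix x assume "x \<in> \<Union>K \<inter> W"
      then show "f v \<le> f x" using fQ[of x] W(2) Qp[of "\<phi> x"] Q0 by (cases "\<phi> x = 0") auto
    qed (rule W(1))
    ultimately show thesis by (rule minimum)
  next
    assume neg: "\<And>t. q t < 0"
    have Qn: "Q w \<le> 0" for w using pol[of w] neg by (metis less_imp_le mult_nonneg_nonpos norm_ge_zero)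
    have "N = ball 0 \<delta>" using Qn by (auto simp: N_def)
    then have "homology_free_of_rank 2 1 (top_of_set Y) (Y - {v})"
      using homology_free_of_rank_disc[OF \<delta>] by (intro red) simp
    moreover have "local_maximum K f v"
      unfolding local_maximum_def
    proof (intro exI[of _ W] conjI ballI)
      show "v \<in> W" using U(2) W(2) by blast
      fix x assume "x \<in> \<Union>K \<inter> W"
      then show "f x \<le> f v" using fQ[of x] W(2) Qn[of "\<phi> x"] by auto
    qed (rule W(1))
    ultimately show thesis by (rule maximum)
  next
    fix n z assume n: "n > 0" and z: "z (2 * n) = z 0 + 2 * pi" "\<And>k. k < 2 * n \<Longrightarrow> z k < z (Suc k)"
      "\<And>k. k \<le> 2 * n \<Longrightarrow> q (z k) = 0"
      "\<And>k t. k < 2 * n \<Longrightarrow> z k < t \<Longrightarrow> t < z (Suc k) \<Longrightarrow> (-1) ^ k * q t > 0"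
    have H: "homology_free_of_rank 1 (n - 1) (top_of_set Y) (Y - {v})"
      using negative_cone_homology[OF Q \<delta> n z] by (intro red) (simp add: N_def)
    \<comment> \<open>Along the ray of angle \<open>t\<close>, points arbitrarily close to
      \<open>v\<close> have \<open>f - f v\<close> a positive multiple of \<open>q t\<close>; since
      \<open>q\<close> takes both signs, \<open>v\<close> is no extremum.\<close>
    have near: "\<exists>x\<in>\<Union>K \<inter> O'. \<exists>r>0. f x = f v + r * q t" if O': "open O'" "v \<in> O'" for O' t
    proof -
      have "openin (top_of_set (ball 0 \<delta>)) (ball 0 \<delta> \<inter> \<psi> -` O')"
        using h O'(1) by (intro continuous_openin_preimage_gen) (simp add: homeomorphism_def)
      then have "open (ball 0 \<delta> \<inter> \<psi> -` O')" by (simp add: openin_open_eq)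
      moreover have "\<psi> 0 = v" using h U by (metis homeomorphism_def)
      then have "0 \<in> ball 0 \<delta> \<inter> \<psi> -` O'" using \<delta> O'(2) by simp
      ultimately obtain e where e: "e > 0" "ball 0 e \<subseteq> ball 0 \<delta> \<inter> \<psi> -` O'" by (meson open_contains_ball)
      let ?w = "(e / 2) *\<^sub>R cis t"
      have "?w \<in> ball 0 e" using e(1) by simp
      then have w: "?w \<in> ball 0 \<delta>" "\<psi> ?w \<in> O'" using e(2) by blast+
      then have x: "\<psi> ?w \<in> U" "\<phi> (\<psi> ?w) = ?w" using h by (auto simp: homeomorphism_def)
      have "f (\<psi> ?w) = f v + (e / 2) * q t" using fQ[OF x(1)] Q[of "e / 2" t] e(1) by (simp add: x(2))
      then show ?thesis using w(2) x(1) W(2) e(1) by (intro bexI[of _ "\<psi> ?w"] exI[of _ "e / 2"]) auto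
    qed
    have qp: "q ((z 0 + z 1) / 2) > 0" using z(4)[of 0 "(z 0 + z 1) / 2"] z(2)[of 0] n by simp
    have qn: "q ((z 1 + z 2) / 2) < 0" using z(4)[of 1 "(z 1 + z 2) / 2"] z(2)[of 1] n by (simp add: numeral_2_eq_2)
    have nmin: "\<not> local_minimum K f v"
    proof
      assume "local_minimum K f v"
      then obtain O' where O': "open O'" "v \<in> O'" "\<forall>x\<in>\<Union>K \<inter> O'. f v \<le> f x" unfolding local_minimum_def by blast
      obtain x r where xr: "x \<in> \<Union>K \<inter> O'" "r > 0" "f x = f v + r * q ((z 1 + z 2) / 2)" using near[OF O'(1,2)] by blast
      then show False using O'(3) mult_pos_neg[OF xr(2) qn] by force
    qed
    have nmax: "\<not> local_maximum K f v"
    proof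
      assume "local_maximum K f v"
      then obtain O' where O': "open O'" "v \<in> O'" "\<forall>x\<in>\<Union>K \<inter> O'. f x \<le> f v" unfolding local_maximum_def by blast
      obtain x r where xr: "x \<in> \<Union>K \<inter> O'" "r > 0" "f x = f v + r * q ((z 0 + z 1) / 2)" using near[OF O'(1,2)] by blast
      then show False using O'(3) mult_pos_pos[OF xr(2) qp] by force
    qed
    show thesis
    proof (rule saddle[OF n H nmin nmax])
      assume n1: "n = 1"
      obtain \<Phi> \<Psi> :: "complex \<Rightarrow> complex" where \<Phi>: "PL_homeomorphism UNIV UNIV \<Phi> \<Psi>" "\<Phi> 0 = 0" "\<And>w. Q w = Im (\<Phi> w)"
        by (rule regular_form[of z Q]) (use z Q n1 in auto)
      have "PL_chart_at (\<Union>K) v U (\<lambda>x. complex_plane (\<Phi> (\<phi> x)))"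
        by (rule PL_chart_at_plane[OF U hom \<Phi>(1,2)])
      moreover have "\<forall>x\<in>U. f x = f v + complex_plane (\<Phi> (\<phi> x)) $ 2"
        using fQ \<Phi>(3) by (simp add: complex_plane_def)
      ultimately show "strongly_regular TYPE(2) K f v" unfolding strongly_regular_def by blast
    next
      assume n2: "n = 2"
      obtain \<Phi> \<Psi> :: "complex \<Rightarrow> complex" where \<Phi>: "PL_homeomorphism UNIV UNIV \<Phi> \<Psi>" "\<Phi> 0 = 0"
        "\<And>w. Q w = \<bar>Im (\<Phi> w)\<bar> - \<bar>Re (\<Phi> w)\<bar>"
        by (rule saddle_form[of z Q]) (use z Q n2 in auto)
      have "PL_chart_at (\<Union>K) v U (\<lambda>x. complex_plane (\<Phi> (\<phi> x)))"
        by (rule PL_chart_at_plane[OF U hom \<Phi>(1,2)])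
      \<comment> \<open>The real part, coordinate 1, carries the minus sign of the model, so it
        alone forms the index set and the index is 1.\<close>
      moreover have "- {1 :: 2} = {2}" by (simp add: set_eq_iff forall_2)
      then have "\<forall>x\<in>U. f x = f v - (\<Sum>i\<in>{1}. \<bar>complex_plane (\<Phi> (\<phi> x)) $ i\<bar>) + (\<Sum>i\<in>-{1}. \<bar>complex_plane (\<Phi> (\<phi> x)) $ i\<bar>)"
        using fQ \<Phi>(3) by (simp add: complex_plane_def)
      moreover have "card {1 :: 2} = 1" by simp
      ultimately show "nondegenerate_critical TYPE(2) K f v 1" unfolding nondegenerate_critical_def by blast
    qed
  qed
qed

theorem proposition8p2:
  fixes K :: "'a::euclidean_space set set"
    and f :: "'a \<Rightarrow> real"
    and F :: "('k, 'm) ring_scheme"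
  assumes "PL_manifold TYPE(2) K"
    and "generic_PL K f"
    and "field F"
  shows "(\<forall>v\<in>vertices K. H_critical F K f v \<longrightarrow>
            (local_minimum K f v \<and>
             (\<forall>k. H_critical_of_index F K f v k \<longleftrightarrow> k = 0) \<and>
             multiplicity_of_index F K f v 0 = 1) \<or>
            (local_maximum K f v \<and>
             (\<forall>k. H_critical_of_index F K f v k \<longleftrightarrow> k = 2) \<and>
             multiplicity_of_index F K f v 2 = 1) \<or>
            (saddle_point F K f v \<and>
             (\<forall>k. H_critical_of_index F K f v k \<longleftrightarrow> k = 1) \<and>
             (\<exists>m::nat. multiplicity_of_index F K f v 1 = enat m))) \<and>
         (\<forall>v\<in>vertices K. H_regular K f v \<longrightarrow> strongly_regular TYPE(2) K f v) \<and>
         (\<forall>v\<in>vertices K. saddle_point F K f v \<and> total_multiplicity F K f v = 1 \<longrightarrow>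
            (\<exists>k. nondegenerate_critical TYPE(2) K f v k))"
proof (intro conjI ballI impI)
  fix v assume v: "v \<in> vertices K" and crit: "H_critical F K f v"
  show "(local_minimum K f v \<and> (\<forall>k. H_critical_of_index F K f v k \<longleftrightarrow> k = 0) \<and>
             multiplicity_of_index F K f v 0 = 1) \<or>
            (local_maximum K f v \<and> (\<forall>k. H_critical_of_index F K f v k \<longleftrightarrow> k = 2) \<and>
             multiplicity_of_index F K f v 2 = 1) \<or>
            (saddle_point F K f v \<and> (\<forall>k. H_critical_of_index F K f v k \<longleftrightarrow> k = 1) \<and>
             (\<exists>m::nat. multiplicity_of_index F K f v 1 = enat m))" (is ?P)
  proof (rule vertex_classification[OF assms(1,2) v])
    assume "homology_free_of_rank 0 1 (top_of_set (sublevel K f (f v))) (sublevel K f (f v) - {v})" "local_minimum K f v"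
    then show ?P using vertex_homology_free[OF assms(3), of 0 1 K f v] by (simp add: one_enat_def)
  next
    assume "homology_free_of_rank 2 1 (top_of_set (sublevel K f (f v))) (sublevel K f (f v) - {v})" "local_maximum K f v"
    then show ?P using vertex_homology_free[OF assms(3), of 2 1 K f v] by (simp add: one_enat_def)
  next
    fix n :: nat assume saddle: "n > 0" "homology_free_of_rank 1 (n - 1) (top_of_set (sublevel K f (f v))) (sublevel K f (f v) - {v})"
      "\<not> local_minimum K f v" "\<not> local_maximum K f v"
      "n = 1 \<Longrightarrow> strongly_regular TYPE(2) K f v" "n = 2 \<Longrightarrow> nondegenerate_critical TYPE(2) K f v 1"
    have 1: "homology_free_of_rank (int 1) (n - 1) (top_of_set (sublevel K f (f v))) (sublevel K f (f v) - {v})"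
      using saddle(2) by simp
    note h = vertex_homology_free[OF assms(3) 1]
    \<comment> \<open>With \<open>n = 1\<close> all groups vanish, so criticality leaves
      \<open>n \<ge> 2\<close>.\<close>
    have "n - 1 \<noteq> 0" using crit h(3) by blast
    then have "\<forall>k. H_critical_of_index F K f v k \<longleftrightarrow> k = 1" using h(2) by blast
    moreover have "saddle_point F K f v" using v crit saddle by (simp add: saddle_point_def)
    moreover have "multiplicity_of_index F K f v 1 = enat (n - 1)" using h(1) by simp
    ultimately show ?P by blast
  qed
next
  fix v assume v: "v \<in> vertices K" and reg: "H_regular K f v"
  then have reg: "\<not> H_critical two_element_field K f v" using field_two_element_field by (simp add: H_regular_def)
  show "strongly_regular TYPE(2) K f v"
  proof (rule vertex_classification[OF assms(1,2) v])
    assume "homology_free_of_rank 0 1 (top_of_set (sublevel K f (f v))) (sublevel K f (f v) - {v})" "local_minimum K f v"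
    then show "strongly_regular TYPE(2) K f v" using vertex_homology_free(3)[OF field_two_element_field, of 0 1 K f v] reg by simp
  next
    assume "homology_free_of_rank 2 1 (top_of_set (sublevel K f (f v))) (sublevel K f (f v) - {v})" "local_maximum K f v"
    then show "strongly_regular TYPE(2) K f v" using vertex_homology_free(3)[OF field_two_element_field, of 2 1 K f v] reg by simp
  next
    fix n :: nat assume saddle: "n > 0" "homology_free_of_rank 1 (n - 1) (top_of_set (sublevel K f (f v))) (sublevel K f (f v) - {v})"
      "\<not> local_minimum K f v" "\<not> local_maximum K f v"
      "n = 1 \<Longrightarrow> strongly_regular TYPE(2) K f v" "n = 2 \<Longrightarrow> nondegenerate_critical TYPE(2) K f v 1"
    have "n - 1 = 0" using vertex_homology_free(3)[OF field_two_element_field, of 1 "n - 1" K f v] saddle(2) reg by simp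
    then show "strongly_regular TYPE(2) K f v" using saddle by simp
  qed
next
  fix v assume v: "v \<in> vertices K" and sad: "saddle_point F K f v \<and> total_multiplicity F K f v = 1"
  show "\<exists>k. nondegenerate_critical TYPE(2) K f v k"
  proof (rule vertex_classification[OF assms(1,2) v])
    fix n :: nat assume saddle: "n > 0" "homology_free_of_rank 1 (n - 1) (top_of_set (sublevel K f (f v))) (sublevel K f (f v) - {v})"
      "\<not> local_minimum K f v" "\<not> local_maximum K f v"
      "n = 1 \<Longrightarrow> strongly_regular TYPE(2) K f v" "n = 2 \<Longrightarrow> nondegenerate_critical TYPE(2) K f v 1"
    \<comment> \<open>The homology sits in degree 1 only, so the total multiplicity is the number of
      negative sectors minus one.\<close>
    have "enat (n - 1) = 1" using vertex_homology_free(4)[OF assms(3), of 1 "n - 1" K f v] saddle(2) sad by simp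
    then have "n = 2" using saddle(1) by (simp add: one_enat_def)
    then show "\<exists>k. nondegenerate_critical TYPE(2) K f v k" using saddle by blast
  qed (use sad in \<open>auto simp: saddle_point_def\<close>)
qed

end
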